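(* Let $0<q<1$ and $n\ge1$. On $\mathcal{H}_{(n)}=\mathcal{H}_n\oplus\mathcal{H}_n$, with $\mathcal{H}_n=\ell^2(\mathbb{N}^n)$, let $\mathcal{A}(\mathbb{C}\mathrm{P}^n_q)$ act by $\pi^{(n)}=\pi^{(n)}_+\oplus\pi^{(n)}_-$ (defined in the context), let $\gamma_{(n)}=1\oplus(-1)$, $F_{(n)}=\begin{pmatrix}0&1\\1&0\end{pmatrix}$, and let $D:=|D|F_{(n)}$, where $|D|$ is the diagonal operator acting on each copy of $\mathcal{H}_n$ by $$|D|\,|\underline m\rangle:=(m_1+\cdots+m_n)\,|\underline m\rangle .$$ Then $(\mathcal{A}(\mathbb{C}\mathrm{P}^n_q),\mathcal{H}_{(n)},\gamma_{(n)},D)$ is an even spectral triple of metric dimension $n$. That is: $D$ is self-adjoint with compact resolvent, $[D,\pi^{(n)}(a)]$ extends to a bounded operator for all $a\in\mathcal{A}(\mathbb{C}\mathrm{P}^n_q)$, $\gamma_{(n)}$ commutes with $\pi^{(n)}(a)$ and anticommutes with $D$, and the infimum of the $s>0$ for which $(1+D^2)^{-s/2}$ is of trace class equals $n$.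
   Context: $\mathbb{N}=\{0,1,2,\ldots\}$ and $0<q<1$. $\mathcal{A}(S^{2n+1}_q)$ is the unital complex $*$-algebra generated by $z_i,z_i^*$, $i=0,\ldots,n$, with relations: $z_iz_j=q^{-1}z_jz_i$ for $0\le i<j\le n$; $z_i^*z_j=qz_jz_i^*$ for $i\ne j$; $[z_i^*,z_i]=(1-q^2)\sum_{j=i+1}^n z_jz_j^*$ for $i=0,\ldots,n-1$; $[z_n^*,z_n]=0$; $\sum_{i=0}^n z_iz_i^*=1$. $\mathcal{A}(\mathbb{C}\mathrm{P}^n_q)$ is the $*$-subalgebra generated by $p_{ij}:=z_i^*z_j$, $0\le i,j\le n$. $\mathcal{H}_n=\ell^2(\mathbb{N}^n)$ has orthonormal basis $|\underline m\rangle$, $\underline m=(m_1,\ldots,m_n)\in\mathbb{N}^n$, and $m_0:=0$. For $0\le i<k\le n$ let $\underline\varepsilon_i^k\in\{0,1\}^n$ have entries $1$ in positions $i+1,\ldots,k$ and $0$ elsewhere. For $0\le k\le n$ let $\mathcal{V}^n_k$ be the closed span of the $|\underline m\rangle$ with $0\le m_1\le\cdots\le m_k$ and $m_{k+1}>m_{k+2}>\cdots>m_n\ge0$. Let $\pi^{(n)}_k:\mathcal{A}(S^{2n+1}_q)\to\mathcal{B}(\mathcal{H}_n)$ be the (not necessarily unital) $*$-representation which is zero on $(\mathcal{V}^n_k)^\perp$ and on basis vectors of $\mathcal{V}^n_k$ is given by $\pi^{(n)}_k(z_i)|\underline m\rangle=q^{m_i}\sqrt{1-q^{2(m_{i+1}-m_i+1)}}\,|\underline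 m+\underline\varepsilon_i^k\rangle$ for $0\le i\le k-1$, $\pi^{(n)}_k(z_k)|\underline m\rangle=q^{m_k}|\underline m\rangle$, and $\pi^{(n)}_k(z_i)|\underline m\rangle=0$ for $i>k$; the unit acts as the orthogonal projection onto $\mathcal{V}^n_k$. Set $\pi^{(n)}_+=\sum_{k\ \mathrm{even}}\pi^{(n)}_k$ and $\pi^{(n)}_-=\sum_{k\ \mathrm{odd}}\pi^{(n)}_k$ (sums over $0\le k\le n$); these are $*$-representations. In a spectral triple the representation is not required here to be unital. *)

theory Defs
  imports
    "HOL-Analysis.Analysis"
    "HOL-Algebra.QuotRing"
    "HOL-Algebra.Module"
    "HOL-Library.Poly_Mapping"
    "HOL-Library.Function_Algebras"
begin

section \<open>Hilbert spaces and their operators\<close>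

text \<open>
  A complex Hilbert space is a linear subspace, complete for its inner product, of an ambient
  complex vector space (the whole type). Only the values of the inner product and of operators
  on the carrier matter. The inner product is linear in the second argument.
\<close>

record 'h hilbert =
  hcarrier :: "'h set"
  hscale :: "complex \<Rightarrow> 'h \<Rightarrow> 'h"
  hinner :: "'h \<Rightarrow> 'h \<Rightarrow> complex"

definition hnorm :: "'h hilbert \<Rightarrow> 'h \<Rightarrow> real" where
  "hnorm H x = sqrt (Re (hinner H x x))"

definition hdist :: "('h::ab_group_add) hilbert \<Rightarrow> 'h \<Rightarrow> 'h \<Rightarrow> real" where
  "hdist H x y = hnorm H (x - y)"

definition htop :: "('h::ab_group_add) hilbert \<Rightarrow> 'h topology" where
  "htop H = Metric_space.mtopology (hcarrier H) (hdist H)"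

definition hdense :: "('h::ab_group_add) hilbert \<Rightarrow> 'h set \<Rightarrow> bool" where
  "hdense H S \<longleftrightarrow> S \<subseteq> hcarrier H \<and> htop H closure_of S = hcarrier H"

definition hilbert_space :: "('h::ab_group_add) hilbert \<Rightarrow> bool" where
  "hilbert_space H \<longleftrightarrow>
     vector_space (hscale H) \<and>
     module.subspace (hscale H) (hcarrier H) \<and>
     (\<forall>x\<in>hcarrier H. \<forall>y\<in>hcarrier H. hinner H y x = cnj (hinner H x y)) \<and>
     (\<forall>x\<in>hcarrier H. \<forall>y\<in>hcarrier H. \<forall>z\<in>hcarrier H.
        hinner H x (y + z) = hinner H x y + hinner H x z) \<and>
     (\<forall>x\<in>hcarrier H. \<forall>y\<in>hcarrier H. \<forall>c. hinner H x (hscale H c y) = c * hinner H x y) \<and>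
     (\<forall>x\<in>hcarrier H. 0 \<le> Re (hinner H x x) \<and> (hinner H x x = 0 \<longrightarrow> x = 0)) \<and>
     Metric_space.mcomplete (hcarrier H) (hdist H)"

definition bounded_op :: "('h::ab_group_add) hilbert \<Rightarrow> ('h \<Rightarrow> 'h) \<Rightarrow> bool" where
  "bounded_op H T \<longleftrightarrow>
     (\<forall>x\<in>hcarrier H. T x \<in> hcarrier H) \<and>
     (\<forall>x\<in>hcarrier H. \<forall>y\<in>hcarrier H. T (x + y) = T x + T y) \<and>
     (\<forall>c. \<forall>x\<in>hcarrier H. T (hscale H c x) = hscale H c (T x)) \<and>
     (\<exists>K. \<forall>x\<in>hcarrier H. hnorm H (T x) \<le> K * hnorm H x)"

definition compact_op :: "('h::ab_group_add) hilbert \<Rightarrow> ('h \<Rightarrow> 'h) \<Rightarrow> bool" where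
  "compact_op H T \<longleftrightarrow>
     bounded_op H T \<and>
     compactin (htop H) (htop H closure_of (T ` {x \<in> hcarrier H. hnorm H x \<le> 1}))"

definition hadjoint :: "'h hilbert \<Rightarrow> ('h \<Rightarrow> 'h) \<Rightarrow> 'h \<Rightarrow> 'h" where
  "hadjoint H T x = (THE y. y \<in> hcarrier H \<and> (\<forall>z\<in>hcarrier H. hinner H y z = hinner H x (T z)))"

definition orthonormal_basis :: "('h::ab_group_add) hilbert \<Rightarrow> 'h set \<Rightarrow> bool" where
  "orthonormal_basis H E \<longleftrightarrow>
     E \<subseteq> hcarrier H \<and>
     (\<forall>e\<in>E. \<forall>e'\<in>E. hinner H e e' = (if e = e' then 1 else 0)) \<and>
     hdense H (module.span (hscale H) E)"

text \<open>\<open>abs_op H T P\<close> says that \<open>P\<close> is the absolute value of \<open>T\<close>: it is positive and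
  its square is the adjoint of \<open>T\<close> times \<open>T\<close>.\<close>

definition abs_op :: "('h::ab_group_add) hilbert \<Rightarrow> ('h \<Rightarrow> 'h) \<Rightarrow> ('h \<Rightarrow> 'h) \<Rightarrow> bool" where
  "abs_op H T P \<longleftrightarrow>
     bounded_op H P \<and>
     (\<forall>x\<in>hcarrier H. hinner H x (P x) \<in> \<real> \<and> 0 \<le> Re (hinner H x (P x))) \<and>
     (\<forall>x\<in>hcarrier H. P (P x) = hadjoint H T (T x))"

definition trace_class :: "('h::ab_group_add) hilbert \<Rightarrow> ('h \<Rightarrow> 'h) \<Rightarrow> bool" where
  "trace_class H T \<longleftrightarrow>
     bounded_op H T \<and>
     (\<exists>P E. abs_op H T P \<and> orthonormal_basis H E \<and> (\<lambda>e. hinner H e (P e)) summable_on E)"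


section \<open>Unbounded operators\<close>

record 'h unbounded_op =
  opdom :: "'h set"
  opapp :: "'h \<Rightarrow> 'h"

definition densely_defined_op :: "('h::ab_group_add) hilbert \<Rightarrow> 'h unbounded_op \<Rightarrow> bool" where
  "densely_defined_op H D \<longleftrightarrow>
     module.subspace (hscale H) (opdom D) \<and>
     hdense H (opdom D) \<and>
     (\<forall>x\<in>opdom D. opapp D x \<in> hcarrier H) \<and>
     (\<forall>x\<in>opdom D. \<forall>y\<in>opdom D. opapp D (x + y) = opapp D x + opapp D y) \<and>
     (\<forall>c. \<forall>x\<in>opdom D. opapp D (hscale H c x) = hscale H c (opapp D x))"

definition op_graph :: "'h unbounded_op \<Rightarrow> ('h \<times> 'h) set" where
  "op_graph D = {(x, opapp D x) |x. x \<in> opdom D}"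

definition adjoint_graph :: "'h hilbert \<Rightarrow> 'h unbounded_op \<Rightarrow> ('h \<times> 'h) set" where
  "adjoint_graph H D =
     {(x, y). x \<in> hcarrier H \<and> y \<in> hcarrier H \<and>
        (\<forall>z\<in>opdom D. hinner H x (opapp D z) = hinner H y z)}"

definition self_adjoint :: "('h::ab_group_add) hilbert \<Rightarrow> 'h unbounded_op \<Rightarrow> bool" where
  "self_adjoint H D \<longleftrightarrow> densely_defined_op H D \<and> adjoint_graph H D = op_graph D"

definition resolvent ::
    "('h::ab_group_add) hilbert \<Rightarrow> 'h unbounded_op \<Rightarrow> complex \<Rightarrow> 'h \<Rightarrow> 'h" where
  "resolvent H D \<mu> = inv_into (opdom D) (\<lambda>x. opapp D x - hscale H \<mu> x)"

definition resolvent_set :: "('h::ab_group_add) hilbert \<Rightarrow> 'h unbounded_op \<Rightarrow> complex set" where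
  "resolvent_set H D =
     {\<mu>. bij_betw (\<lambda>x. opapp D x - hscale H \<mu> x) (opdom D) (hcarrier H) \<and>
         bounded_op H (resolvent H D \<mu>)}"

definition compact_resolvent :: "('h::ab_group_add) hilbert \<Rightarrow> 'h unbounded_op \<Rightarrow> bool" where
  "compact_resolvent H D \<longleftrightarrow>
     resolvent_set H D \<noteq> {} \<and> (\<forall>\<mu>\<in>resolvent_set H D. compact_op H (resolvent H D \<mu>))"

text \<open>
  Functional calculus for a self-adjoint operator with discrete spectrum: \<open>T = f(D)\<close>
  if \<open>D\<close> has an orthonormal eigenbasis on which the bounded operator \<open>T\<close> acts by
  \<open>f\<close> of the eigenvalue. A self-adjoint operator with compact resolvent has such
  a basis, and \<open>T\<close> does not depend on its choice.
\<close>

definition functional_calculus ::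
    "('h::ab_group_add) hilbert \<Rightarrow> 'h unbounded_op \<Rightarrow> (real \<Rightarrow> real) \<Rightarrow> ('h \<Rightarrow> 'h) \<Rightarrow> bool" where
  "functional_calculus H D f T \<longleftrightarrow>
     bounded_op H T \<and>
     (\<exists>E. orthonormal_basis H E \<and>
        (\<forall>e\<in>E. \<exists>t::real. e \<in> opdom D \<and>
           opapp D e = hscale H (of_real t) e \<and> T e = hscale H (of_real (f t)) e))"

definition metric_dimension :: "('h::ab_group_add) hilbert \<Rightarrow> 'h unbounded_op \<Rightarrow> ereal" where
  "metric_dimension H D =
     Inf (ereal ` {s. 0 < s \<and>
       (\<exists>T. functional_calculus H D (\<lambda>t. (1 + t\<^sup>2) powr (- s / 2)) T \<and> trace_class H T)})"


section \<open>Star-algebras and even spectral triples\<close>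

text \<open>Algebras need not be unital; the field \<open>one\<close> of the record is then irrelevant.\<close>

record 'a star_alg = "(complex, 'a) module" +
  star :: "'a \<Rightarrow> 'a"

locale star_algebra = abelian_group A for A :: "'a star_alg" (structure) +
  assumes mult_closed: "x \<in> carrier A \<Longrightarrow> y \<in> carrier A \<Longrightarrow> x \<otimes> y \<in> carrier A"
    and mult_assoc: "x \<in> carrier A \<Longrightarrow> y \<in> carrier A \<Longrightarrow> z \<in> carrier A \<Longrightarrow>
          (x \<otimes> y) \<otimes> z = x \<otimes> (y \<otimes> z)"
    and distrib_left: "x \<in> carrier A \<Longrightarrow> y \<in> carrier A \<Longrightarrow> z \<in> carrier A \<Longrightarrow>
          x \<otimes> (y \<oplus> z) = x \<otimes> y \<oplus> x \<otimes> z"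
    and distrib_right: "x \<in> carrier A \<Longrightarrow> y \<in> carrier A \<Longrightarrow> z \<in> carrier A \<Longrightarrow>
          (x \<oplus> y) \<otimes> z = x \<otimes> z \<oplus> y \<otimes> z"
    and scale_closed: "x \<in> carrier A \<Longrightarrow> c \<odot> x \<in> carrier A"
    and scale_add: "x \<in> carrier A \<Longrightarrow> y \<in> carrier A \<Longrightarrow> c \<odot> (x \<oplus> y) = c \<odot> x \<oplus> c \<odot> y"
    and add_scale: "x \<in> carrier A \<Longrightarrow> (c + d) \<odot> x = c \<odot> x \<oplus> d \<odot> x"
    and scale_scale: "x \<in> carrier A \<Longrightarrow> (c * d) \<odot> x = c \<odot> (d \<odot> x)"
    and scale_one: "x \<in> carrier A \<Longrightarrow> 1 \<odot> x = x"
    and scale_mult_left: "x \<in> carrier A \<Longrightarrow> y \<in> carrier A \<Longrightarrow> (c \<odot> x) \<otimes> y = c \<odot> (x \<otimes> y)"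
    and scale_mult_right: "x \<in> carrier A \<Longrightarrow> y \<in> carrier A \<Longrightarrow> x \<otimes> (c \<odot> y) = c \<odot> (x \<otimes> y)"
    and star_closed: "x \<in> carrier A \<Longrightarrow> star A x \<in> carrier A"
    and star_star: "x \<in> carrier A \<Longrightarrow> star A (star A x) = x"
    and star_add: "x \<in> carrier A \<Longrightarrow> y \<in> carrier A \<Longrightarrow> star A (x \<oplus> y) = star A x \<oplus> star A y"
    and star_scale: "x \<in> carrier A \<Longrightarrow> star A (c \<odot> x) = cnj c \<odot> star A x"
    and star_mult: "x \<in> carrier A \<Longrightarrow> y \<in> carrier A \<Longrightarrow> star A (x \<otimes> y) = star A y \<otimes> star A x"

inductive_set star_subalgebra_generated :: "'a star_alg \<Rightarrow> 'a set \<Rightarrow> 'a set"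
  for A :: "'a star_alg" and S :: "'a set" where
  gen: "x \<in> S \<Longrightarrow> x \<in> star_subalgebra_generated A S"
| zero: "\<zero>\<^bsub>A\<^esub> \<in> star_subalgebra_generated A S"
| add: "x \<in> star_subalgebra_generated A S \<Longrightarrow> y \<in> star_subalgebra_generated A S \<Longrightarrow>
    x \<oplus>\<^bsub>A\<^esub> y \<in> star_subalgebra_generated A S"
| mult: "x \<in> star_subalgebra_generated A S \<Longrightarrow> y \<in> star_subalgebra_generated A S \<Longrightarrow>
    x \<otimes>\<^bsub>A\<^esub> y \<in> star_subalgebra_generated A S"
| scale: "x \<in> star_subalgebra_generated A S \<Longrightarrow> c \<odot>\<^bsub>A\<^esub> x \<in> star_subalgebra_generated A S"
| star: "x \<in> star_subalgebra_generated A S \<Longrightarrow> star A x \<in> star_subalgebra_generated A S"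

text \<open>Representations are by bounded operators and need not be unital.\<close>

definition star_representation ::
    "'a star_alg \<Rightarrow> ('h::ab_group_add) hilbert \<Rightarrow> ('a \<Rightarrow> 'h \<Rightarrow> 'h) \<Rightarrow> bool" where
  "star_representation A H \<rho> \<longleftrightarrow>
     (\<forall>a\<in>carrier A. bounded_op H (\<rho> a)) \<and>
     (\<forall>a\<in>carrier A. \<forall>b\<in>carrier A. \<forall>x\<in>hcarrier H.
        \<rho> (a \<oplus>\<^bsub>A\<^esub> b) x = \<rho> a x + \<rho> b x \<and> \<rho> (a \<otimes>\<^bsub>A\<^esub> b) x = \<rho> a (\<rho> b x)) \<and>
     (\<forall>c. \<forall>a\<in>carrier A. \<forall>x\<in>hcarrier H. \<rho> (c \<odot>\<^bsub>A\<^esub> a) x = hscale H c (\<rho> a x)) \<and>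
     (\<forall>a\<in>carrier A. \<forall>x\<in>hcarrier H. \<rho> (star A a) x = hadjoint H (\<rho> a) x)"

definition even_spectral_triple ::
    "'a star_alg \<Rightarrow> ('h::ab_group_add) hilbert \<Rightarrow> ('a \<Rightarrow> 'h \<Rightarrow> 'h) \<Rightarrow> ('h \<Rightarrow> 'h) \<Rightarrow>
     'h unbounded_op \<Rightarrow> bool" where
  "even_spectral_triple A H \<rho> \<gamma> D \<longleftrightarrow>
     star_algebra A \<and>
     hilbert_space H \<and>
     star_representation A H \<rho> \<and>
     self_adjoint H D \<and>
     compact_resolvent H D \<and>
     (\<forall>a\<in>carrier A.
        (\<forall>x\<in>opdom D. \<rho> a x \<in> opdom D) \<and>
        (\<exists>T. bounded_op H T \<and> (\<forall>x\<in>opdom D. T x = opapp D (\<rho> a x) - \<rho> a (opapp D x)))) \<and>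
     bounded_op H \<gamma> \<and>
     (\<forall>x\<in>hcarrier H. \<gamma> (\<gamma> x) = x \<and> hadjoint H \<gamma> x = \<gamma> x) \<and>
     (\<forall>a\<in>carrier A. \<forall>x\<in>hcarrier H. \<gamma> (\<rho> a x) = \<rho> a (\<gamma> x)) \<and>
     (\<forall>x\<in>opdom D. \<gamma> x \<in> opdom D \<and> \<gamma> (opapp D x) = - opapp D (\<gamma> x))"


section \<open>The quantum sphere and the quantum projective space\<close>

text \<open>The free monoid, written additively so that \<open>'a word \<Rightarrow>\<^sub>0 complex\<close> is the free
  unital complex algebra on \<open>'a\<close>.\<close>

datatype 'a word = Word (letters: "'a list")

instantiation word :: (type) monoid_add
begin

definition "0 = Word []"

definition "u + v = Word (letters u @ letters v)"

instance
  by standard (auto simp: zero_word_def plus_word_def)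

end

datatype sphere_gen = Z nat | Zs nat

type_synonym free_elem = "sphere_gen word \<Rightarrow>\<^sub>0 complex"

primrec gen_index :: "sphere_gen \<Rightarrow> nat" where
  "gen_index (Z i) = i"
| "gen_index (Zs i) = i"

primrec gen_star :: "sphere_gen \<Rightarrow> sphere_gen" where
  "gen_star (Z i) = Zs i"
| "gen_star (Zs i) = Z i"

definition free_const :: "complex \<Rightarrow> free_elem" where
  "free_const c = Poly_Mapping.single 0 c"

definition fz :: "nat \<Rightarrow> free_elem" where
  "fz i = Poly_Mapping.single (Word [Z i]) 1"

definition fzs :: "nat \<Rightarrow> free_elem" where
  "fzs i = Poly_Mapping.single (Word [Zs i]) 1"

definition free_star :: "free_elem \<Rightarrow> free_elem" where
  "free_star x = (\<Sum>w\<in>Poly_Mapping.keys x.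
     Poly_Mapping.single (Word (rev (map gen_star (letters w)))) (cnj (Poly_Mapping.lookup x w)))"

definition free_alg :: "nat \<Rightarrow> free_elem ring" where
  "free_alg n =
     \<lparr>carrier = {x. \<forall>w\<in>Poly_Mapping.keys x. \<forall>g\<in>set (letters w). gen_index g \<le> n},
      monoid.mult = (*), one = 1, ring.zero = 0, add = (+)\<rparr>"

definition sphere_relations :: "real \<Rightarrow> nat \<Rightarrow> free_elem set" where
  "sphere_relations q n =
     {fz i * fz j - free_const (inverse (of_real q)) * fz j * fz i |i j. i < j \<and> j \<le> n} \<union>
     {fzs i * fz j - free_const (of_real q) * fz j * fzs i |i j. i \<le> n \<and> j \<le> n \<and> i \<noteq> j} \<union>
     {fzs i * fz i - fz i * fzs i
        - free_const (1 - (of_real q)\<^sup>2) * (\<Sum>j\<in>{i+1..n}. fz j * fzs j) |i. i < n} \<union>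
     {fzs n * fz n - fz n * fzs n} \<union>
     {(\<Sum>i\<in>{0..n}. fz i * fzs i) - 1}"

text \<open>Closing the relations under the star makes this a star-ideal.\<close>

definition sphere_ideal :: "real \<Rightarrow> nat \<Rightarrow> free_elem set" where
  "sphere_ideal q n =
     genideal (free_alg n) (sphere_relations q n \<union> free_star ` sphere_relations q n)"

definition sphere_class :: "real \<Rightarrow> nat \<Rightarrow> free_elem \<Rightarrow> free_elem set" where
  "sphere_class q n x = sphere_ideal q n +>\<^bsub>free_alg n\<^esub> x"

definition sphere_alg :: "real \<Rightarrow> nat \<Rightarrow> free_elem set star_alg" where
  "sphere_alg q n = (let Q = free_alg n Quot sphere_ideal q n in
     \<lparr>carrier = carrier Q, monoid.mult = monoid.mult Q, one = one Q,
      ring.zero = ring.zero Q, add = add Q,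
      smult = (\<lambda>c X. sphere_class q n (free_const c) \<otimes>\<^bsub>Q\<^esub> X),
      star = (\<lambda>X. free_star ` X)\<rparr>)"

definition proj_gen :: "real \<Rightarrow> nat \<Rightarrow> nat \<Rightarrow> nat \<Rightarrow> free_elem set" where
  "proj_gen q n i j =
     star (sphere_alg q n) (sphere_class q n (fz i)) \<otimes>\<^bsub>sphere_alg q n\<^esub> sphere_class q n (fz j)"

definition projective_alg :: "real \<Rightarrow> nat \<Rightarrow> free_elem set star_alg" where
  "projective_alg q n =
     (sphere_alg q n)\<lparr>carrier :=
        star_subalgebra_generated (sphere_alg q n) {proj_gen q n i j |i j. i \<le> n \<and> j \<le> n}\<rparr>"


section \<open>The representations\<close>

definition ell2 :: "'b set \<Rightarrow> ('b \<Rightarrow> complex) hilbert" where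
  "ell2 I =
     \<lparr>hcarrier = {\<psi>. (\<forall>x. x \<notin> I \<longrightarrow> \<psi> x = 0) \<and> (\<lambda>x. (cmod (\<psi> x))\<^sup>2) summable_on I},
      hscale = (\<lambda>c \<psi> x. c * \<psi> x),
      hinner = (\<lambda>\<phi> \<psi>. \<Sum>\<^sub>\<infinity>x\<in>I. cnj (\<phi> x) * \<psi> x)\<rparr>"

definition ket :: "'b \<Rightarrow> 'b \<Rightarrow> complex" where
  "ket x = (\<lambda>y. if y = x then 1 else 0)"

text \<open>The operator on \<open>ell2 I\<close> that sends the basis vector \<open>ket m\<close> to \<open>v m\<close>.\<close>

definition basis_op :: "'b set \<Rightarrow> ('b \<Rightarrow> 'b \<Rightarrow> complex) \<Rightarrow> ('b \<Rightarrow> complex) \<Rightarrow> 'b \<Rightarrow> complex" where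
  "basis_op I v \<psi> = (\<lambda>p. \<Sum>\<^sub>\<infinity>m\<in>I. \<psi> m * v m p)"

text \<open>Multi-indices with entries at positions \<open>1, \<dots>, n\<close>; in particular \<open>m 0 = 0\<close>.\<close>

definition multi_indices :: "nat \<Rightarrow> (nat \<Rightarrow> nat) set" where
  "multi_indices n = {m. \<forall>i. i = 0 \<or> n < i \<longrightarrow> m i = 0}"

definition eps :: "nat \<Rightarrow> nat \<Rightarrow> nat \<Rightarrow> nat" where
  "eps i k = (\<lambda>j. if i < j \<and> j \<le> k then 1 else 0)"

definition V_indices :: "nat \<Rightarrow> nat \<Rightarrow> (nat \<Rightarrow> nat) set" where
  "V_indices n k =
     {m \<in> multi_indices n.
        (\<forall>i. 1 \<le> i \<and> i < k \<longrightarrow> m i \<le> m (i + 1)) \<and>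
        (\<forall>i. k < i \<and> i < n \<longrightarrow> m i > m (i + 1))}"

type_synonym vec = "(nat \<Rightarrow> nat) \<Rightarrow> complex"

definition H_single :: "nat \<Rightarrow> vec hilbert" where
  "H_single n = ell2 (multi_indices n)"

definition V_proj :: "nat \<Rightarrow> nat \<Rightarrow> vec \<Rightarrow> vec" where
  "V_proj n k = basis_op (multi_indices n) (\<lambda>m. if m \<in> V_indices n k then ket m else 0)"

definition z_op :: "real \<Rightarrow> nat \<Rightarrow> nat \<Rightarrow> nat \<Rightarrow> vec \<Rightarrow> vec" where
  "z_op q n k i = basis_op (multi_indices n)
     (\<lambda>m. if m \<notin> V_indices n k then 0
          else if i < k then
            hscale (H_single n)
              (of_real (q ^ m i * sqrt (1 - q ^ (2 * (m (i + 1) - m i + 1)))))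
              (ket (m + eps i k))
          else if i = k then hscale (H_single n) (of_real (q ^ m k)) (ket m)
          else 0)"

primrec gen_op :: "real \<Rightarrow> nat \<Rightarrow> nat \<Rightarrow> sphere_gen \<Rightarrow> vec \<Rightarrow> vec" where
  "gen_op q n k (Z i) = z_op q n k i"
| "gen_op q n k (Zs i) = hadjoint (H_single n) (z_op q n k i)"

primrec word_op :: "real \<Rightarrow> nat \<Rightarrow> nat \<Rightarrow> sphere_gen list \<Rightarrow> vec \<Rightarrow> vec" where
  "word_op q n k [] = V_proj n k"
| "word_op q n k (g # w) = gen_op q n k g \<circ> word_op q n k w"

definition free_rep :: "real \<Rightarrow> nat \<Rightarrow> nat \<Rightarrow> free_elem \<Rightarrow> vec \<Rightarrow> vec" where
  "free_rep q n k x \<psi> =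
     (\<Sum>w\<in>Poly_Mapping.keys x.
        hscale (H_single n) (Poly_Mapping.lookup x w) (word_op q n k (letters w) \<psi>))"

text \<open>The value does not depend on the representative because the operators satisfy the
  defining relations.\<close>

definition sphere_rep :: "real \<Rightarrow> nat \<Rightarrow> nat \<Rightarrow> free_elem set \<Rightarrow> vec \<Rightarrow> vec" where
  "sphere_rep q n k X = free_rep q n k (SOME x. x \<in> X)"

definition pi_plus :: "real \<Rightarrow> nat \<Rightarrow> free_elem set \<Rightarrow> vec \<Rightarrow> vec" where
  "pi_plus q n X \<psi> = (\<Sum>k\<in>{k. k \<le> n \<and> even k}. sphere_rep q n k X \<psi>)"

definition pi_minus :: "real \<Rightarrow> nat \<Rightarrow> free_elem set \<Rightarrow> vec \<Rightarrow> vec" where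
  "pi_minus q n X \<psi> = (\<Sum>k\<in>{k. k \<le> n \<and> odd k}. sphere_rep q n k X \<psi>)"


section \<open>The spectral triple\<close>

definition hilbert_sum :: "'h hilbert \<Rightarrow> 'k hilbert \<Rightarrow> ('h \<times> 'k) hilbert" where
  "hilbert_sum H K =
     \<lparr>hcarrier = hcarrier H \<times> hcarrier K,
      hscale = (\<lambda>c (x, y). (hscale H c x, hscale K c y)),
      hinner = (\<lambda>(x, y) (x', y'). hinner H x x' + hinner K y y')\<rparr>"

definition H_total :: "nat \<Rightarrow> (vec \<times> vec) hilbert" where
  "H_total n = hilbert_sum (H_single n) (H_single n)"

definition pi_total :: "real \<Rightarrow> nat \<Rightarrow> free_elem set \<Rightarrow> vec \<times> vec \<Rightarrow> vec \<times> vec" where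
  "pi_total q n X = map_prod (pi_plus q n X) (pi_minus q n X)"

definition grading :: "vec \<times> vec \<Rightarrow> vec \<times> vec" where
  "grading = (\<lambda>(\<phi>, \<psi>). (\<phi>, - \<psi>))"

definition flip :: "vec \<times> vec \<Rightarrow> vec \<times> vec" where
  "flip = (\<lambda>(\<phi>, \<psi>). (\<psi>, \<phi>))"

text \<open>The diagonal operator with eigenvalues \<open>a\<close>, on its maximal domain.\<close>

definition diagonal_op :: "'b set \<Rightarrow> ('b \<Rightarrow> complex) \<Rightarrow> ('b \<Rightarrow> complex) unbounded_op" where
  "diagonal_op I a =
     \<lparr>opdom = {\<psi> \<in> hcarrier (ell2 I). (\<lambda>m. a m * \<psi> m) \<in> hcarrier (ell2 I)},
      opapp = (\<lambda>\<psi> m. a m * \<psi> m)\<rparr>"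

definition abs_D_single :: "nat \<Rightarrow> vec unbounded_op" where
  "abs_D_single n = diagonal_op (multi_indices n) (\<lambda>m. of_nat (\<Sum>i\<in>{1..n}. m i))"

definition abs_D :: "nat \<Rightarrow> (vec \<times> vec) unbounded_op" where
  "abs_D n =
     \<lparr>opdom = opdom (abs_D_single n) \<times> opdom (abs_D_single n),
      opapp = map_prod (opapp (abs_D_single n)) (opapp (abs_D_single n))\<rparr>"

definition Dirac :: "nat \<Rightarrow> (vec \<times> vec) unbounded_op" where
  "Dirac n =
     \<lparr>opdom = {x \<in> hcarrier (H_total n). flip x \<in> opdom (abs_D n)},
      opapp = opapp (abs_D n) \<circ> flip\<rparr>"

end

theory Submission
  imports Defs
begin

text \<open>
  The statement has an operator-theoretic half, about the Dirac operator alone, and an algebraic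
  half, about the representations; the two meet in the boundedness of the commutators.

  For each multi-index \<open>m\<close> with \<open>a = m\<^sub>1 + \<dots> + m\<^sub>n\<close>, the Dirac operator acts
  on the span of the two copies of \<open>ket m\<close> by the block with rows \<open>(0, a)\<close> and \<open>(a, 0)\<close>, with
  eigenvalues \<open>a\<close> and \<open>-a\<close>. Self-adjointness follows by testing an adjoint pair against basis
  vectors. Inverting the blocks gives the resolvent, whose coefficients are at most
  \<open>1 / (a - |\<mu>|)\<close> for large \<open>a\<close>; only finitely many \<open>m\<close> have a given \<open>a\<close>, so these tend to \<open>0\<close> and the resolvent
  is compact. For the dimension one needs to know when \<open>(1 + a\<^sup>2) powr (- s / 2)\<close> is summable over
  the multi-indices. If \<open>s > n\<close>, then \<open>(1 + a) ^ n \<ge> \<Prod> (1 + m\<^sub>i)\<close> bounds the sum by the \<open>n\<close>-th power of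
  a convergent one-dimensional series (\<open>weight_summable\<close>); if \<open>s < n\<close>, the \<open>M ^ n\<close> points of a box
  already contribute about \<open>M powr (n - s)\<close> (\<open>weight_divergent\<close>). Since the trace is defined with an
  arbitrary orthonormal basis and the function of the operator with an arbitrary eigenbasis, the
  lower bound also needs basis independence: every eigenvector of the operator is an eigenvector of
  the function (\<open>functional_calculus_eigen\<close>), the positive square root is unique on eigenvectors
  (\<open>abs_op_eigen\<close>), and a trace computed in any basis controls all finite sums of eigenvalues
  (\<open>trace_class_eigenvalue_bound\<close>).

  On the \<open>k\<close>-th component the generators are weighted shifts. Written
  as maps on coordinates, \<open>(A \<psi>) p = a p * \<psi> (\<tau> p)\<close>, they can be composed and compared pointwise,
  and all relations of the quantum sphere become identities between amplitudes
  (\<open>sphere_relation_zero\<close>). Hence the action of the free algebra descends to the quotient, independently of the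
  representative (\<open>sphere_rep_class\<close>). Components whose indices differ by at least two live on
  disjoint sets of basis vectors, so the sums over even and over odd \<open>k\<close> are again representations.

  In block form, the commutator of the Dirac operator with an element \<open>x\<close> is bounded as soon as
  the commutators of \<open>\<pi>\<^sub>+ x\<close> and \<open>\<pi>\<^sub>- x\<close> with the multiplication by \<open>a\<close>, and the product of
  \<open>\<pi>\<^sub>+ x - \<pi>\<^sub>- x\<close> with it, are bounded. These properties pass to products by a
  Leibniz rule, so only the generators \<open>z\<^sub>i\<^sup>* z\<^sub>j\<close> matter. They shift \<open>a\<close> by the constant \<open>i - j\<close>, which
  settles the commutators. For the difference, every multi-index in one of the sets
  \<open>V\<^sub>0, \<dots>, V\<^sub>n\<close> lies in exactly two of them, \<open>V\<^sub>r\<^sub>-\<^sub>1\<close> and \<open>V\<^sub>r\<close> (\<open>V_indices_peak\<close>), where \<open>m\<^sub>r\<close> is the largest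
  entry. The two contributions carry opposite signs and cancel up to \<open>2 q ^ m\<^sub>r\<close>
  (\<open>proj_coeff_step\<close>), which beats the growth \<open>a \<le> n * m\<^sub>r\<close>.
\<close>


section \<open>Inner product spaces\<close>

text \<open>
  Completeness is kept out of this locale because the metric space built from the inner product is
  needed to prove it. Positivity and invariance under negation are required on the whole type,
  not just on the carrier, because a metric space has a nonnegative and symmetric distance function on
  its whole type.
\<close>

locale pre_hilbert =
  fixes H :: "('h::ab_group_add) hilbert"
  assumes vec: "vector_space (hscale H)"
    and carrier_subspace: "module.subspace (hscale H) (hcarrier H)"
    and inner_cnj: "\<And>x y. x \<in> hcarrier H \<Longrightarrow> y \<in> hcarrier H \<Longrightarrow> hinner H y x = cnj (hinner H x y)"
    and inner_add: "\<And>x y z. x \<in> hcarrier H \<Longrightarrow> y \<in> hcarrier H \<Longrightarrow> z \<in> hcarrier H \<Longrightarrow>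
          hinner H x (y + z) = hinner H x y + hinner H x z"
    and inner_scale: "\<And>x y c. x \<in> hcarrier H \<Longrightarrow> y \<in> hcarrier H \<Longrightarrow>
          hinner H x (hscale H c y) = c * hinner H x y"
    and inner_pos: "\<And>x. 0 \<le> Re (hinner H x x)"
    and inner_uminus: "\<And>x. hinner H (- x) (- x) = hinner H x x"
    and inner_definite: "\<And>x. x \<in> hcarrier H \<Longrightarrow> hinner H x x = 0 \<Longrightarrow> x = 0"
begin

sublocale vs: vector_space "hscale H" by (rule vec)

abbreviation "C \<equiv> hcarrier H"
abbreviation inner (infix "\<bullet>\<bullet>" 70) where "x \<bullet>\<bullet> y \<equiv> hinner H x y"
abbreviation "N \<equiv> hnorm H"
abbreviation scale (infixr "*h" 75) where "c *h x \<equiv> hscale H c x"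

lemma zero_closed[simp, intro]: "0 \<in> C"
  using carrier_subspace vs.subspace_0 by blast

lemma add_closed[simp, intro]: "x \<in> C \<Longrightarrow> y \<in> C \<Longrightarrow> x + y \<in> C"
  using carrier_subspace vs.subspace_add by blast

lemma scale_closed[simp, intro]: "x \<in> C \<Longrightarrow> c *h x \<in> C"
  using carrier_subspace vs.subspace_scale by blast

lemma diff_closed[simp, intro]: "x \<in> C \<Longrightarrow> y \<in> C \<Longrightarrow> x - y \<in> C"
  using carrier_subspace vs.subspace_diff by blast

lemma uminus_closed[simp, intro]: "x \<in> C \<Longrightarrow> - x \<in> C"
  using carrier_subspace vs.subspace_neg by blast

lemma sum_closed[simp, intro]: "(\<And>i. i \<in> A \<Longrightarrow> f i \<in> C) \<Longrightarrow> sum f A \<in> C"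
  using carrier_subspace vs.subspace_sum by blast

lemma inner_zero_right[simp]: "x \<in> C \<Longrightarrow> x \<bullet>\<bullet> 0 = 0"
  using inner_scale[of x 0 0] by simp

lemma inner_minus_right: "x \<in> C \<Longrightarrow> y \<in> C \<Longrightarrow> x \<bullet>\<bullet> (- y) = - (x \<bullet>\<bullet> y)"
  using inner_scale[of x y "-1"] by simp

lemma inner_diff: "x \<in> C \<Longrightarrow> y \<in> C \<Longrightarrow> z \<in> C \<Longrightarrow> x \<bullet>\<bullet> (y - z) = x \<bullet>\<bullet> y - x \<bullet>\<bullet> z"
  using inner_add[of x y "- z"] inner_minus_right[of x z] by simp

lemma inner_sum: "x \<in> C \<Longrightarrow> (\<And>i. i \<in> A \<Longrightarrow> f i \<in> C) \<Longrightarrow> x \<bullet>\<bullet> (sum f A) = (\<Sum>i\<in>A. x \<bullet>\<bullet> f i)"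
  by (induction A rule: infinite_finite_induct) (auto simp: inner_add)

lemma inner_add_left: "x \<in> C \<Longrightarrow> y \<in> C \<Longrightarrow> z \<in> C \<Longrightarrow> (y + z) \<bullet>\<bullet> x = y \<bullet>\<bullet> x + z \<bullet>\<bullet> x"
  by (metis add_closed complex_cnj_add inner_add inner_cnj)

lemma inner_scale_left: "x \<in> C \<Longrightarrow> y \<in> C \<Longrightarrow> (c *h y) \<bullet>\<bullet> x = cnj c * (y \<bullet>\<bullet> x)"
  by (metis scale_closed complex_cnj_mult inner_scale inner_cnj)

lemma inner_zero_left[simp]: "x \<in> C \<Longrightarrow> 0 \<bullet>\<bullet> x = 0"
  using inner_cnj[of x 0] by simp

lemma inner_diff_left: "x \<in> C \<Longrightarrow> y \<in> C \<Longrightarrow> z \<in> C \<Longrightarrow> (y - z) \<bullet>\<bullet> x = y \<bullet>\<bullet> x - z \<bullet>\<bullet> x"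
  by (metis diff_closed complex_cnj_diff inner_diff inner_cnj)

lemma inner_sum_left: "x \<in> C \<Longrightarrow> (\<And>i. i \<in> A \<Longrightarrow> f i \<in> C) \<Longrightarrow> (sum f A) \<bullet>\<bullet> x = (\<Sum>i\<in>A. f i \<bullet>\<bullet> x)"
  by (induction A rule: infinite_finite_induct) (auto simp: inner_add_left)

lemma norm_sq: "x \<in> C \<Longrightarrow> (N x)\<^sup>2 = Re (x \<bullet>\<bullet> x)"
  using inner_pos by (simp add: hnorm_def)

lemma inner_self: "x \<in> C \<Longrightarrow> x \<bullet>\<bullet> x = of_real ((N x)\<^sup>2)"
  using inner_cnj[of x x] by (simp add: norm_sq complex_eq_iff)

lemma norm_nonneg[simp]: "x \<in> C \<Longrightarrow> 0 \<le> N x"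
  using inner_pos by (simp add: hnorm_def)

lemma norm_zero[simp]: "N 0 = 0"
  by (simp add: hnorm_def)

lemma norm_eq_0: "x \<in> C \<Longrightarrow> N x = 0 \<longleftrightarrow> x = 0"
  using inner_definite[of x] inner_self[of x] by auto

lemma norm_scale: "x \<in> C \<Longrightarrow> N (c *h x) = cmod c * N x"
proof -
  assume x: "x \<in> C"
  have "(c *h x) \<bullet>\<bullet> (c *h x) = (cnj c * c) * (x \<bullet>\<bullet> x)"
    using x by (simp add: inner_scale inner_scale_left)
  also have "\<dots> = of_real ((cmod c)\<^sup>2 * (N x)\<^sup>2)"
    using x complex_norm_square[of c] by (simp add: inner_self mult.commute)
  finally show ?thesis
    using x inner_pos[of x] by (simp add: hnorm_def real_sqrt_mult)
qed

lemma norm_minus: "x \<in> C \<Longrightarrow> N (- x) = N x"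
  using norm_scale[of x "-1"] by simp

lemma norm_diff_commute: "x \<in> C \<Longrightarrow> y \<in> C \<Longrightarrow> N (x - y) = N (y - x)"
  using norm_minus[of "x - y"] by simp

lemma norm_add_sq:
  assumes "x \<in> C" "y \<in> C" shows "(N (x + y))\<^sup>2 = (N x)\<^sup>2 + 2 * Re (x \<bullet>\<bullet> y) + (N y)\<^sup>2"
  using assms inner_cnj[of x y] by (simp add: norm_sq inner_add inner_add_left)

lemma cauchy_schwarz:
  assumes x: "x \<in> C" and y: "y \<in> C"
  shows "cmod (x \<bullet>\<bullet> y) \<le> N x * N y"
proof (cases "x = 0")
  case True then show ?thesis using y by simp
next
  case False
  define a where "a = (N x)\<^sup>2"
  have a: "a > 0" using False x norm_eq_0 by (simp add: a_def)
  define c where "c = - (x \<bullet>\<bullet> y) / of_real a"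
  have "0 \<le> (N (y + c *h x))\<^sup>2" by simp
  also have "\<dots> = (N y)\<^sup>2 + 2 * Re (y \<bullet>\<bullet> (c *h x)) + (N (c *h x))\<^sup>2"
    using x y by (simp add: norm_add_sq)
  also have "y \<bullet>\<bullet> (c *h x) = - of_real ((cmod (x \<bullet>\<bullet> y))\<^sup>2 / a)"
    using complex_norm_square[of "x \<bullet>\<bullet> y"]
    by (simp only: inner_scale[OF y x] inner_cnj[OF x y] c_def) simp
  also have "(N (c *h x))\<^sup>2 = (cmod (x \<bullet>\<bullet> y))\<^sup>2 / a"
    using norm_scale[OF x, of c] a
    by (simp add: c_def norm_divide power_mult_distrib power_divide a_def[symmetric] del: vs.scale_minus_left)
       (simp add: power2_eq_square)
  finally have "(cmod (x \<bullet>\<bullet> y))\<^sup>2 / a \<le> (N y)\<^sup>2" by simp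
  then have "(cmod (x \<bullet>\<bullet> y))\<^sup>2 \<le> (N x * N y)\<^sup>2"
    using a by (simp add: a_def power_mult_distrib pos_divide_le_eq mult.commute)
  then show ?thesis
    by (rule power2_le_imp_le) (use x y in simp)
qed

lemma norm_triangle:
  assumes x: "x \<in> C" and y: "y \<in> C" shows "N (x + y) \<le> N x + N y"
proof -
  have "Re (x \<bullet>\<bullet> y) \<le> N x * N y"
    using cauchy_schwarz[OF x y] complex_Re_le_cmod order_trans by blast
  then have "(N (x + y))\<^sup>2 \<le> (N x + N y)\<^sup>2"
    using assms by (simp add: norm_add_sq power2_sum)
  then show ?thesis by (rule power2_le_imp_le) (use assms in simp)
qed

sublocale ms: Metric_space "hcarrier H" "hdist H"
proof
  fix x y z :: 'h
  show "0 \<le> hdist H x y"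
    using inner_pos by (simp add: hdist_def hnorm_def)
  show "hdist H x y = hdist H y x"
    using inner_uminus[of "x - y"] by (simp add: hdist_def hnorm_def)
  show "x \<in> C \<Longrightarrow> y \<in> C \<Longrightarrow> (hdist H x y = 0) = (x = y)"
    using norm_eq_0[of "x - y"] by (simp add: hdist_def)
  show "hdist H x z \<le> hdist H x y + hdist H y z" if "x \<in> C" "y \<in> C" "z \<in> C"
    using norm_triangle[of "x - y" "y - z"] that by (simp add: hdist_def)
qed

end

section \<open>Bounded operators, traces and functional calculus\<close>

lemma bounded_opI:
  assumes "\<And>x. x \<in> hcarrier H \<Longrightarrow> T x \<in> hcarrier H"
    and "\<And>x y. x \<in> hcarrier H \<Longrightarrow> y \<in> hcarrier H \<Longrightarrow> T (x + y) = T x + T y"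
    and "\<And>c x. x \<in> hcarrier H \<Longrightarrow> T (hscale H c x) = hscale H c (T x)"
    and "\<And>x. x \<in> hcarrier H \<Longrightarrow> hnorm H (T x) \<le> K * hnorm H x"
  shows "bounded_op H T"
  unfolding bounded_op_def using assms by blast

lemma bounded_op_closed: "bounded_op H T \<Longrightarrow> x \<in> hcarrier H \<Longrightarrow> T x \<in> hcarrier H"
  and bounded_op_add: "bounded_op H T \<Longrightarrow> x \<in> hcarrier H \<Longrightarrow> y \<in> hcarrier H \<Longrightarrow> T (x + y) = T x + T y"
  and bounded_op_scale: "bounded_op H T \<Longrightarrow> x \<in> hcarrier H \<Longrightarrow> T (hscale H c x) = hscale H c (T x)"
  by (auto simp: bounded_op_def)

lemma bounded_op_cong:
  assumes "bounded_op H T" "\<And>x. x \<in> hcarrier H \<Longrightarrow> T' x = T x"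
    "\<And>x y. x \<in> hcarrier H \<Longrightarrow> y \<in> hcarrier H \<Longrightarrow> x + y \<in> hcarrier H"
    "\<And>c x. x \<in> hcarrier H \<Longrightarrow> hscale H c x \<in> hcarrier H"
  shows "bounded_op H T'"
  using assms unfolding bounded_op_def by simp

context pre_hilbert
begin

lemma bounded_op_norm:
  assumes "bounded_op H T"
  obtains K where "K \<ge> 0" "\<And>x. x \<in> C \<Longrightarrow> N (T x) \<le> K * N x"
proof -
  obtain K where K: "\<forall>x\<in>C. N (T x) \<le> K * N x" using assms by (auto simp: bounded_op_def)
  have "N (T x) \<le> max K 0 * N x" if "x \<in> C" for x
    using K that mult_right_mono[of K "max K 0" "N x"] by fastforce
  then show ?thesis using that[of "max K 0"] by simp
qed

lemma bounded_op_id: "bounded_op H (\<lambda>x. x)"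
  by (rule bounded_opI[where K=1]) auto

lemma bounded_op_zero: "bounded_op H (\<lambda>x. 0)"
  by (rule bounded_opI[where K=0]) auto

lemma bounded_op_comp:
  assumes S: "bounded_op H S" and T: "bounded_op H T" shows "bounded_op H (\<lambda>x. S (T x))"
proof -
  obtain K where K: "K \<ge> 0" "\<And>x. x \<in> C \<Longrightarrow> N (S x) \<le> K * N x" by (rule bounded_op_norm[OF S]) blast
  obtain L where L: "L \<ge> 0" "\<And>x. x \<in> C \<Longrightarrow> N (T x) \<le> L * N x" by (rule bounded_op_norm[OF T]) blast
  show ?thesis
  proof (rule bounded_opI[where K="K * L"])
    fix x assume x: "x \<in> C"
    then have "N (S (T x)) \<le> K * N (T x)" using K bounded_op_closed[OF T] by blast
    also have "\<dots> \<le> K * (L * N x)" using K L x by (intro mult_left_mono) auto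
    finally show "N (S (T x)) \<le> K * L * N x" by (simp add: mult.assoc)
  qed (simp_all add: bounded_op_closed[OF S] bounded_op_closed[OF T] bounded_op_add[OF S]
      bounded_op_add[OF T] bounded_op_scale[OF S] bounded_op_scale[OF T])
qed

lemma bounded_op_plus:
  assumes S: "bounded_op H S" and T: "bounded_op H T" shows "bounded_op H (\<lambda>x. S x + T x)"
proof -
  obtain K where K: "K \<ge> 0" "\<And>x. x \<in> C \<Longrightarrow> N (S x) \<le> K * N x" by (rule bounded_op_norm[OF S]) blast
  obtain L where L: "L \<ge> 0" "\<And>x. x \<in> C \<Longrightarrow> N (T x) \<le> L * N x" by (rule bounded_op_norm[OF T]) blast
  show ?thesis
  proof (rule bounded_opI[where K="K + L"])
    fix x assume x: "x \<in> C"
    then have "N (S x + T x) \<le> N (S x) + N (T x)"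
      using bounded_op_closed[OF T] bounded_op_closed[OF S] norm_triangle by blast
    also have "\<dots> \<le> (K + L) * N x" using K(2)[OF x] L(2)[OF x] by (simp add: algebra_simps)
    finally show "N (S x + T x) \<le> (K + L) * N x" .
  qed (simp_all add: bounded_op_closed[OF S] bounded_op_closed[OF T] bounded_op_add[OF S]
      bounded_op_add[OF T] bounded_op_scale[OF S] bounded_op_scale[OF T] vs.scale_right_distrib)
qed

lemma bounded_op_scaled:
  assumes T: "bounded_op H T" shows "bounded_op H (\<lambda>x. c *h T x)"
proof -
  obtain L where L: "L \<ge> 0" "\<And>x. x \<in> C \<Longrightarrow> N (T x) \<le> L * N x" by (rule bounded_op_norm[OF T]) blast
  show ?thesis
  proof (rule bounded_opI[where K="cmod c * L"])
    fix x assume x: "x \<in> C"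
    show "N (c *h T x) \<le> cmod c * L * N x"
      using mult_left_mono[OF L(2)[OF x], of "cmod c"] x
      by (simp add: norm_scale bounded_op_closed[OF T] mult.assoc)
  qed (simp_all add: bounded_op_closed[OF T]
      bounded_op_add[OF T] bounded_op_scale[OF T] vs.scale_right_distrib mult.commute)
qed

lemma bounded_op_uminus: "bounded_op H T \<Longrightarrow> bounded_op H (\<lambda>x. - T x)"
  using bounded_op_scaled[of T "-1"] by simp

lemma bounded_op_diff:
  "bounded_op H S \<Longrightarrow> bounded_op H T \<Longrightarrow> bounded_op H (\<lambda>x. S x - T x)"
  using bounded_op_plus[OF _ bounded_op_uminus, of S T] by simp

lemma bounded_op_sum:
  "(\<And>i. i \<in> I \<Longrightarrow> bounded_op H (T i)) \<Longrightarrow> bounded_op H (\<lambda>x. \<Sum>i\<in>I. T i x)"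
  by (induction I rule: infinite_finite_induct) (auto simp: bounded_op_zero bounded_op_plus)

lemma bounded_op_cong': "bounded_op H T \<Longrightarrow> (\<And>x. x \<in> C \<Longrightarrow> T' x = T x) \<Longrightarrow> bounded_op H T'"
  by (rule bounded_op_cong) auto

lemma bounded_op_0: "bounded_op H T \<Longrightarrow> T 0 = 0"
  using bounded_op_scale[of H T 0 0] by simp

lemma bounded_op_minus: "bounded_op H T \<Longrightarrow> x \<in> C \<Longrightarrow> T (- x) = - T x"
  using bounded_op_scale[of H T x "-1"] by simp

lemma bounded_op_minus2: "bounded_op H T \<Longrightarrow> x \<in> C \<Longrightarrow> y \<in> C \<Longrightarrow> T (x - y) = T x - T y"
  using bounded_op_add[of H T x "-y"] bounded_op_minus[of T y] by simp

lemma bounded_op_of_sum: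
  "bounded_op H T \<Longrightarrow> (\<And>i. i \<in> A \<Longrightarrow> f i \<in> C) \<Longrightarrow> T (sum f A) = (\<Sum>i\<in>A. T (f i))"
  by (induction A rule: infinite_finite_induct) (auto simp: bounded_op_0 bounded_op_add)

lemma inner_eqI:
  assumes "x \<in> C" "y \<in> C" "\<And>z. z \<in> C \<Longrightarrow> x \<bullet>\<bullet> z = y \<bullet>\<bullet> z" shows "x = y"
proof -
  have "(x - y) \<bullet>\<bullet> (x - y) = 0"
    using assms by (simp add: inner_diff_left)
  then show ?thesis using inner_definite[of "x - y"] assms by simp
qed

lemma hadjoint_eqI:
  assumes "y \<in> C" "\<And>z. z \<in> C \<Longrightarrow> y \<bullet>\<bullet> z = x \<bullet>\<bullet> T z"
  shows "hadjoint H T x = y"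
  unfolding hadjoint_def
proof (rule the_equality)
  show "y \<in> C \<and> (\<forall>z\<in>C. y \<bullet>\<bullet> z = x \<bullet>\<bullet> T z)" using assms by blast
  show "y' = y" if "y' \<in> C \<and> (\<forall>z\<in>C. y' \<bullet>\<bullet> z = x \<bullet>\<bullet> T z)" for y'
    using that assms by (intro inner_eqI) auto
qed

lemma hdense_iff:
  assumes "S \<subseteq> C" shows "hdense H S \<longleftrightarrow> (\<forall>x\<in>C. \<forall>r>0. \<exists>y\<in>S. N (x - y) < r)"
proof -
  have "htop H closure_of S = {x \<in> C. \<forall>r>0. \<exists>y\<in>S. N (x - y) < r}"
    unfolding htop_def ms.metric_closure_of using assms by (auto simp: hdist_def; blast)
  then have "hdense H S \<longleftrightarrow> {x \<in> C. \<forall>r>0. \<exists>y\<in>S. N (x - y) < r} = C"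
    using assms by (simp add: hdense_def)
  also have "\<dots> \<longleftrightarrow> (\<forall>x\<in>C. \<forall>r>0. \<exists>y\<in>S. N (x - y) < r)" by blast
  finally show ?thesis .
qed

text \<open>
  A bounded functional is continuous, so its values on a dense span determine it.
\<close>

lemma functional_zero_dense:
  fixes \<phi> :: "'h \<Rightarrow> complex"
  assumes D: "hdense H (module.span (hscale H) E)" and E: "E \<subseteq> C"
    and add: "\<And>x y. x \<in> C \<Longrightarrow> y \<in> C \<Longrightarrow> \<phi> (x + y) = \<phi> x + \<phi> y"
    and scale: "\<And>c x. x \<in> C \<Longrightarrow> \<phi> (c *h x) = c * \<phi> x"
    and bound: "\<And>x. x \<in> C \<Longrightarrow> cmod (\<phi> x) \<le> K * N x"
    and zero: "\<And>e. e \<in> E \<Longrightarrow> \<phi> e = 0"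
    and x: "x \<in> C"
  shows "\<phi> x = 0"
proof (rule ccontr)
  assume nz: "\<phi> x \<noteq> 0"
  have sub: "vs.span E \<subseteq> C" using E carrier_subspace vs.span_minimal by blast
  have span0: "\<phi> y = 0" if "y \<in> vs.span E" for y
  proof -
    have "vs.subspace {y \<in> C. \<phi> y = 0}"
      unfolding vs.subspace_def using scale[of 0 0] by (auto simp: add scale)
    then have "vs.span E \<subseteq> {y \<in> C. \<phi> y = 0}"
      by (rule vs.span_minimal[rotated]) (use E zero in auto)
    then show ?thesis using that by auto
  qed
  \<comment> \<open>the summand \<open>1\<close> keeps the denominator positive when \<open>K = 0\<close>\<close>
  define r where "r = cmod (\<phi> x) / (\<bar>K\<bar> + 1)"
  have "r > 0" using nz by (simp add: r_def)
  then obtain y where y: "y \<in> vs.span E" "N (x - y) < r"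
    using D hdense_iff[OF sub] x by blast
  have yC: "y \<in> C" using y sub by blast
  have "\<phi> x = \<phi> (x - y) + \<phi> y" using add[of "x - y" y] x yC by simp
  then have "cmod (\<phi> x) \<le> K * N (x - y)" using span0[OF y(1)] bound[of "x - y"] x yC by simp
  also have "\<dots> \<le> (\<bar>K\<bar> + 1) * N (x - y)"
    using x yC by (intro mult_right_mono) auto
  also have "\<dots> < (\<bar>K\<bar> + 1) * r" using y by (intro mult_strict_left_mono) auto
  also have "\<dots> = cmod (\<phi> x)" by (simp add: r_def)
  finally show False by simp
qed

lemma orthogonal_onb_zero:
  assumes "orthonormal_basis H E" "x \<in> C" "\<And>e. e \<in> E \<Longrightarrow> e \<bullet>\<bullet> x = 0" shows "x = 0"
proof -
  have E: "E \<subseteq> C" using assms(1) by (simp add: orthonormal_basis_def)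
  have "x \<bullet>\<bullet> x = 0"
  proof (rule functional_zero_dense[where E=E and K="N x" and \<phi>="\<lambda>y. x \<bullet>\<bullet> y"])
    show "hdense H (vs.span E)" using assms(1) by (simp add: orthonormal_basis_def)
    show "x \<bullet>\<bullet> e = 0" if "e \<in> E" for e
      using assms(3)[OF that] inner_cnj[of e x] E that assms(2) by auto
  qed (use assms E in \<open>auto simp: inner_add inner_scale cauchy_schwarz\<close>)
  then show ?thesis using inner_definite assms(2) by blast
qed

text \<open>
  Among all combinations of a finite orthonormal set \<open>G'\<close>, the one with the coefficients
  \<open>hinner H e x\<close> is closest to \<open>x\<close>; its squared distance is the defect in Bessel's inequality, and density of
  the span makes it small. This half of Parseval's identity is all that the comparison of traces uses, so
  no infinite expansion is needed.
\<close>

lemma parseval_approx: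
  assumes E: "orthonormal_basis H E" and x: "x \<in> C" and "\<epsilon> > 0"
  obtains G where "finite G" "G \<subseteq> E"
    "\<And>G'. finite G' \<Longrightarrow> G \<subseteq> G' \<Longrightarrow> G' \<subseteq> E \<Longrightarrow> (N x)\<^sup>2 - \<epsilon> \<le> (\<Sum>e\<in>G'. (cmod (e \<bullet>\<bullet> x))\<^sup>2)"
proof -
  have EC: "E \<subseteq> C" using E by (simp add: orthonormal_basis_def)
  then have sub: "vs.span E \<subseteq> C" using carrier_subspace vs.span_minimal by blast
  have "sqrt \<epsilon> > 0" using \<open>\<epsilon> > 0\<close> by simp
  then obtain u where u: "u \<in> vs.span E" "N (x - u) < sqrt \<epsilon>"
    using E x hdense_iff[OF sub] unfolding orthonormal_basis_def by blast
  obtain G c where G: "finite G" "G \<subseteq> E" "u = (\<Sum>e\<in>G. c e *h e)"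
    using u(1) unfolding vs.span_explicit by blast
  have "(N x)\<^sup>2 - \<epsilon> \<le> (\<Sum>e\<in>G'. (cmod (e \<bullet>\<bullet> x))\<^sup>2)"
    if G': "finite G'" "G \<subseteq> G'" "G' \<subseteq> E" for G'
  proof -
    define d where "d e = (if e \<in> G then c e else 0)" for e
    have eC: "e \<in> C" if "e \<in> G'" for e using that G' EC by blast
    have u': "u = (\<Sum>e\<in>G'. d e *h e)"
      unfolding G(3) using G' by (intro sum.mono_neutral_cong_left) (auto simp: d_def)
    have uC: "u \<in> C" using u sub by blast
    have orth: "e \<bullet>\<bullet> e' = (if e = e' then 1 else 0)" if "e \<in> G'" "e' \<in> G'" for e e'
      using E that G' unfolding orthonormal_basis_def by blast
    have eu: "e \<bullet>\<bullet> u = d e" if "e \<in> G'" for e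
    proof -
      have "e \<bullet>\<bullet> u = (\<Sum>e'\<in>G'. d e' * (e \<bullet>\<bullet> e'))"
        unfolding u' using eC that by (simp add: inner_sum inner_scale)
      also have "\<dots> = (\<Sum>e'\<in>G'. if e = e' then d e' else 0)"
        using orth that by (intro sum.cong) auto
      finally show ?thesis using G'(1) that by simp
    qed
    have ul: "u \<bullet>\<bullet> v = (\<Sum>e\<in>G'. cnj (d e) * (e \<bullet>\<bullet> v))" if "v \<in> C" for v
      unfolding u' using eC that by (simp add: inner_sum_left inner_scale_left)
    have "(N (x - u))\<^sup>2 = Re (x \<bullet>\<bullet> x) - Re (x \<bullet>\<bullet> u) - Re (u \<bullet>\<bullet> x) + Re (u \<bullet>\<bullet> u)"
      using x uC by (simp add: norm_sq inner_diff inner_diff_left)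
    also have "\<dots> = (N x)\<^sup>2 - 2 * Re (u \<bullet>\<bullet> x) + Re (u \<bullet>\<bullet> u)"
      using x uC inner_cnj[of x u] by (simp add: norm_sq)
    also have "\<dots> = (N x)\<^sup>2 - (\<Sum>e\<in>G'. 2 * Re (cnj (d e) * (e \<bullet>\<bullet> x)) - (cmod (d e))\<^sup>2)"
      using x uC eu
      by (simp add: ul sum_distrib_left sum_subtractf cmod_power2 power2_eq_square[symmetric] cong: sum.cong)
    also have "\<dots> \<ge> (N x)\<^sup>2 - (\<Sum>e\<in>G'. (cmod (e \<bullet>\<bullet> x))\<^sup>2)"
    proof -
      have "2 * Re (cnj a * b) - (cmod a)\<^sup>2 \<le> (cmod b)\<^sup>2" for a b
        using sum_power2_ge_zero[of "Re a - Re b" "Im a - Im b"]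
        by (simp add: cmod_power2 algebra_simps power2_diff)
      then show ?thesis by (simp add: sum_mono)
    qed
    finally have "(N x)\<^sup>2 - (\<Sum>e\<in>G'. (cmod (e \<bullet>\<bullet> x))\<^sup>2) \<le> (N (x - u))\<^sup>2" .
    also have "\<dots> \<le> (sqrt \<epsilon>)\<^sup>2" using u(2) x uC by (intro power_mono) auto
    finally show ?thesis using \<open>\<epsilon> > 0\<close> by simp
  qed
  then show ?thesis using that G by blast
qed

text \<open>
  Polarization: the quadratic form is real at \<open>x + y\<close> and at \<open>x + \<i> y\<close>.
\<close>

lemma positive_symmetric:
  assumes P: "bounded_op H P" and real: "\<And>x. x \<in> C \<Longrightarrow> x \<bullet>\<bullet> P x \<in> \<real>"
    and x: "x \<in> C" and y: "y \<in> C"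
  shows "y \<bullet>\<bullet> P x = cnj (x \<bullet>\<bullet> P y)"
proof -
  note [simp] = x y bounded_op_closed[OF P] bounded_op_add[OF P] bounded_op_scale[OF P]
    inner_add inner_add_left inner_scale inner_scale_left
  have "Im ((x + y) \<bullet>\<bullet> P (x + y)) = 0" "Im ((x + \<i> *h y) \<bullet>\<bullet> P (x + \<i> *h y)) = 0"
    "Im (x \<bullet>\<bullet> P x) = 0" "Im (y \<bullet>\<bullet> P y) = 0"
    using real[of "x + y"] real[of "x + \<i> *h y"] real[of x] real[of y]
    by (simp_all only: complex_is_Real_iff) simp_all
  then show ?thesis by (simp add: complex_eq_iff)
qed

text \<open>
  Decompose \<open>x = p + y\<close> with \<open>p\<close> in the span of the eigenvectors \<open>b i\<close>. By symmetry \<open>P y\<close> stays orthogonal to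
  this span, so the form of \<open>P\<close> at \<open>x\<close> is the sum on the left plus the form at \<open>y\<close>, which is
  nonnegative.
\<close>

lemma positive_lower_bound:
  fixes b :: "'i \<Rightarrow> 'h" and lam :: "'i \<Rightarrow> real"
  assumes P: "bounded_op H P"
    and pos: "\<And>x. x \<in> C \<Longrightarrow> x \<bullet>\<bullet> P x \<in> \<real> \<and> 0 \<le> Re (x \<bullet>\<bullet> P x)"
    and F: "finite F" and bC: "\<And>i. i \<in> F \<Longrightarrow> b i \<in> C"
    and orth: "\<And>i j. i \<in> F \<Longrightarrow> j \<in> F \<Longrightarrow> b i \<bullet>\<bullet> b j = (if i = j then 1 else 0)"
    and eig: "\<And>i. i \<in> F \<Longrightarrow> P (b i) = of_real (lam i) *h b i"
    and x: "x \<in> C"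
  shows "(\<Sum>i\<in>F. lam i * (cmod (b i \<bullet>\<bullet> x))\<^sup>2) \<le> Re (x \<bullet>\<bullet> P x)"
proof -
  define a where "a i = b i \<bullet>\<bullet> x" for i
  define p where "p = (\<Sum>i\<in>F. a i *h b i)"
  define y where "y = x - p"
  have pC: "p \<in> C" unfolding p_def using bC by blast
  then have yC: "y \<in> C" using x by (simp add: y_def)
  have bp: "b j \<bullet>\<bullet> p = a j" if "j \<in> F" for j
  proof -
    have "b j \<bullet>\<bullet> p = (\<Sum>i\<in>F. a i * (b j \<bullet>\<bullet> b i))"
      unfolding p_def using bC that by (simp add: inner_sum inner_scale)
    also have "\<dots> = (\<Sum>i\<in>F. if j = i then a i else 0)" using orth that by (intro sum.cong) auto
    finally show ?thesis using F that by simp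
  qed
  have by0: "b j \<bullet>\<bullet> y = 0" if "j \<in> F" for j
    unfolding y_def using that bC x pC bp by (simp add: inner_diff a_def)
  have Pp: "P p = (\<Sum>i\<in>F. (a i * of_real (lam i)) *h b i)"
    unfolding p_def using bC by (simp add: bounded_op_of_sum[OF P] bounded_op_scale[OF P] eig)
  have bPx: "b j \<bullet>\<bullet> P x = of_real (lam j) * a j" if j: "j \<in> F" for j
  proof -
    have "b j \<bullet>\<bullet> P x = cnj (x \<bullet>\<bullet> P (b j))"
      using positive_symmetric[OF P] pos x bC j by blast
    also have "x \<bullet>\<bullet> P (b j) = of_real (lam j) * (x \<bullet>\<bullet> b j)" using eig j x bC by (simp add: inner_scale)
    finally show ?thesis using inner_cnj[of "b j" x] bC j x by (simp add: a_def)
  qed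
  have bPy: "b j \<bullet>\<bullet> P y = 0" if j: "j \<in> F" for j
  proof -
    have "b j \<bullet>\<bullet> P p = (\<Sum>i\<in>F. a i * of_real (lam i) * (b j \<bullet>\<bullet> b i))"
      unfolding Pp using bC that by (simp add: inner_sum inner_scale)
    also have "\<dots> = (\<Sum>i\<in>F. if j = i then a i * of_real (lam i) else 0)" using orth that by (intro sum.cong) auto
    finally have "b j \<bullet>\<bullet> P p = a j * of_real (lam j)" using F that by simp
    then show ?thesis unfolding y_def
      using x pC bC j bPx[OF j] by (simp add: bounded_op_minus2[OF P] inner_diff bounded_op_closed[OF P])
  qed
  have "y \<bullet>\<bullet> P y = x \<bullet>\<bullet> P y"
  proof -
    have "p \<bullet>\<bullet> P y = 0"
      unfolding p_def using bC bPy yC by (simp add: inner_sum_left inner_scale_left bounded_op_closed[OF P])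
    then show ?thesis
      using x pC yC by (subst (1) y_def) (simp add: inner_diff_left bounded_op_closed[OF P])
  qed
  also have "\<dots> = x \<bullet>\<bullet> P x - x \<bullet>\<bullet> P p"
    unfolding y_def using x pC by (simp add: bounded_op_minus2[OF P] inner_diff bounded_op_closed[OF P])
  also have "x \<bullet>\<bullet> P p = (\<Sum>i\<in>F. of_real (lam i * (cmod (a i))\<^sup>2))"
  proof -
    have "x \<bullet>\<bullet> P p = (\<Sum>i\<in>F. a i * of_real (lam i) * (x \<bullet>\<bullet> b i))"
      unfolding Pp using bC x by (simp add: inner_sum inner_scale)
    also have "\<dots> = (\<Sum>i\<in>F. of_real (lam i * (cmod (a i))\<^sup>2))"
    proof (rule sum.cong[OF refl])
      fix i assume "i \<in> F"
      then have "x \<bullet>\<bullet> b i = cnj (a i)" using inner_cnj[of "b i" x] bC x by (simp add: a_def)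
      then show "a i * of_real (lam i) * (x \<bullet>\<bullet> b i) = of_real (lam i * (cmod (a i))\<^sup>2)"
        using complex_norm_square[of "a i"] by (simp add: mult_ac)
    qed
    finally show ?thesis .
  qed
  finally have "Re (x \<bullet>\<bullet> P x) - (\<Sum>i\<in>F. lam i * (cmod (a i))\<^sup>2) = Re (y \<bullet>\<bullet> P y)"
    by simp
  also have "\<dots> \<ge> 0" using pos yC by blast
  finally show ?thesis by (simp add: a_def)
qed

text \<open>
  Uniqueness of the positive square root, on one eigenvector: \<open>w = P v - l v\<close> satisfies
  \<open>P w = - l w\<close>, which positivity of \<open>P\<close> allows only for \<open>w = 0\<close>.
\<close>

lemma abs_op_eigen:
  assumes abs: "abs_op H T P" and v: "v \<in> C" and TT: "hadjoint H T (T v) = of_real (l\<^sup>2) *h v" and l: "l > 0"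
  shows "P v = of_real l *h v"
proof -
  have P: "bounded_op H P" and pos: "\<And>x. x \<in> C \<Longrightarrow> 0 \<le> Re (x \<bullet>\<bullet> P x)"
    and PP: "P (P v) = of_real (l\<^sup>2) *h v"
    using abs v TT by (auto simp: abs_op_def)
  define w where "w = P v - of_real l *h v"
  have wC: "w \<in> C" using v by (simp add: w_def bounded_op_closed[OF P])
  have "P w = - (of_real l *h w)"
    unfolding w_def using v PP
    by (simp add: bounded_op_minus2[OF P] bounded_op_closed[OF P] bounded_op_scale[OF P] vs.scale_right_diff_distrib
        power2_eq_square)
  then have "Re (w \<bullet>\<bullet> P w) = - (l * (N w)\<^sup>2)"
    using wC by (simp add: inner_minus_right inner_scale inner_self)
  then have "l * (N w)\<^sup>2 \<le> 0" using pos[OF wC] by simp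
  then have "N w = 0" using l by (simp add: mult_le_0_iff)
  then show ?thesis using norm_eq_0[OF wC] by (simp add: w_def)
qed

text \<open>
  The trace is finite in some orthonormal basis \<open>E\<close>, unrelated to the eigenvectors \<open>b i\<close>. Expanding the
  eigenvectors in \<open>E\<close> costs a factor \<open>2\<close>: a finite part of \<open>E\<close> captures half of the norm of
  each of finitely many \<open>b i\<close>, and the form of the absolute value at \<open>e\<close> dominates the contribution of the \<open>b i\<close> to \<open>e\<close>.
\<close>

lemma trace_class_eigenvalue_bound:
  fixes b :: "'i \<Rightarrow> 'h" and lam :: "'i \<Rightarrow> real"
  assumes T: "trace_class H T"
    and bC: "\<And>i. i \<in> J \<Longrightarrow> b i \<in> C"
    and orth: "\<And>i j. i \<in> J \<Longrightarrow> j \<in> J \<Longrightarrow> b i \<bullet>\<bullet> b j = (if i = j then 1 else 0)"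
    and eig: "\<And>i. i \<in> J \<Longrightarrow> hadjoint H T (T (b i)) = of_real ((lam i)\<^sup>2) *h b i"
    and pos: "\<And>i. i \<in> J \<Longrightarrow> lam i > 0"
  obtains B where "\<And>F. finite F \<Longrightarrow> F \<subseteq> J \<Longrightarrow> (\<Sum>i\<in>F. lam i) \<le> B"
proof -
  obtain P E where abs: "abs_op H T P" and E: "orthonormal_basis H E"
    and summ: "(\<lambda>e. e \<bullet>\<bullet> P e) summable_on E"
    using T by (auto simp: trace_class_def)
  have P: "bounded_op H P" and Ppos: "\<And>x. x \<in> C \<Longrightarrow> x \<bullet>\<bullet> P x \<in> \<real> \<and> 0 \<le> Re (x \<bullet>\<bullet> P x)"
    using abs by (auto simp: abs_op_def)
  have EC: "E \<subseteq> C" using E by (simp add: orthonormal_basis_def)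
  have Peig: "P (b i) = of_real (lam i) *h b i" if "i \<in> J" for i
    using abs_op_eigen[OF abs bC eig pos] that by blast
  have summ': "(\<lambda>e. Re (e \<bullet>\<bullet> P e)) summable_on E" by (rule summable_on_Re[OF summ])
  define B where "B = infsum (\<lambda>e. Re (e \<bullet>\<bullet> P e)) E"
  have "(\<Sum>i\<in>F. lam i) \<le> 2 * B" if F: "finite F" "F \<subseteq> J" for F
  proof -
    define Q where "Q i G \<longleftrightarrow> finite G \<and> G \<subseteq> E \<and> (\<forall>G'. finite G' \<longrightarrow> G \<subseteq> G' \<longrightarrow> G' \<subseteq> E \<longrightarrow>
          (N (b i))\<^sup>2 - 1/2 \<le> (\<Sum>e\<in>G'. (cmod (e \<bullet>\<bullet> b i))\<^sup>2))" for i G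
    have "\<forall>i\<in>F. \<exists>G. Q i G"
    proof
      fix i assume "i \<in> F"
      then have "b i \<in> C" using F bC by blast
      then show "\<exists>G. Q i G"
        unfolding Q_def by (rule parseval_approx[OF E _, of _ "1/2"]) (simp, blast)
    qed
    then obtain G where QG: "\<forall>i\<in>F. Q i (G i)" using bchoice[of F Q] by blast
    then have G: "\<And>i. i \<in> F \<Longrightarrow> finite (G i)" "\<And>i. i \<in> F \<Longrightarrow> G i \<subseteq> E"
      "\<And>i G'. i \<in> F \<Longrightarrow> finite G' \<Longrightarrow> G i \<subseteq> G' \<Longrightarrow> G' \<subseteq> E \<Longrightarrow>
          (N (b i))\<^sup>2 - 1/2 \<le> (\<Sum>e\<in>G'. (cmod (e \<bullet>\<bullet> b i))\<^sup>2)"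
      by (simp_all add: Q_def)
    define GG where "GG = (\<Union>i\<in>F. G i)"
    have GG: "finite GG" "GG \<subseteq> E" using G F by (auto simp: GG_def)
    have half: "1/2 \<le> (\<Sum>e\<in>GG. (cmod (b i \<bullet>\<bullet> e))\<^sup>2)" if i: "i \<in> F" for i
    proof -
      have "(N (b i))\<^sup>2 = 1" using norm_sq[of "b i"] bC orth i F by (simp add: subset_iff)
      moreover have "G i \<subseteq> GG" using i by (auto simp: GG_def)
      ultimately have "1/2 \<le> (\<Sum>e\<in>GG. (cmod (e \<bullet>\<bullet> b i))\<^sup>2)" using G(3)[OF i GG(1) _ GG(2)] by simp
      also have "\<dots> = (\<Sum>e\<in>GG. (cmod (b i \<bullet>\<bullet> e))\<^sup>2)"
      proof (rule sum.cong[OF refl])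
        fix e assume "e \<in> GG"
        then have "e \<in> C" "b i \<in> C" using GG EC bC i F by auto
        then show "(cmod (e \<bullet>\<bullet> b i))\<^sup>2 = (cmod (b i \<bullet>\<bullet> e))\<^sup>2" by (metis inner_cnj complex_mod_cnj)
      qed
      finally show ?thesis .
    qed
    have "(\<Sum>i\<in>F. lam i) \<le> (\<Sum>i\<in>F. 2 * (lam i * (\<Sum>e\<in>GG. (cmod (b i \<bullet>\<bullet> e))\<^sup>2)))"
    proof (rule sum_mono)
      fix i assume i: "i \<in> F"
      have "lam i > 0" using pos i F by blast
      then show "lam i \<le> 2 * (lam i * (\<Sum>e\<in>GG. (cmod (b i \<bullet>\<bullet> e))\<^sup>2))"
        using mult_left_mono[OF half[OF i], of "2 * lam i"] by simp
    qed
    also have "\<dots> = 2 * (\<Sum>e\<in>GG. \<Sum>i\<in>F. lam i * (cmod (b i \<bullet>\<bullet> e))\<^sup>2)"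
      by (simp add: sum_distrib_left) (rule sum.swap)
    also have "(\<Sum>e\<in>GG. \<Sum>i\<in>F. lam i * (cmod (b i \<bullet>\<bullet> e))\<^sup>2) \<le> (\<Sum>e\<in>GG. Re (e \<bullet>\<bullet> P e))"
    proof (rule sum_mono)
      fix e assume "e \<in> GG"
      then have "e \<in> C" using GG EC by blast
      then show "(\<Sum>i\<in>F. lam i * (cmod (b i \<bullet>\<bullet> e))\<^sup>2) \<le> Re (e \<bullet>\<bullet> P e)"
        using F(2) by (intro positive_lower_bound[OF P Ppos F(1)]) (simp_all add: bC orth Peig subset_iff)
    qed
    also have "\<dots> \<le> B"
      unfolding B_def using GG EC Ppos by (intro finite_sum_le_infsum[OF summ']) auto
    finally show ?thesis by simp
  qed
  then show ?thesis using that by blast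
qed

text \<open>
  Both sides are bounded functionals of \<open>z\<close>, so they need to be compared only on the eigenbasis that
  defines \<open>T\<close>; there they agree because eigenvectors of a symmetric operator with different eigenvalues
  are orthogonal.
\<close>

lemma functional_calculus_pairing:
  assumes sym: "\<And>x y. x \<in> opdom D \<Longrightarrow> y \<in> opdom D \<Longrightarrow> x \<bullet>\<bullet> opapp D y = opapp D x \<bullet>\<bullet> y"
    and dom: "opdom D \<subseteq> C"
    and fc: "functional_calculus H D f T"
    and v: "v \<in> opdom D" "opapp D v = of_real s *h v" and z: "z \<in> C"
  shows "v \<bullet>\<bullet> T z = of_real (f s) * (v \<bullet>\<bullet> z)"
proof -
  obtain E where T: "bounded_op H T" and E: "orthonormal_basis H E"
    and eig: "\<And>e. e \<in> E \<Longrightarrow> \<exists>t::real. e \<in> opdom D \<and> opapp D e = of_real t *h e \<and> T e = of_real (f t) *h e"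
    using fc unfolding functional_calculus_def by blast
  have EC: "E \<subseteq> C" and dense: "hdense H (vs.span E)" using E by (auto simp: orthonormal_basis_def)
  obtain K where K: "K \<ge> 0" "\<And>x. x \<in> C \<Longrightarrow> N (T x) \<le> K * N x" by (rule bounded_op_norm[OF T]) blast
  have vC: "v \<in> C" using v dom by blast
  have "v \<bullet>\<bullet> T z - of_real (f s) * (v \<bullet>\<bullet> z) = 0"
  proof (rule functional_zero_dense[OF dense EC, where K="N v * K + \<bar>f s\<bar> * N v"
        and \<phi>="\<lambda>z. v \<bullet>\<bullet> T z - of_real (f s) * (v \<bullet>\<bullet> z)"])
    fix x assume x: "x \<in> C"
    have "cmod (v \<bullet>\<bullet> T x) \<le> N v * N (T x)" using vC x by (simp add: cauchy_schwarz bounded_op_closed[OF T])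
    also have "\<dots> \<le> N v * (K * N x)" using K vC x by (intro mult_left_mono) auto
    finally have 1: "cmod (v \<bullet>\<bullet> T x) \<le> N v * K * N x" by simp
    have 2: "cmod (of_real (f s) * (v \<bullet>\<bullet> x)) \<le> \<bar>f s\<bar> * N v * N x"
      using mult_left_mono[OF cauchy_schwarz[OF vC x], of "\<bar>f s\<bar>"] by (simp add: norm_mult mult.assoc)
    show "cmod (v \<bullet>\<bullet> T x - of_real (f s) * (v \<bullet>\<bullet> x)) \<le> (N v * K + \<bar>f s\<bar> * N v) * N x"
      using norm_triangle_ineq4[of "v \<bullet>\<bullet> T x" "of_real (f s) * (v \<bullet>\<bullet> x)"] 1 2
      by (simp add: algebra_simps)
  next
    fix e assume e: "e \<in> E"
    then obtain r where r: "e \<in> opdom D" "opapp D e = of_real r *h e" "T e = of_real (f r) *h e"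
      using eig by blast
    have eC: "e \<in> C" using e EC by blast
    have "of_real r * (v \<bullet>\<bullet> e) = of_real s * (v \<bullet>\<bullet> e)"
      using sym[OF v(1) r(1)] r(2) v(2) vC eC by (simp add: inner_scale inner_scale_left)
    then have "r = s \<or> v \<bullet>\<bullet> e = 0" by auto
    then show "v \<bullet>\<bullet> T e - of_real (f s) * (v \<bullet>\<bullet> e) = 0"
      using r vC eC by (auto simp: inner_scale)
  qed (use vC z in \<open>auto simp: bounded_op_add[OF T] bounded_op_scale[OF T] bounded_op_closed[OF T]
        inner_add inner_scale algebra_simps\<close>)
  then show ?thesis by simp
qed

text \<open>
  An operator obtained by functional calculus does not depend on the eigenbasis used to define it.
\<close>

lemma functional_calculus_eigen:
  assumes sym: "\<And>x y. x \<in> opdom D \<Longrightarrow> y \<in> opdom D \<Longrightarrow> x \<bullet>\<bullet> opapp D y = opapp D x \<bullet>\<bullet> y"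
    and dom: "opdom D \<subseteq> C"
    and fc: "functional_calculus H D f T"
    and b: "b \<in> opdom D" "opapp D b = of_real t *h b"
  shows "T b = of_real (f t) *h b"
proof -
  obtain E where T: "bounded_op H T" and E: "orthonormal_basis H E"
    and eig: "\<And>e. e \<in> E \<Longrightarrow> \<exists>t::real. e \<in> opdom D \<and> opapp D e = of_real t *h e \<and> T e = of_real (f t) *h e"
    using fc unfolding functional_calculus_def by blast
  have EC: "E \<subseteq> C" using E by (simp add: orthonormal_basis_def)
  have key: "v \<bullet>\<bullet> T z = of_real (f s) * (v \<bullet>\<bullet> z)"
    if "v \<in> opdom D" "opapp D v = of_real s *h v" "z \<in> C" for v s z
    by (rule functional_calculus_pairing[OF _ dom fc that]) (rule sym)
  have bC: "b \<in> C" using b dom by blast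
  have "T b - of_real (f t) *h b = 0"
  proof (rule orthogonal_onb_zero[OF E])
    show "T b - of_real (f t) *h b \<in> C" using bC bounded_op_closed[OF T] by simp
    fix e assume e: "e \<in> E"
    then obtain r where r: "e \<in> opdom D" "opapp D e = of_real r *h e" using eig by blast
    have eC: "e \<in> C" using e EC by blast
    have "of_real t * (e \<bullet>\<bullet> b) = of_real r * (e \<bullet>\<bullet> b)"
      using sym[OF r(1) b(1)] r(2) b(2) bC eC by (simp add: inner_scale inner_scale_left)
    then have "r = t \<or> e \<bullet>\<bullet> b = 0" by auto
    then show "e \<bullet>\<bullet> (T b - of_real (f t) *h b) = 0"
      using key[OF r bC] eC bC by (auto simp: inner_diff inner_scale bounded_op_closed[OF T])
  qed
  then show "T b = of_real (f t) *h b" by simp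
qed

end

locale hilbert = pre_hilbert +
  assumes complete: "Metric_space.mcomplete (hcarrier H) (hdist H)"
begin

lemma hilbert_space: "hilbert_space H"
  unfolding hilbert_space_def
  by (intro conjI ballI allI impI vec carrier_subspace inner_add inner_scale inner_pos inner_definite
      complete, rule inner_cnj)

text \<open>
  In a complete space, relative compactness of the image of the unit ball is total boundedness. The
  centres \<open>K\<close> of the net may lie anywhere; total boundedness asks for centres in
  the image, which is repaired at the price of a factor \<open>2\<close> in the radius.
\<close>

lemma compact_opI:
  assumes T: "bounded_op H T"
    and net: "\<And>\<epsilon>. \<epsilon> > 0 \<Longrightarrow> \<exists>K. finite K \<and> K \<subseteq> C \<and> (\<forall>x\<in>C. N x \<le> 1 \<longrightarrow> (\<exists>k\<in>K. N (T x - k) < \<epsilon>))"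
  shows "compact_op H T"
proof -
  define S where "S = T ` {x \<in> C. N x \<le> 1}"
  have SC: "S \<subseteq> C" using bounded_op_closed[OF T] by (auto simp: S_def)
  have "ms.mtotally_bounded S"
    unfolding ms.mtotally_bounded_def
  proof (intro allI impI)
    fix \<epsilon> :: real assume "\<epsilon> > 0"
    then obtain K where K: "finite K" "K \<subseteq> C" "\<And>s. s \<in> S \<Longrightarrow> \<exists>k\<in>K. N (s - k) < \<epsilon> / 2"
      using net[of "\<epsilon> / 2"] by (force simp: S_def)
    \<comment> \<open>centres with no nearby image point are dropped, the others are moved into the image\<close>
    define K' where "K' = {k \<in> K. \<exists>s\<in>S. N (s - k) < \<epsilon> / 2}"
    define g where "g k = (SOME s. s \<in> S \<and> N (s - k) < \<epsilon> / 2)" for k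
    have g: "g k \<in> S \<and> N (g k - k) < \<epsilon> / 2" if "k \<in> K'" for k
      unfolding g_def by (rule someI_ex) (use that in \<open>auto simp: K'_def\<close>)
    show "\<exists>K. finite K \<and> K \<subseteq> S \<and> S \<subseteq> (\<Union>x\<in>K. ms.mball x \<epsilon>)"
    proof (intro exI[of _ "g ` K'"] conjI)
      show "finite (g ` K')" using K by (simp add: K'_def)
      show "g ` K' \<subseteq> S" using g by blast
      show "S \<subseteq> (\<Union>x\<in>g ` K'. ms.mball x \<epsilon>)"
      proof
        fix s assume s: "s \<in> S"
        then obtain k where k: "k \<in> K" "N (s - k) < \<epsilon> / 2" using K by blast
        then have k': "k \<in> K'" using s by (auto simp: K'_def)
        have cs: "s \<in> C" "k \<in> C" "g k \<in> C" using s SC k K g[OF k'] by auto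
        have "hdist H (g k) s \<le> hdist H (g k) k + hdist H k s" using ms.triangle cs by blast
        also have "\<dots> < \<epsilon>" using g[OF k'] k cs norm_diff_commute[of k s] by (simp add: hdist_def)
        finally show "s \<in> (\<Union>x\<in>g ` K'. ms.mball x \<epsilon>)" using k' cs by auto
      qed
    qed
  qed
  then have "compactin ms.mtopology (ms.mtopology closure_of S)"
    using ms.mtotally_bounded_eq_compact_closure_of[OF complete] by blast
  then show ?thesis using T by (simp add: compact_op_def htop_def S_def)
qed

end

section \<open>Square-summable functions\<close>

lemma ell2_carrier:
  "\<psi> \<in> hcarrier (ell2 I) \<longleftrightarrow> (\<forall>x. x \<notin> I \<longrightarrow> \<psi> x = 0) \<and> (\<lambda>x. (cmod (\<psi> x))\<^sup>2) summable_on I"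
  by (simp add: ell2_def)

lemma ell2_scale: "hscale (ell2 I) c \<psi> = (\<lambda>x. c * \<psi> x)"
  by (simp add: ell2_def)

lemma ell2_inner: "hinner (ell2 I) \<phi> \<psi> = (\<Sum>\<^sub>\<infinity>x\<in>I. cnj (\<phi> x) * \<psi> x)"
  by (simp add: ell2_def)

lemma ell2_carrierI:
  assumes "\<And>x. x \<notin> I \<Longrightarrow> \<psi> x = 0" "\<And>F. finite F \<Longrightarrow> F \<subseteq> I \<Longrightarrow> (\<Sum>x\<in>F. (cmod (\<psi> x))\<^sup>2) \<le> B"
  shows "\<psi> \<in> hcarrier (ell2 I)"
  unfolding ell2_carrier using assms
  by (auto intro!: nonneg_bdd_above_summable_on bdd_aboveI[where M=B])

lemma ell2_inner_self: "hinner (ell2 I) \<psi> \<psi> = of_real (\<Sum>\<^sub>\<infinity>x\<in>I. (cmod (\<psi> x))\<^sup>2)"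
proof -
  have "hinner (ell2 I) \<psi> \<psi> = (\<Sum>\<^sub>\<infinity>x\<in>I. of_real ((cmod (\<psi> x))\<^sup>2))"
    unfolding ell2_inner by (intro infsum_cong) (metis complex_norm_square mult.commute)
  also have "\<dots> = of_real (\<Sum>\<^sub>\<infinity>x\<in>I. (cmod (\<psi> x))\<^sup>2)"
  proof (cases "(\<lambda>x. (cmod (\<psi> x))\<^sup>2) summable_on I")
    case True
    then show ?thesis by (intro infsumI has_sum_of_real has_sum_infsum)
  next
    case False
    then have "\<not> (\<lambda>x. of_real ((cmod (\<psi> x))\<^sup>2) :: complex) summable_on I"
      using summable_on_Re[of "\<lambda>x. of_real ((cmod (\<psi> x))\<^sup>2)" I] by auto
    then show ?thesis using False by (simp add: infsum_not_exists)
  qed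
  finally show ?thesis .
qed

lemma ell2_norm: "hnorm (ell2 I) \<psi> = sqrt (\<Sum>\<^sub>\<infinity>x\<in>I. (cmod (\<psi> x))\<^sup>2)"
  by (simp add: hnorm_def ell2_inner_self)

lemma ell2_norm_sq: "(hnorm (ell2 I) \<psi>)\<^sup>2 = (\<Sum>\<^sub>\<infinity>x\<in>I. (cmod (\<psi> x))\<^sup>2)"
  by (simp add: ell2_norm infsum_nonneg)

lemma ell2_summable_inner:
  assumes "\<phi> \<in> hcarrier (ell2 I)" "\<psi> \<in> hcarrier (ell2 I)"
  shows "(\<lambda>x. cnj (\<phi> x) * \<psi> x) summable_on I"
proof (rule abs_summable_summable, rule summable_on_comparison_test)
  show "(\<lambda>x. (cmod (\<phi> x))\<^sup>2 + (cmod (\<psi> x))\<^sup>2) summable_on I"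
    using assms by (simp add: ell2_carrier summable_on_add)
  show "norm (cnj (\<phi> x) * \<psi> x) \<le> (cmod (\<phi> x))\<^sup>2 + (cmod (\<psi> x))\<^sup>2" for x
    using sum_squares_bound[of "cmod (\<phi> x)" "cmod (\<psi> x)"]
      mult_nonneg_nonneg[OF norm_ge_zero norm_ge_zero, of "\<phi> x" "\<psi> x"]
    unfolding norm_mult complex_mod_cnj by linarith
qed simp

lemma ell2_add_closed:
  assumes "\<phi> \<in> hcarrier (ell2 I)" "\<psi> \<in> hcarrier (ell2 I)"
  shows "\<phi> + \<psi> \<in> hcarrier (ell2 I)"
  unfolding ell2_carrier
proof (intro conjI)
  show "\<forall>x. x \<notin> I \<longrightarrow> (\<phi> + \<psi>) x = 0" using assms by (simp add: ell2_carrier)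
  show "(\<lambda>x. (cmod ((\<phi> + \<psi>) x))\<^sup>2) summable_on I"
  proof (rule summable_on_comparison_test)
    show "(\<lambda>x. 2 * ((cmod (\<phi> x))\<^sup>2 + (cmod (\<psi> x))\<^sup>2)) summable_on I"
      using assms by (auto simp: ell2_carrier intro!: summable_on_add summable_on_cmult_right)
    fix x
    have "(cmod (\<phi> x + \<psi> x))\<^sup>2 \<le> (cmod (\<phi> x) + cmod (\<psi> x))\<^sup>2"
      by (intro power_mono norm_triangle_ineq) simp
    also have "\<dots> \<le> 2 * ((cmod (\<phi> x))\<^sup>2 + (cmod (\<psi> x))\<^sup>2)"
      using sum_squares_bound[of "cmod (\<phi> x)" "cmod (\<psi> x)"] by (simp add: power2_sum)
    finally show "(cmod ((\<phi> + \<psi>) x))\<^sup>2 \<le> 2 * ((cmod (\<phi> x))\<^sup>2 + (cmod (\<psi> x))\<^sup>2)" by simp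
  qed simp
qed

interpretation ell2: pre_hilbert "ell2 I" for I
proof
  interpret vector_space "hscale (ell2 I)"
    by unfold_locales (auto simp: ell2_scale algebra_simps fun_eq_iff)
  show "\<And>a x y. hscale (ell2 I) a (x + y) = hscale (ell2 I) a x + hscale (ell2 I) a y"
    "\<And>a b x. hscale (ell2 I) (a + b) x = hscale (ell2 I) a x + hscale (ell2 I) b x"
    "\<And>a b x. hscale (ell2 I) a (hscale (ell2 I) b x) = hscale (ell2 I) (a * b) x"
    "\<And>x. hscale (ell2 I) 1 x = x"
    by (auto simp: ell2_scale algebra_simps fun_eq_iff)
  show "subspace (hcarrier (ell2 I))"
    unfolding subspace_def
    by (auto simp: ell2_add_closed)
       (auto simp: ell2_carrier ell2_scale norm_mult power_mult_distrib intro: summable_on_cmult_right)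
  fix x y z :: "'a \<Rightarrow> complex" and c
  show "hinner (ell2 I) y x = cnj (hinner (ell2 I) x y)"
    unfolding ell2_inner infsum_cnj[symmetric] by (simp add: mult.commute)
  show "0 \<le> Re (hinner (ell2 I) x x)" by (simp add: ell2_inner_self infsum_nonneg)
  show "hinner (ell2 I) (- x) (- x) = hinner (ell2 I) x x" by (simp add: ell2_inner)
  assume x: "x \<in> hcarrier (ell2 I)"
  show "x = 0" if "hinner (ell2 I) x x = 0"
  proof
    fix p
    have "(\<Sum>\<^sub>\<infinity>x'\<in>I. (cmod (x x'))\<^sup>2) = 0" using that ell2_inner_self[of I x] by simp
    then have "(cmod (x p))\<^sup>2 = 0" if "p \<in> I"
      using that x by (intro nonneg_infsum_le_0D[of "\<lambda>p. (cmod (x p))\<^sup>2" I p]) (auto simp: ell2_carrier)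
    then show "x p = 0 p" using x by (cases "p \<in> I") (auto simp: ell2_carrier)
  qed
  assume y: "y \<in> hcarrier (ell2 I)"
  show "hinner (ell2 I) x (hscale (ell2 I) c y) = c * hinner (ell2 I) x y"
    unfolding ell2_inner ell2_scale
    by (simp add: mult.left_commute[of _ c] infsum_cmult_right ell2_summable_inner[OF x y])
  assume z: "z \<in> hcarrier (ell2 I)"
  show "hinner (ell2 I) x (y + z) = hinner (ell2 I) x y + hinner (ell2 I) x z"
    unfolding ell2_inner
    by (simp add: distrib_left infsum_add ell2_summable_inner[OF x y] ell2_summable_inner[OF x z])
qed

lemma ell2_partial_sum:
  assumes "\<psi> \<in> hcarrier (ell2 I)" "finite F" "F \<subseteq> I"
  shows "(\<Sum>x\<in>F. (cmod (\<psi> x))\<^sup>2) \<le> (hnorm (ell2 I) \<psi>)\<^sup>2"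
  unfolding ell2_norm_sq using assms by (intro finite_sum_le_infsum) (auto simp: ell2_carrier)

lemma ell2_coord:
  assumes "\<psi> \<in> hcarrier (ell2 I)" shows "cmod (\<psi> x) \<le> hnorm (ell2 I) \<psi>"
proof (cases "x \<in> I")
  case True
  then have "(cmod (\<psi> x))\<^sup>2 \<le> (hnorm (ell2 I) \<psi>)\<^sup>2"
    using ell2_partial_sum[OF assms, of "{x}"] by simp
  then show ?thesis by (rule power2_le_imp_le) (use assms in simp)
qed (use assms in \<open>simp add: ell2_carrier\<close>)

lemma ell2_normI:
  assumes "\<psi> \<in> hcarrier (ell2 I)" "B \<ge> 0"
    "\<And>F. finite F \<Longrightarrow> F \<subseteq> I \<Longrightarrow> (\<Sum>x\<in>F. (cmod (\<psi> x))\<^sup>2) \<le> B\<^sup>2"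
  shows "hnorm (ell2 I) \<psi> \<le> B"
proof -
  have "(hnorm (ell2 I) \<psi>)\<^sup>2 \<le> B\<^sup>2"
    unfolding ell2_norm_sq using assms by (intro infsum_le_finite_sums) (auto simp: ell2_carrier)
  then show ?thesis by (rule power2_le_imp_le) (use assms in simp)
qed

text \<open>
  A Cauchy sequence converges in each coordinate, and the Cauchy estimate, stated for finite partial
  sums of squares, passes to the coordinatewise limit.
\<close>

interpretation ell2: hilbert "ell2 I" for I
proof
  show "ell2.ms.mcomplete TYPE('a) I"
    unfolding ell2.ms.mcomplete_def
  proof (intro allI impI)
    fix \<sigma> :: "nat \<Rightarrow> 'a \<Rightarrow> complex" assume "ell2.ms.MCauchy I \<sigma>"
    note cauchy = this[unfolded ell2.ms.MCauchy_def hdist_def]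
    then have \<sigma>: "\<And>n. \<sigma> n \<in> hcarrier (ell2 I)" by blast
    have cau: "\<And>\<epsilon>. \<epsilon> > 0 \<Longrightarrow> \<exists>M. \<forall>n\<ge>M. \<forall>n'\<ge>M. hnorm (ell2 I) (\<sigma> n - \<sigma> n') < \<epsilon>"
      using cauchy by meson
    have "Cauchy (\<lambda>n. \<sigma> n p)" for p
    proof (rule CauchyI)
      fix \<epsilon> :: real assume "\<epsilon> > 0"
      then obtain M where "\<forall>n\<ge>M. \<forall>n'\<ge>M. hnorm (ell2 I) (\<sigma> n - \<sigma> n') < \<epsilon>" using cau by blast
      then show "\<exists>M. \<forall>m\<ge>M. \<forall>n\<ge>M. norm (\<sigma> m p - \<sigma> n p) < \<epsilon>"
        using ell2_coord[of "\<sigma> _ - \<sigma> _" I p] \<sigma> by (auto intro!: exI[of _ M]) (metis order_le_less_trans ell2.diff_closed \<sigma>)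
    qed
    then have "\<exists>l. (\<lambda>n. \<sigma> n p) \<longlonglongrightarrow> l" for p by (simp add: Cauchy_convergent_iff convergent_def)
    then obtain x where x: "\<And>p. (\<lambda>n. \<sigma> n p) \<longlonglongrightarrow> x p" by metis
    have fin: "(\<Sum>p\<in>F. (cmod ((\<sigma> n - x) p))\<^sup>2) \<le> \<epsilon>\<^sup>2"
      if M: "\<forall>n\<ge>M. \<forall>n'\<ge>M. hnorm (ell2 I) (\<sigma> n - \<sigma> n') < \<epsilon>" and n: "n \<ge> M" and F: "finite F" "F \<subseteq> I"
      for n M \<epsilon> F
    proof (rule LIMSEQ_le_const2)
      show "(\<lambda>n'. \<Sum>p\<in>F. (cmod ((\<sigma> n - \<sigma> n') p))\<^sup>2) \<longlonglongrightarrow> (\<Sum>p\<in>F. (cmod ((\<sigma> n - x) p))\<^sup>2)"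
        by (auto intro!: tendsto_intros x)
      show "\<exists>N. \<forall>n'\<ge>N. (\<Sum>p\<in>F. (cmod ((\<sigma> n - \<sigma> n') p))\<^sup>2) \<le> \<epsilon>\<^sup>2"
      proof (intro exI allI impI)
        fix n' assume "n' \<ge> M"
        then have "hnorm (ell2 I) (\<sigma> n - \<sigma> n') \<le> \<epsilon>" using M n by force
        then have "(hnorm (ell2 I) (\<sigma> n - \<sigma> n'))\<^sup>2 \<le> \<epsilon>\<^sup>2" using \<sigma> by (intro power_mono) auto
        then show "(\<Sum>p\<in>F. (cmod ((\<sigma> n - \<sigma> n') p))\<^sup>2) \<le> \<epsilon>\<^sup>2"
          using ell2_partial_sum[of "\<sigma> n - \<sigma> n'" I F] \<sigma> F by auto
      qed
    qed
    have x0: "x p = 0" if "p \<notin> I" for p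
      using x[of p] \<sigma> that by (simp add: ell2_carrier LIMSEQ_const_iff)
    have dC: "\<sigma> n - x \<in> hcarrier (ell2 I)"
      if "\<forall>n\<ge>M. \<forall>n'\<ge>M. hnorm (ell2 I) (\<sigma> n - \<sigma> n') < \<epsilon>" "n \<ge> M" for n M \<epsilon>
      by (rule ell2_carrierI[OF _ fin[OF that]]) (use \<sigma> x0 in \<open>simp_all add: ell2_carrier\<close>)
    have xC: "x \<in> hcarrier (ell2 I)"
    proof -
      obtain M where "\<forall>n\<ge>M. \<forall>n'\<ge>M. hnorm (ell2 I) (\<sigma> n - \<sigma> n') < 1" using cau[of 1] by auto
      then have "\<sigma> M - (\<sigma> M - x) \<in> hcarrier (ell2 I)" using dC[of M 1 M] \<sigma> by blast
      then show ?thesis by simp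
    qed
    show "\<exists>x. limitin (ell2.ms.mtopology I) \<sigma> x sequentially"
      unfolding ell2.ms.limit_metric_sequentially
    proof (intro exI[of _ x] conjI xC allI impI)
      fix \<epsilon> :: real assume "\<epsilon> > 0"
      then obtain M where M: "\<forall>n\<ge>M. \<forall>n'\<ge>M. hnorm (ell2 I) (\<sigma> n - \<sigma> n') < \<epsilon> / 2" using cau[of "\<epsilon> / 2"] by auto
      have "hnorm (ell2 I) (\<sigma> n - x) \<le> \<epsilon> / 2" if "n \<ge> M" for n
        using dC[OF M that] \<open>\<epsilon> > 0\<close> fin[OF M that] by (intro ell2_normI) auto
      then show "\<exists>N. \<forall>n\<ge>N. \<sigma> n \<in> hcarrier (ell2 I) \<and> hdist (ell2 I) (\<sigma> n) x < \<epsilon>"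
        using \<sigma> \<open>\<epsilon> > 0\<close> by (intro exI[of _ M]) (force simp: hdist_def)
    qed
  qed
qed

lemma ket_apply: "ket m p = (if p = m then 1 else 0)"
  by (simp add: ket_def)

lemma ket_carrier: "m \<in> I \<Longrightarrow> ket m \<in> hcarrier (ell2 I)"
  unfolding ell2_carrier by (auto simp: ket_apply intro!: finite_nonzero_values_imp_summable_on)

lemma ket_inner:
  assumes "m \<in> I" shows "hinner (ell2 I) (ket m) \<psi> = \<psi> m" "hinner (ell2 I) \<psi> (ket m) = cnj (\<psi> m)"
proof -
  have "hinner (ell2 I) (ket m) \<psi> = (\<Sum>\<^sub>\<infinity>x\<in>{m}. cnj (ket m x) * \<psi> x)"
    unfolding ell2_inner using assms by (intro infsum_cong_neutral) (auto simp: ket_apply)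
  then show "hinner (ell2 I) (ket m) \<psi> = \<psi> m" by (simp add: ket_apply)
  have "hinner (ell2 I) \<psi> (ket m) = (\<Sum>\<^sub>\<infinity>x\<in>{m}. cnj (\<psi> x) * ket m x)"
    unfolding ell2_inner using assms by (intro infsum_cong_neutral) (auto simp: ket_apply)
  then show "hinner (ell2 I) \<psi> (ket m) = cnj (\<psi> m)" by (simp add: ket_apply)
qed

definition truncate :: "'b set \<Rightarrow> ('b \<Rightarrow> complex) \<Rightarrow> 'b \<Rightarrow> complex" where
  "truncate F \<psi> = (\<lambda>p. if p \<in> F then \<psi> p else 0)"

lemma truncate_sum: "finite F \<Longrightarrow> truncate F \<psi> = (\<Sum>m\<in>F. (\<lambda>x. \<psi> m * ket m x))"
proof
  fix p assume F: "finite F"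
  have "(\<Sum>m\<in>F. (\<lambda>x. \<psi> m * ket m x)) p = (\<Sum>m\<in>F. \<psi> m * ket m p)"
    by (induction F rule: infinite_finite_induct) auto
  also have "\<dots> = (\<Sum>m\<in>F. if p = m then \<psi> m else 0)" by (intro sum.cong) (auto simp: ket_apply)
  finally show "truncate F \<psi> p = (\<Sum>m\<in>F. (\<lambda>x. \<psi> m * ket m x)) p" using F by (simp add: truncate_def)
qed

lemma ell2_truncate_approx:
  assumes \<psi>: "\<psi> \<in> hcarrier (ell2 I)" and "\<epsilon> > 0"
  obtains F where "finite F" "F \<subseteq> I" "hnorm (ell2 I) (\<psi> - truncate F \<psi>) < \<epsilon>"
proof -
  define S where "S = (\<Sum>\<^sub>\<infinity>x\<in>I. (cmod (\<psi> x))\<^sup>2)"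
  have summ: "(\<lambda>x. (cmod (\<psi> x))\<^sup>2) summable_on I" using \<psi> by (simp add: ell2_carrier)
  obtain F where F: "finite F" "F \<subseteq> I" "dist (\<Sum>x\<in>F. (cmod (\<psi> x))\<^sup>2) S \<le> (\<epsilon> / 2)\<^sup>2"
    using infsum_finite_approximation[OF summ, of "(\<epsilon> / 2)\<^sup>2"] \<open>\<epsilon> > 0\<close> unfolding S_def by auto
  have fin: "(\<Sum>x\<in>G. (cmod ((\<psi> - truncate F \<psi>) x))\<^sup>2) \<le> (\<epsilon> / 2)\<^sup>2" if G: "finite G" "G \<subseteq> I" for G
  proof -
    have "(\<Sum>x\<in>G. (cmod ((\<psi> - truncate F \<psi>) x))\<^sup>2) = (\<Sum>x\<in>G - F. (cmod (\<psi> x))\<^sup>2)"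
      using G by (intro sum.mono_neutral_cong_right) (auto simp: truncate_def)
    also have "\<dots> = (\<Sum>x\<in>G \<union> F. (cmod (\<psi> x))\<^sup>2) - (\<Sum>x\<in>F. (cmod (\<psi> x))\<^sup>2)"
      using G F sum.union_disjoint[of "G - F" F "\<lambda>x. (cmod (\<psi> x))\<^sup>2"]
      by (simp add: Diff_disjoint Int_commute)
    also have "(\<Sum>x\<in>G \<union> F. (cmod (\<psi> x))\<^sup>2) \<le> S"
      unfolding S_def using G F by (intro finite_sum_le_infsum[OF summ]) auto
    finally show ?thesis using F(3) by (simp add: dist_real_def)
  qed
  have "\<psi> - truncate F \<psi> \<in> hcarrier (ell2 I)"
    using \<psi> F by (intro ell2_carrierI[OF _ fin]) (auto simp: ell2_carrier truncate_def)
  then have "hnorm (ell2 I) (\<psi> - truncate F \<psi>) \<le> \<epsilon> / 2" using \<open>\<epsilon> > 0\<close> fin by (intro ell2_normI) auto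
  then show ?thesis using that F \<open>\<epsilon> > 0\<close> by fastforce
qed

subsection \<open>Weighted pullbacks\<close>

text \<open>
  A weighted partial shift, described by what it does to coordinates instead of basis
  vectors. Composition is then substitution, and identities between such operators are
  pointwise identities that hold for every function, square-summable or not.
\<close>

definition pull :: "'b set \<Rightarrow> ('b \<Rightarrow> complex) \<Rightarrow> ('b \<Rightarrow> 'b) \<Rightarrow> ('b \<Rightarrow> complex) \<Rightarrow> 'b \<Rightarrow> complex" where
  "pull I a \<tau> \<psi> = (\<lambda>p. if p \<in> I then a p * \<psi> (\<tau> p) else 0)"

lemma bounded_op_pull:
  assumes bound: "\<And>p. p \<in> I \<Longrightarrow> cmod (a p) \<le> B"
    and inj: "inj_on \<tau> {p \<in> I. a p \<noteq> 0}" and into: "\<And>p. p \<in> I \<Longrightarrow> a p \<noteq> 0 \<Longrightarrow> \<tau> p \<in> I"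
  shows "bounded_op (ell2 I) (pull I a \<tau>)"
proof -
  have fin: "(\<Sum>p\<in>F. (cmod (pull I a \<tau> \<psi> p))\<^sup>2) \<le> (\<bar>B\<bar> * hnorm (ell2 I) \<psi>)\<^sup>2"
    if \<psi>: "\<psi> \<in> hcarrier (ell2 I)" and F: "finite F" "F \<subseteq> I" for \<psi> F
  proof -
    define F' where "F' = {p \<in> F. a p \<noteq> 0}"
    have F': "finite F'" "F' \<subseteq> {p \<in> I. a p \<noteq> 0}" using F by (auto simp: F'_def)
    have "(\<Sum>p\<in>F. (cmod (pull I a \<tau> \<psi> p))\<^sup>2) = (\<Sum>p\<in>F'. (cmod (a p))\<^sup>2 * (cmod (\<psi> (\<tau> p)))\<^sup>2)"
      using F by (intro sum.mono_neutral_cong_right) (auto simp: F'_def pull_def norm_mult power_mult_distrib)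
    also have "\<dots> \<le> (\<Sum>p\<in>F'. B\<^sup>2 * (cmod (\<psi> (\<tau> p)))\<^sup>2)"
      using F' bound by (intro sum_mono mult_right_mono power_mono) auto
    also have "\<dots> = B\<^sup>2 * (\<Sum>p\<in>\<tau> ` F'. (cmod (\<psi> p))\<^sup>2)"
      using inj_on_subset[OF inj F'(2)] by (simp add: sum.reindex sum_distrib_left)
    also have "\<dots> \<le> B\<^sup>2 * (hnorm (ell2 I) \<psi>)\<^sup>2"
      using F' into by (intro mult_left_mono ell2_partial_sum[OF \<psi>]) auto
    finally show ?thesis by (simp add: power_mult_distrib)
  qed
  have closed: "pull I a \<tau> \<psi> \<in> hcarrier (ell2 I)" if "\<psi> \<in> hcarrier (ell2 I)" for \<psi>
    by (rule ell2_carrierI[OF _ fin[OF that]]) (auto simp: pull_def)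
  show ?thesis
  proof (rule bounded_opI)
    show "hnorm (ell2 I) (pull I a \<tau> \<psi>) \<le> \<bar>B\<bar> * hnorm (ell2 I) \<psi>" if "\<psi> \<in> hcarrier (ell2 I)" for \<psi>
      using closed[OF that] fin[OF that] that by (intro ell2_normI) auto
  qed (auto simp: closed, auto simp: pull_def ell2_scale algebra_simps)
qed

text \<open>
  Substitution \<open>m = \<tau> p\<close> in the sum that defines the inner product.
\<close>

lemma pull_adjoint:
  assumes bij: "bij_betw \<tau> {p \<in> I. a p \<noteq> 0} {p \<in> I. b p \<noteq> 0}"
    and inv: "\<And>p. p \<in> I \<Longrightarrow> a p \<noteq> 0 \<Longrightarrow> \<sigma> (\<tau> p) = p \<and> b (\<tau> p) = cnj (a p)"
  shows "hinner (ell2 I) (pull I b \<sigma> \<phi>) \<psi> = hinner (ell2 I) \<phi> (pull I a \<tau> \<psi>)"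
proof -
  have "hinner (ell2 I) (pull I b \<sigma> \<phi>) \<psi> = (\<Sum>\<^sub>\<infinity>m\<in>{p \<in> I. b p \<noteq> 0}. cnj (b m * \<phi> (\<sigma> m)) * \<psi> m)"
    unfolding ell2_inner by (intro infsum_cong_neutral) (auto simp: pull_def)
  also have "\<dots> = (\<Sum>\<^sub>\<infinity>p\<in>{p \<in> I. a p \<noteq> 0}. cnj (b (\<tau> p) * \<phi> (\<sigma> (\<tau> p))) * \<psi> (\<tau> p))"
    by (rule infsum_reindex_bij_betw[OF bij, symmetric])
  also have "\<dots> = (\<Sum>\<^sub>\<infinity>p\<in>{p \<in> I. a p \<noteq> 0}. cnj (\<phi> p) * (a p * \<psi> (\<tau> p)))"
    by (intro infsum_cong) (simp add: inv)
  also have "\<dots> = hinner (ell2 I) \<phi> (pull I a \<tau> \<psi>)"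
    unfolding ell2_inner by (intro infsum_cong_neutral) (auto simp: pull_def)
  finally show ?thesis .
qed

section \<open>Direct sums of Hilbert spaces\<close>

lemma hilbert_sum_simps:
  "hcarrier (hilbert_sum H K) = hcarrier H \<times> hcarrier K"
  "hscale (hilbert_sum H K) c (x, y) = (hscale H c x, hscale K c y)"
  "hinner (hilbert_sum H K) (x, y) (x', y') = hinner H x x' + hinner K y y'"
  by (simp_all add: hilbert_sum_def)

lemma pre_hilbert_sum:
  assumes "pre_hilbert H" "pre_hilbert K"
  shows "pre_hilbert (hilbert_sum H K)"
proof -
  interpret H: pre_hilbert H by fact
  interpret K: pre_hilbert K by fact
  let ?S = "hilbert_sum H K"
  have vec: "vector_space (hscale ?S)"
    by unfold_locales
      (auto simp: hilbert_sum_simps H.vs.scale_right_distrib K.vs.scale_right_distrib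
        H.vs.scale_left_distrib K.vs.scale_left_distrib)
  interpret vector_space "hscale ?S" by (rule vec)
  show ?thesis
  proof
    show "subspace (hcarrier ?S)"
      unfolding subspace_def by (auto simp: hilbert_sum_simps zero_prod_def)
    fix x y z :: "'a \<times> 'b" and c
    obtain x1 x2 y1 y2 z1 z2 where [simp]: "x = (x1, x2)" "y = (y1, y2)" "z = (z1, z2)"
      by (cases x, cases y, cases z) auto
    show "0 \<le> Re (hinner ?S x x)" using H.inner_pos K.inner_pos by (simp add: hilbert_sum_simps)
    show "hinner ?S (- x) (- x) = hinner ?S x x"
      by (simp add: hilbert_sum_simps H.inner_uminus K.inner_uminus)
    assume x: "x \<in> hcarrier ?S"
    show "x = 0" if "hinner ?S x x = 0"
    proof -
      have "hinner H x1 x1 + hinner K x2 x2 = 0" using that by (simp add: hilbert_sum_simps)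
      then have "(hnorm H x1)\<^sup>2 + (hnorm K x2)\<^sup>2 = 0"
        using x by (simp add: hilbert_sum_simps H.norm_sq K.norm_sq) (metis plus_complex.sel(1) zero_complex.sel(1))
      then show ?thesis
        using x H.norm_eq_0[of x1] K.norm_eq_0[of x2] by (auto simp: hilbert_sum_simps zero_prod_def sum_power2_eq_zero_iff)
    qed
    assume y: "y \<in> hcarrier ?S"
    show "hinner ?S y x = cnj (hinner ?S x y)"
      using x y H.inner_cnj[of x1 y1] K.inner_cnj[of x2 y2] by (simp add: hilbert_sum_simps)
    show "hinner ?S x (hscale ?S c y) = c * hinner ?S x y"
      using x y by (simp add: hilbert_sum_simps H.inner_scale K.inner_scale distrib_left)
    assume z: "z \<in> hcarrier ?S"
    show "hinner ?S x (y + z) = hinner ?S x y + hinner ?S x z"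
      using x y z by (simp add: hilbert_sum_simps H.inner_add K.inner_add)
  qed
qed

locale hilbert_pair = H: hilbert H + K: hilbert K
  for H :: "('h::ab_group_add) hilbert" and K :: "('k::ab_group_add) hilbert"
begin

sublocale S: pre_hilbert "hilbert_sum H K"
  by (rule pre_hilbert_sum) (rule H.pre_hilbert_axioms K.pre_hilbert_axioms)+

lemma sum_norm_sq: "x \<in> hcarrier H \<Longrightarrow> y \<in> hcarrier K \<Longrightarrow>
    (hnorm (hilbert_sum H K) (x, y))\<^sup>2 = (hnorm H x)\<^sup>2 + (hnorm K y)\<^sup>2"
  using S.norm_sq[of "(x, y)"] by (simp add: hilbert_sum_simps H.norm_sq K.norm_sq)

lemma sum_norm_ge:
  assumes "x \<in> hcarrier H" "y \<in> hcarrier K"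
  shows "hnorm H x \<le> hnorm (hilbert_sum H K) (x, y)" "hnorm K y \<le> hnorm (hilbert_sum H K) (x, y)"
proof -
  have *: "(hnorm H x)\<^sup>2 \<le> (hnorm (hilbert_sum H K) (x, y))\<^sup>2" "(hnorm K y)\<^sup>2 \<le> (hnorm (hilbert_sum H K) (x, y))\<^sup>2"
    using assms by (simp_all add: sum_norm_sq)
  have "0 \<le> hnorm (hilbert_sum H K) (x, y)" using assms by (intro S.norm_nonneg) (simp add: hilbert_sum_simps)
  then show "hnorm H x \<le> hnorm (hilbert_sum H K) (x, y)" "hnorm K y \<le> hnorm (hilbert_sum H K) (x, y)"
    using * by (blast intro: power2_le_imp_le)+
qed

lemma sum_norm_le:
  assumes "x \<in> hcarrier H" "y \<in> hcarrier K"
  shows "hnorm (hilbert_sum H K) (x, y) \<le> hnorm H x + hnorm K y"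
proof -
  have "(hnorm (hilbert_sum H K) (x, y))\<^sup>2 \<le> (hnorm H x + hnorm K y)\<^sup>2"
    using assms by (simp add: sum_norm_sq power2_sum)
  then show ?thesis by (rule power2_le_imp_le) (use assms in simp)
qed

sublocale S: hilbert "hilbert_sum H K"
proof
  show "S.ms.mcomplete"
    unfolding S.ms.mcomplete_def
  proof (intro allI impI)
    fix \<sigma> assume "S.ms.MCauchy \<sigma>"
    note cauchy = this[unfolded S.ms.MCauchy_def hdist_def]
    then have \<sigma>: "fst (\<sigma> n) \<in> hcarrier H" "snd (\<sigma> n) \<in> hcarrier K" for n
      by (auto simp: hilbert_sum_simps image_subset_iff mem_Times_iff)
    have diff: "\<sigma> m - \<sigma> n = (fst (\<sigma> m) - fst (\<sigma> n), snd (\<sigma> m) - snd (\<sigma> n))" for m n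
      by (simp add: minus_prod_def)
    have le: "hnorm H (fst (\<sigma> m) - fst (\<sigma> n)) \<le> hnorm (hilbert_sum H K) (\<sigma> m - \<sigma> n)"
      "hnorm K (snd (\<sigma> m) - snd (\<sigma> n)) \<le> hnorm (hilbert_sum H K) (\<sigma> m - \<sigma> n)" for m n
      unfolding diff using \<sigma> by (intro sum_norm_ge; simp)+
    have "H.ms.MCauchy (\<lambda>n. fst (\<sigma> n))" "K.ms.MCauchy (\<lambda>n. snd (\<sigma> n))"
      unfolding H.ms.MCauchy_def K.ms.MCauchy_def hdist_def
      using \<sigma> cauchy le by (auto, meson order_le_less_trans, meson order_le_less_trans)
    then obtain x y where "limitin H.ms.mtopology (\<lambda>n. fst (\<sigma> n)) x sequentially"
      "limitin K.ms.mtopology (\<lambda>n. snd (\<sigma> n)) y sequentially"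
      using H.complete K.complete unfolding H.ms.mcomplete_def K.ms.mcomplete_def by blast
    then have lim: "x \<in> hcarrier H" "\<And>\<epsilon>. \<epsilon> > 0 \<Longrightarrow> \<exists>N. \<forall>n\<ge>N. hnorm H (fst (\<sigma> n) - x) < \<epsilon>"
      "y \<in> hcarrier K" "\<And>\<epsilon>. \<epsilon> > 0 \<Longrightarrow> \<exists>N. \<forall>n\<ge>N. hnorm K (snd (\<sigma> n) - y) < \<epsilon>"
      unfolding H.ms.limit_metric_sequentially K.ms.limit_metric_sequentially hdist_def by meson+
    show "\<exists>x. limitin S.ms.mtopology \<sigma> x sequentially"
      unfolding S.ms.limit_metric_sequentially
    proof (intro exI[of _ "(x, y)"] conjI allI impI)
      show "(x, y) \<in> hcarrier (hilbert_sum H K)" using lim by (simp add: hilbert_sum_simps)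
      fix \<epsilon> :: real assume "\<epsilon> > 0"
      obtain M1 where M1: "\<forall>n\<ge>M1. hnorm H (fst (\<sigma> n) - x) < \<epsilon> / 2" using lim(2)[of "\<epsilon> / 2"] \<open>\<epsilon> > 0\<close> by auto
      obtain M2 where M2: "\<forall>n\<ge>M2. hnorm K (snd (\<sigma> n) - y) < \<epsilon> / 2" using lim(4)[of "\<epsilon> / 2"] \<open>\<epsilon> > 0\<close> by auto
      show "\<exists>N. \<forall>n\<ge>N. \<sigma> n \<in> hcarrier (hilbert_sum H K) \<and> hdist (hilbert_sum H K) (\<sigma> n) (x, y) < \<epsilon>"
      proof (intro exI allI impI conjI)
        fix n assume n: "n \<ge> max M1 M2"
        show "\<sigma> n \<in> hcarrier (hilbert_sum H K)" using \<sigma>[of n] by (simp add: hilbert_sum_simps mem_Times_iff)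
        have "hdist (hilbert_sum H K) (\<sigma> n) (x, y) = hnorm (hilbert_sum H K) (fst (\<sigma> n) - x, snd (\<sigma> n) - y)"
          by (simp add: hdist_def minus_prod_def)
        also have "\<dots> \<le> hnorm H (fst (\<sigma> n) - x) + hnorm K (snd (\<sigma> n) - y)"
          using \<sigma> lim by (intro sum_norm_le) auto
        also have "\<dots> < \<epsilon>" using M1 M2 n by force
        finally show "hdist (hilbert_sum H K) (\<sigma> n) (x, y) < \<epsilon>" .
      qed
    qed
  qed
qed

end

lemma (in hilbert) bounded_op_block:
  assumes "bounded_op H A" "bounded_op H B" "bounded_op H A'" "bounded_op H B'"
  shows "bounded_op (hilbert_sum H H) (\<lambda>(x, y). (A x + B y, A' x + B' y))"
proof -
  interpret P: hilbert_pair H H ..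
  note op = bounded_op_closed[of H] bounded_op_add[of H] bounded_op_scale[of H]
  obtain K1 where K1: "K1 \<ge> 0" "\<And>x. x \<in> C \<Longrightarrow> N (A x) \<le> K1 * N x" by (rule bounded_op_norm[OF assms(1)]) blast
  obtain K2 where K2: "K2 \<ge> 0" "\<And>x. x \<in> C \<Longrightarrow> N (B x) \<le> K2 * N x" by (rule bounded_op_norm[OF assms(2)]) blast
  obtain K3 where K3: "K3 \<ge> 0" "\<And>x. x \<in> C \<Longrightarrow> N (A' x) \<le> K3 * N x" by (rule bounded_op_norm[OF assms(3)]) blast
  obtain K4 where K4: "K4 \<ge> 0" "\<And>x. x \<in> C \<Longrightarrow> N (B' x) \<le> K4 * N x" by (rule bounded_op_norm[OF assms(4)]) blast
  show ?thesis
  proof (rule bounded_opI[where K="K1 + K2 + K3 + K4"])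
    fix z assume "z \<in> hcarrier (hilbert_sum H H)"
    then obtain x y where z: "z = (x, y)" and xy: "x \<in> C" "y \<in> C" by (auto simp: hilbert_sum_simps)
    let ?n = "hnorm (hilbert_sum H H) (x, y)"
    have le: "N x \<le> ?n" "N y \<le> ?n" using P.sum_norm_ge[OF xy] .
    have "hnorm (hilbert_sum H H) (A x + B y, A' x + B' y) \<le> N (A x + B y) + N (A' x + B' y)"
      using xy assms by (intro P.sum_norm_le) (auto simp: op)
    also have "\<dots> \<le> (N (A x) + N (B y)) + (N (A' x) + N (B' y))"
      using xy assms by (intro add_mono norm_triangle) (auto simp: op)
    also have "\<dots> \<le> (K1 * ?n + K2 * ?n) + (K3 * ?n + K4 * ?n)"
      using K1 K2 K3 K4 xy le by (intro add_mono) (meson order_trans mult_left_mono)+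
    finally show "hnorm (hilbert_sum H H) (case z of (x, y) \<Rightarrow> (A x + B y, A' x + B' y))
        \<le> (K1 + K2 + K3 + K4) * hnorm (hilbert_sum H H) z" by (simp add: z algebra_simps)
  qed (use assms in \<open>auto simp: hilbert_sum_simps op vs.scale_right_distrib\<close>)
qed

interpretation ell2p: hilbert_pair "ell2 I" "ell2 I" for I ..

text \<open>
  Finitely supported pairs of functions are dense.
\<close>

lemma ell2_pair_dense:
  assumes S: "module.subspace (hscale (hilbert_sum (ell2 I) (ell2 I))) S"
    and sub: "S \<subseteq> hcarrier (hilbert_sum (ell2 I) (ell2 I))"
    and ket: "\<And>m. m \<in> I \<Longrightarrow> (ket m, 0) \<in> S \<and> (0, ket m) \<in> S"
  shows "hdense (hilbert_sum (ell2 I) (ell2 I)) S"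
  unfolding ell2p.S.hdense_iff[OF sub]
proof (intro ballI allI impI)
  fix x :: "('a \<Rightarrow> complex) \<times> ('a \<Rightarrow> complex)" and r :: real
  assume "x \<in> hcarrier (hilbert_sum (ell2 I) (ell2 I))" "r > 0"
  then obtain \<phi> \<psi> where x: "x = (\<phi>, \<psi>)" "\<phi> \<in> hcarrier (ell2 I)" "\<psi> \<in> hcarrier (ell2 I)"
    by (auto simp: hilbert_sum_simps)
  obtain F where F: "finite F" "F \<subseteq> I" "hnorm (ell2 I) (\<phi> - truncate F \<phi>) < r / 2"
    using ell2_truncate_approx[OF x(2), of "r / 2"] \<open>r > 0\<close> by auto
  obtain G where G: "finite G" "G \<subseteq> I" "hnorm (ell2 I) (\<psi> - truncate G \<psi>) < r / 2"
    using ell2_truncate_approx[OF x(3), of "r / 2"] \<open>r > 0\<close> by auto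
  let ?sc = "hscale (hilbert_sum (ell2 I) (ell2 I))"
  have eq1: "(truncate F \<phi>, 0) = (\<Sum>m\<in>F. ?sc (\<phi> m) (ket m, 0))"
  proof -
    have "(\<Sum>m\<in>F. ?sc (\<phi> m) (ket m, 0)) = (\<Sum>m\<in>F. ((\<lambda>x. \<phi> m * ket m x), 0))"
      by (simp add: hilbert_sum_simps ell2_scale zero_fun_def)
    then show ?thesis by (simp add: truncate_sum[OF F(1)] prod_eq_iff fst_sum snd_sum)
  qed
  have eq2: "(0, truncate G \<psi>) = (\<Sum>m\<in>G. ?sc (\<psi> m) (0, ket m))"
  proof -
    have "(\<Sum>m\<in>G. ?sc (\<psi> m) (0, ket m)) = (\<Sum>m\<in>G. (0, (\<lambda>x. \<psi> m * ket m x)))"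
      by (simp add: hilbert_sum_simps ell2_scale zero_fun_def)
    then show ?thesis by (simp add: truncate_sum[OF G(1)] prod_eq_iff fst_sum snd_sum)
  qed
  have "(truncate F \<phi>, 0) \<in> S" "(0, truncate G \<psi>) \<in> S"
    unfolding eq1 eq2 using S ket F G
    by (auto intro!: ell2p.S.vs.subspace_sum ell2p.S.vs.subspace_scale)
  from ell2p.S.vs.subspace_add[OF S this] have y: "(truncate F \<phi>, truncate G \<psi>) \<in> S" by simp
  then have yC: "truncate F \<phi> \<in> hcarrier (ell2 I)" "truncate G \<psi> \<in> hcarrier (ell2 I)"
    using sub by (auto simp: hilbert_sum_simps)
  have "hnorm (hilbert_sum (ell2 I) (ell2 I)) (\<phi> - truncate F \<phi>, \<psi> - truncate G \<psi>)
      \<le> hnorm (ell2 I) (\<phi> - truncate F \<phi>) + hnorm (ell2 I) (\<psi> - truncate G \<psi>)"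
    using x yC by (intro ell2p.sum_norm_le) auto
  then show "\<exists>y\<in>S. hnorm (hilbert_sum (ell2 I) (ell2 I)) (x - y) < r"
    using F G y by (intro bexI[of _ "(truncate F \<phi>, truncate G \<psi>)"]) (auto simp: x)
qed

section \<open>The Dirac operator\<close>

definition level :: "nat \<Rightarrow> (nat \<Rightarrow> nat) \<Rightarrow> nat" where
  "level n m = (\<Sum>i\<in>{1..n}. m i)"

definition level_mult :: "nat \<Rightarrow> vec \<Rightarrow> vec" where
  "level_mult n \<psi> = (\<lambda>m. of_nat (level n m) * \<psi> m)"

abbreviation ell :: "nat \<Rightarrow> vec set" where
  "ell n \<equiv> hcarrier (H_single n)"

lemma level_mult_linear:
  "level_mult n (\<phi> + \<psi>) = level_mult n \<phi> + level_mult n \<psi>"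
  "level_mult n (\<phi> - \<psi>) = level_mult n \<phi> - level_mult n \<psi>"
  "level_mult n (hscale (H_single n) c \<psi>) = hscale (H_single n) c (level_mult n \<psi>)"
  "level_mult n (- \<psi>) = - level_mult n \<psi>"
  "level_mult n 0 = 0"
  by (auto simp: level_mult_def H_single_def ell2_scale algebra_simps fun_eq_iff)

lemma level_mult_symmetric:
  "hinner (H_single n) \<phi> (level_mult n \<psi>) = hinner (H_single n) (level_mult n \<phi>) \<psi>"
  unfolding H_single_def ell2_inner level_mult_def by (intro infsum_cong) simp

lemma level_mult_ket: "level_mult n (ket m) = hscale (H_single n) (of_nat (level n m)) (ket m)"
  by (rule ext) (auto simp: level_mult_def ket_apply H_single_def ell2_scale)

interpretation Hs: hilbert "H_single n" for n
  unfolding H_single_def by (rule ell2.hilbert_axioms)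

interpretation Hp: hilbert_pair "H_single n" "H_single n" for n ..

interpretation Ht: hilbert "H_total n" for n
  unfolding H_total_def by (rule Hp.S.hilbert_axioms)

lemma H_total_simps:
  "(\<phi>, \<psi>) \<in> hcarrier (H_total n) \<longleftrightarrow> \<phi> \<in> ell n \<and> \<psi> \<in> ell n"
  "hscale (H_total n) c (\<phi>, \<psi>) = (hscale (H_single n) c \<phi>, hscale (H_single n) c \<psi>)"
  "hinner (H_total n) (\<phi>, \<psi>) (\<phi>', \<psi>') = hinner (H_single n) \<phi> \<phi>' + hinner (H_single n) \<psi> \<psi>'"
  by (simp_all add: H_total_def hilbert_sum_simps)

lemma Dirac_dom:
  "(\<phi>, \<psi>) \<in> opdom (Dirac n) \<longleftrightarrow>
     \<phi> \<in> ell n \<and> \<psi> \<in> ell n \<and> level_mult n \<phi> \<in> ell n \<and> level_mult n \<psi> \<in> ell n"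
  by (auto simp: Dirac_def abs_D_def abs_D_single_def diagonal_op_def flip_def H_total_simps
      level_mult_def level_def H_single_def)

lemma Dirac_app: "opapp (Dirac n) (\<phi>, \<psi>) = (level_mult n \<psi>, level_mult n \<phi>)"
  by (auto simp: Dirac_def abs_D_def abs_D_single_def diagonal_op_def flip_def
      level_mult_def level_def)

lemma Dirac_dom_carrier: "opdom (Dirac n) \<subseteq> hcarrier (H_total n)"
  by (auto simp: Dirac_dom H_total_simps)

lemma Dirac_symmetric:
  "hinner (H_total n) x (opapp (Dirac n) y) = hinner (H_total n) (opapp (Dirac n) x) y"
  by (cases x; cases y) (simp add: H_total_simps Dirac_app level_mult_symmetric)

text \<open>
  The operator is symmetric on its domain. Conversely, pairing with the
  basis vectors forces the second component of an adjoint pair to be the image of the first, and since the domain is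
  the maximal one, the first component then belongs to it.
\<close>

lemma Dirac_self_adjoint: "self_adjoint (H_total n) (Dirac n)"
  unfolding self_adjoint_def
proof
  let ?I = "multi_indices n"
  have ket: "ket m \<in> ell n" if "m \<in> ?I" for m
    using that by (simp add: H_single_def ket_carrier)
  have dom_sub: "Ht.vs.subspace n (opdom (Dirac n))"
    unfolding Ht.vs.subspace_def
    by (auto simp: zero_prod_def Dirac_dom level_mult_linear H_total_simps)
  have dom_ket: "(ket m, 0) \<in> opdom (Dirac n)" "(0, ket m) \<in> opdom (Dirac n)" if "m \<in> ?I" for m
    using that ket by (auto simp: Dirac_dom level_mult_linear level_mult_ket)
  show "densely_defined_op (H_total n) (Dirac n)"
    unfolding densely_defined_op_def
  proof (intro conjI ballI allI)
    show "Ht.vs.subspace n (opdom (Dirac n))" by (rule dom_sub)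
    show "hdense (H_total n) (opdom (Dirac n))"
      unfolding H_total_def H_single_def
      by (rule ell2_pair_dense)
         (use dom_sub Dirac_dom_carrier dom_ket in \<open>auto simp: H_total_def H_single_def\<close>)
  qed (auto simp: Dirac_dom Dirac_app H_total_simps level_mult_linear)
  show "adjoint_graph (H_total n) (Dirac n) = op_graph (Dirac n)"
  proof
    show "op_graph (Dirac n) \<subseteq> adjoint_graph (H_total n) (Dirac n)"
      using Dirac_symmetric
      by (auto simp: op_graph_def adjoint_graph_def Dirac_dom Dirac_app H_total_simps level_mult_symmetric)
    show "adjoint_graph (H_total n) (Dirac n) \<subseteq> op_graph (Dirac n)"
    proof
      fix z assume z: "z \<in> adjoint_graph (H_total n) (Dirac n)"
      obtain x1 x2 y1 y2 where [simp]: "z = ((x1, x2), (y1, y2))" by (cases z) auto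
      have car: "x1 \<in> ell n" "x2 \<in> ell n" "y1 \<in> ell n" "y2 \<in> ell n"
        and adj: "\<And>w. w \<in> opdom (Dirac n) \<Longrightarrow>
          hinner (H_total n) (x1, x2) (opapp (Dirac n) w) = hinner (H_total n) (y1, y2) w"
        using z by (auto simp: adjoint_graph_def H_total_simps)
      \<comment> \<open>testing against basis vectors determines the coordinates of the image\<close>
      have "level_mult n x2 m = y1 m \<and> level_mult n x1 m = y2 m" for m
      proof (cases "m \<in> ?I")
        case True
        have "cnj (level_mult n x2 m) = cnj (y1 m)" "cnj (level_mult n x1 m) = cnj (y2 m)"
          using adj[OF dom_ket(1)[OF True]] adj[OF dom_ket(2)[OF True]] True car
          by (simp_all add: Dirac_app H_total_simps level_mult_symmetric level_mult_linear)
             (simp_all add: H_single_def ket_inner)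
        then show ?thesis by simp
      next
        case False
        then show ?thesis using car by (simp add: H_single_def ell2_carrier level_mult_def)
      qed
      then have "y1 = level_mult n x2" "y2 = level_mult n x1" by auto
      then show "z \<in> op_graph (Dirac n)" using car by (auto simp: op_graph_def Dirac_dom Dirac_app)
    qed
  qed
qed

lemma finite_level_le: "finite {m \<in> multi_indices n. real (level n m) \<le> K}"
proof (rule finite_subset)
  let ?A = "{m. \<forall>i. (i \<in> {1..n} \<longrightarrow> m i \<in> {..nat \<lfloor>K\<rfloor>}) \<and> (i \<notin> {1..n} \<longrightarrow> m i = 0)}"
  show "finite ?A" by (rule finite_set_of_finite_funs) auto
  show "{m \<in> multi_indices n. real (level n m) \<le> K} \<subseteq> ?A"
  proof clarsimp
    fix m i assume m: "m \<in> multi_indices n" "real (level n m) \<le> K"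
    have "m i \<le> level n m" if "Suc 0 \<le> i" "i \<le> n"
      unfolding level_def using that by (intro member_le_sum) auto
    then show "(Suc 0 \<le> i \<and> i \<le> n \<longrightarrow> m i \<le> nat \<lfloor>K\<rfloor>) \<and> ((Suc 0 \<le> i \<longrightarrow> \<not> i \<le> n) \<longrightarrow> m i = 0)"
      using m by (auto simp: multi_indices_def le_nat_floor Suc_le_eq intro!: le_nat_floor)
  qed
qed

text \<open>
  Multiplication by a sequence tending to zero is a compact operation: outside a finite set \<open>F\<close> of
  coordinates the values contribute little, and on \<open>F\<close> they are bounded, hence covered by the products of
  finite nets of a disc. Domination by \<open>d * g\<close> instead of equality lets one net serve for sums of
  several such operators.
\<close>

lemma ell2_dominated_net:
  fixes d :: "'b \<Rightarrow> real"
  assumes c0: "\<And>\<epsilon>. \<epsilon> > 0 \<Longrightarrow> finite {m \<in> I. d m > \<epsilon>}" and "\<epsilon> > 0" and B: "B \<ge> 0"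
  obtains K where "finite K" "K \<subseteq> hcarrier (ell2 I)"
    "\<And>u g. u \<in> hcarrier (ell2 I) \<Longrightarrow> g \<in> hcarrier (ell2 I) \<Longrightarrow> hnorm (ell2 I) g \<le> B \<Longrightarrow>
       (\<And>m. m \<in> I \<Longrightarrow> cmod (u m) \<le> d m * cmod (g m)) \<Longrightarrow> \<exists>k\<in>K. hnorm (ell2 I) (u - k) < \<epsilon>"
proof -
  define \<eta> where "\<eta> = \<epsilon> / (4 * (B + 1))"
  have "\<eta> > 0" using \<open>\<epsilon> > 0\<close> B by (simp add: \<eta>_def)
  define F where "F = {m \<in> I. d m > \<eta>}"
  have F: "finite F" "F \<subseteq> I" using c0[OF \<open>\<eta> > 0\<close>] by (auto simp: F_def)
  define R where "R = (\<Sum>m\<in>F. d m * B)"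
  have dF: "d m * B \<le> R" if "m \<in> F" for m
    unfolding R_def using that F \<open>\<eta> > 0\<close> B by (intro member_le_sum) (auto simp: F_def)
  define \<delta> where "\<delta> = \<epsilon> / (4 * (real (card F) + 1))"
  have "\<delta> > 0" using \<open>\<epsilon> > 0\<close> by (simp add: \<delta>_def)
  obtain K0 where K0: "finite K0" "cball (0::complex) R \<subseteq> (\<Union>x\<in>K0. ball x \<delta>)"
  proof -
    have "seq_compact (cball (0::complex) R)" by (simp add: compact_eq_seq_compact_metric[symmetric])
    from seq_compact_imp_totally_bounded[OF this] \<open>\<delta> > 0\<close> show ?thesis using that by blast
  qed
  define K where "K = (\<lambda>f. truncate F f) ` (F \<rightarrow>\<^sub>E K0)"
  have trC: "truncate F f \<in> hcarrier (ell2 I)" for f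
    using F by (auto simp: ell2_carrier truncate_def intro!: finite_nonzero_values_imp_summable_on
        finite_subset[OF _ F(1)] split: if_splits)
  have "\<exists>k\<in>K. hnorm (ell2 I) (u - k) < \<epsilon>"
    if u: "u \<in> hcarrier (ell2 I)" and g: "g \<in> hcarrier (ell2 I)" "hnorm (ell2 I) g \<le> B"
      and ug: "\<And>m. m \<in> I \<Longrightarrow> cmod (u m) \<le> d m * cmod (g m)" for u g
  proof -
    have "\<exists>k\<in>K0. cmod (u m - k) < \<delta>" if m: "m \<in> F" for m
    proof -
      have "cmod (u m) \<le> d m * cmod (g m)" using ug m F by blast
      also have "\<dots> \<le> d m * B"
        using m \<open>\<eta> > 0\<close> ell2_coord[OF g(1), of m] g(2) by (intro mult_left_mono) (auto simp: F_def)
      also have "\<dots> \<le> R" by (rule dF[OF m])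
      finally have "u m \<in> cball 0 R" by (simp add: dist_norm)
      then obtain k where "k \<in> K0" "u m \<in> ball k \<delta>" using K0 by blast
      then show ?thesis by (auto simp: dist_norm norm_minus_commute intro!: bexI[of _ k])
    qed
    then obtain k0 where k0: "\<And>m. m \<in> F \<Longrightarrow> k0 m \<in> K0 \<and> cmod (u m - k0 m) < \<delta>" by metis
    define k where "k = truncate F (restrict k0 F)"
    have kK: "k \<in> K" unfolding k_def K_def using k0 by (intro imageI) auto
    have "(\<Sum>x\<in>G. (cmod ((u - k) x))\<^sup>2) \<le> (\<epsilon> / 2)\<^sup>2" if G: "finite G" "G \<subseteq> I" for G
    proof -
      have "(\<Sum>x\<in>G. (cmod ((u - k) x))\<^sup>2) \<le> (\<Sum>x\<in>G. (if x \<in> F then \<delta>\<^sup>2 else 0) + \<eta>\<^sup>2 * (cmod (g x))\<^sup>2)"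
      proof (rule sum_mono)
        fix x assume x: "x \<in> G"
        show "(cmod ((u - k) x))\<^sup>2 \<le> (if x \<in> F then \<delta>\<^sup>2 else 0) + \<eta>\<^sup>2 * (cmod (g x))\<^sup>2"
        proof (cases "x \<in> F")
          case True
          then have "(cmod ((u - k) x))\<^sup>2 \<le> \<delta>\<^sup>2"
            using k0[of x] by (intro power_mono) (auto simp: k_def truncate_def)
          then show ?thesis using True by (simp add: add_increasing2)
        next
          case False
          have "x \<in> I" using x G by blast
          then have "cmod (u x) \<le> \<eta> * cmod (g x)"
            using ug[of x] False mult_right_mono[of "d x" \<eta> "cmod (g x)"] by (auto simp: F_def)
          then have "(cmod (u x))\<^sup>2 \<le> (\<eta> * cmod (g x))\<^sup>2" by (intro power_mono) auto
          then show ?thesis using False by (simp add: k_def truncate_def power_mult_distrib)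
        qed
      qed
      also have "\<dots> = real (card (G \<inter> F)) * \<delta>\<^sup>2 + \<eta>\<^sup>2 * (\<Sum>x\<in>G. (cmod (g x))\<^sup>2)"
        using G by (simp add: sum.distrib sum_distrib_left sum.If_cases Collect_mem_eq)
      also have "\<dots> \<le> (\<epsilon> / 4)\<^sup>2 + (\<epsilon> / 4)\<^sup>2"
      proof (rule add_mono)
        have "real (card (G \<inter> F)) \<le> real (card F)" using F by (simp add: card_mono)
        also have "\<dots> \<le> (real (card F) + 1)\<^sup>2" by (simp add: power2_eq_square algebra_simps)
        finally have "real (card (G \<inter> F)) * \<delta>\<^sup>2 \<le> (real (card F) + 1)\<^sup>2 * \<delta>\<^sup>2"
          by (intro mult_right_mono) auto
        also have "\<dots> = (\<epsilon> / 4)\<^sup>2"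
          unfolding \<delta>_def power_mult_distrib[symmetric] by (rule arg_cong[where f="\<lambda>x. x\<^sup>2"]) (simp add: field_simps)
        finally show "real (card (G \<inter> F)) * \<delta>\<^sup>2 \<le> (\<epsilon> / 4)\<^sup>2" .
        have "(\<Sum>x\<in>G. (cmod (g x))\<^sup>2) \<le> (hnorm (ell2 I) g)\<^sup>2" by (rule ell2_partial_sum[OF g(1) G])
        also have "\<dots> \<le> (B + 1)\<^sup>2" using g by (intro power_mono) auto
        finally have "\<eta>\<^sup>2 * (\<Sum>x\<in>G. (cmod (g x))\<^sup>2) \<le> \<eta>\<^sup>2 * (B + 1)\<^sup>2" by (intro mult_left_mono) auto
        also have "\<dots> = (\<epsilon> / 4)\<^sup>2"
          unfolding \<eta>_def power_mult_distrib[symmetric] using B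
          by (intro arg_cong[where f="\<lambda>x. x\<^sup>2"]) (simp add: field_simps)
        finally show "\<eta>\<^sup>2 * (\<Sum>x\<in>G. (cmod (g x))\<^sup>2) \<le> (\<epsilon> / 4)\<^sup>2" .
      qed
      also have "\<dots> \<le> (\<epsilon> / 2)\<^sup>2" by (simp add: power2_eq_square field_simps)
      finally show ?thesis .
    qed
    then have "hnorm (ell2 I) (u - k) \<le> \<epsilon> / 2"
      using u trC \<open>\<epsilon> > 0\<close> unfolding k_def by (intro ell2_normI) auto
    then show ?thesis using kK \<open>\<epsilon> > 0\<close> by (intro bexI[of _ k]) auto
  qed
  moreover have "finite K" unfolding K_def using F K0 by (intro finite_imageI finite_PiE) auto
  moreover have "K \<subseteq> hcarrier (ell2 I)" unfolding K_def using trC by blast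
  ultimately show ?thesis using that by blast
qed

lemma c0_bounded:
  fixes d :: "'b \<Rightarrow> complex"
  assumes "finite {m \<in> I. cmod (d m) > 1}"
  obtains B where "\<And>m. m \<in> I \<Longrightarrow> cmod (d m) \<le> B"
proof
  fix m assume "m \<in> I"
  show "cmod (d m) \<le> 1 + (\<Sum>m\<in>{m \<in> I. cmod (d m) > 1}. cmod (d m))"
  proof (cases "cmod (d m) > 1")
    case True
    then have "cmod (d m) \<le> (\<Sum>m\<in>{m \<in> I. cmod (d m) > 1}. cmod (d m))"
      using assms \<open>m \<in> I\<close> by (intro member_le_sum) auto
    then show ?thesis by simp
  next
    case False
    then show ?thesis using sum_nonneg[of "{m \<in> I. cmod (d m) > 1}" "\<lambda>m. cmod (d m)"] by simp
  qed
qed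

text \<open>
  The inverse of the block with rows \<open>(- \<mu>, a)\<close> and \<open>(a, - \<mu>)\<close> has the entries \<open>\<mu> / (a\<^sup>2 - \<mu>\<^sup>2)\<close> on
  the diagonal and \<open>a / (a\<^sup>2 - \<mu>\<^sup>2)\<close> off it; \<open>c\<close> stands for either numerator.
\<close>

definition resolvent_coeff :: "nat \<Rightarrow> complex \<Rightarrow> complex \<Rightarrow> (nat \<Rightarrow> nat) \<Rightarrow> complex" where
  "resolvent_coeff n \<mu> c m = c / ((of_nat (level n m))\<^sup>2 - \<mu>\<^sup>2)"

definition Dirac_resolvent :: "nat \<Rightarrow> complex \<Rightarrow> vec \<times> vec \<Rightarrow> vec \<times> vec" where
  "Dirac_resolvent n \<mu> = (\<lambda>(u, v).
     let d1 = (\<lambda>m. resolvent_coeff n \<mu> \<mu> m); d2 = (\<lambda>m. resolvent_coeff n \<mu> (of_nat (level n m)) m);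
         A = pull (multi_indices n) d1 (\<lambda>m. m); B = pull (multi_indices n) d2 (\<lambda>m. m)
     in (A u + B v, B u + A v))"

lemma resolvent_coeff_le:
  assumes "real (level n m) > cmod \<mu>" "c = \<mu> \<or> c = of_nat (level n m)"
  shows "cmod (resolvent_coeff n \<mu> c m) \<le> 1 / (real (level n m) - cmod \<mu>)"
proof -
  let ?a = "real (level n m)"
  have "?a\<^sup>2 - (cmod \<mu>)\<^sup>2 \<le> cmod ((of_nat (level n m))\<^sup>2 - \<mu>\<^sup>2)"
    using norm_triangle_ineq2[of "(of_nat (level n m))\<^sup>2" "\<mu>\<^sup>2"] by (simp add: norm_power)
  moreover have "(?a - cmod \<mu>) * (?a + cmod \<mu>) = ?a\<^sup>2 - (cmod \<mu>)\<^sup>2"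
    by (simp add: power2_eq_square algebra_simps)
  moreover have "cmod c \<le> ?a + cmod \<mu>" using assms by auto
  moreover have pos: "0 < (?a - cmod \<mu>) * (?a + cmod \<mu>)"
    using assms(1) norm_ge_zero[of \<mu>] by (intro mult_pos_pos) linarith+
  ultimately have "cmod c / cmod ((of_nat (level n m))\<^sup>2 - \<mu>\<^sup>2) \<le> (?a + cmod \<mu>) / ((?a - cmod \<mu>) * (?a + cmod \<mu>))"
    by (intro frac_le) auto
  also have "\<dots> = 1 / (?a - cmod \<mu>)" using pos by (auto simp: zero_less_mult_iff)
  finally show ?thesis by (simp add: resolvent_coeff_def norm_divide)
qed

lemma resolvent_coeff_c0:
  assumes c: "\<And>m. c m = \<mu> \<or> c m = of_nat (level n m)" and "\<epsilon> > 0"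
  shows "finite {m \<in> multi_indices n. cmod (resolvent_coeff n \<mu> (c m) m) > \<epsilon>}"
proof (rule finite_subset[OF _ finite_level_le[of n "cmod \<mu> + 1 / \<epsilon>"]], clarify)
  fix m assume m: "\<epsilon> < cmod (resolvent_coeff n \<mu> (c m) m)"
  show "real (level n m) \<le> cmod \<mu> + 1 / \<epsilon>"
  proof (rule ccontr)
    assume "\<not> ?thesis"
    then have 1: "real (level n m) - cmod \<mu> > 1 / \<epsilon>" by simp
    then have 2: "real (level n m) > cmod \<mu>" using \<open>\<epsilon> > 0\<close> by (smt (verit) divide_pos_pos)
    have "\<epsilon> < 1 / (real (level n m) - cmod \<mu>)" using m resolvent_coeff_le[OF 2 c] by simp
    then have "\<epsilon> * (real (level n m) - cmod \<mu>) < 1" using 2 by (simp add: pos_less_divide_eq)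
    moreover have "\<epsilon> * (1 / \<epsilon>) < \<epsilon> * (real (level n m) - cmod \<mu>)" using 1 \<open>\<epsilon> > 0\<close> by (intro mult_strict_left_mono)
    ultimately show False using \<open>\<epsilon> > 0\<close> by simp
  qed
qed

lemma Dirac_resolvent_bounded: "bounded_op (H_total n) (Dirac_resolvent n \<mu>)"
proof -
  have "bounded_op (H_single n) (pull (multi_indices n) (\<lambda>m. resolvent_coeff n \<mu> (c m) m) (\<lambda>m. m))"
    if c: "\<And>m. c m = \<mu> \<or> c m = of_nat (level n m)" for c
  proof -
    have "finite {m \<in> multi_indices n. cmod (resolvent_coeff n \<mu> (c m) m) > 1}"
      by (rule resolvent_coeff_c0[OF c]) auto
    then obtain B where "\<And>m. m \<in> multi_indices n \<Longrightarrow> cmod (resolvent_coeff n \<mu> (c m) m) \<le> B"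
      by (rule c0_bounded) blast
    then show ?thesis unfolding H_single_def by (rule bounded_op_pull) auto
  qed
  then show ?thesis
    unfolding H_total_def Dirac_resolvent_def Let_def by (intro Hs.bounded_op_block) auto
qed

lemma Dirac_resolvent_compact: "compact_op (H_total n) (Dirac_resolvent n \<mu>)"
proof (rule Ht.compact_opI[OF Dirac_resolvent_bounded])
  fix \<epsilon> :: real assume "\<epsilon> > 0"
  let ?d1 = "\<lambda>m. resolvent_coeff n \<mu> \<mu> m" let ?d2 = "\<lambda>m. resolvent_coeff n \<mu> (of_nat (level n m)) m"
  define d where "d m = max (cmod (?d1 m)) (cmod (?d2 m))" for m
  have "finite {m \<in> multi_indices n. d m > \<epsilon>}" if "\<epsilon> > 0" for \<epsilon>
  proof -
    have "{m \<in> multi_indices n. d m > \<epsilon>} =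
        {m \<in> multi_indices n. cmod (?d1 m) > \<epsilon>} \<union> {m \<in> multi_indices n. cmod (?d2 m) > \<epsilon>}"
      by (auto simp: d_def less_max_iff_disj)
    then show ?thesis using resolvent_coeff_c0[of "\<lambda>_. \<mu>" \<mu> n \<epsilon>]
        resolvent_coeff_c0[of "\<lambda>m. of_nat (level n m)" \<mu> n \<epsilon>] that by simp
  qed
  note fin = this
  obtain K where K: "finite K" "K \<subseteq> ell n"
    "\<And>u g. u \<in> ell n \<Longrightarrow> g \<in> ell n \<Longrightarrow> hnorm (H_single n) g \<le> 2 \<Longrightarrow>
       (\<And>m. m \<in> multi_indices n \<Longrightarrow> cmod (u m) \<le> d m * cmod (g m)) \<Longrightarrow> \<exists>k\<in>K. hnorm (H_single n) (u - k) < \<epsilon> / 2"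
  proof -
    assume *: "\<And>K. finite K \<Longrightarrow> K \<subseteq> ell n \<Longrightarrow>
      (\<And>u g. u \<in> ell n \<Longrightarrow> g \<in> ell n \<Longrightarrow> hnorm (H_single n) g \<le> 2 \<Longrightarrow>
       (\<And>m. m \<in> multi_indices n \<Longrightarrow> cmod (u m) \<le> d m * cmod (g m)) \<Longrightarrow>
       \<exists>k\<in>K. hnorm (H_single n) (u - k) < \<epsilon> / 2) \<Longrightarrow> thesis"
    show thesis
      by (rule ell2_dominated_net[of "multi_indices n" d "\<epsilon> / 2" 2, OF fin])
         (use \<open>\<epsilon> > 0\<close> in \<open>simp_all add: *[unfolded H_single_def]\<close>)
  qed
  have "\<exists>k\<in>K \<times> K. hnorm (H_total n) (Dirac_resolvent n \<mu> x - k) < \<epsilon>"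
    if x: "x \<in> hcarrier (H_total n)" "hnorm (H_total n) x \<le> 1" for x
  proof -
    obtain u v where [simp]: "x = (u, v)" by (cases x)
    have uv: "u \<in> ell n" "v \<in> ell n" using x by (simp_all add: H_total_simps)
    have nuv: "hnorm (H_single n) u \<le> 1" "hnorm (H_single n) v \<le> 1"
      using Hp.sum_norm_ge[OF uv] x(2) by (simp_all add: H_total_def)
    define au where "au = (\<lambda>m. complex_of_real (cmod (u m)))"
    define av where "av = (\<lambda>m. complex_of_real (cmod (v m)))"
    have a: "au \<in> ell n" "av \<in> ell n" using uv by (auto simp: au_def av_def H_single_def ell2_carrier)
    have na: "hnorm (H_single n) au \<le> 1" "hnorm (H_single n) av \<le> 1"
      using nuv by (simp_all add: au_def av_def H_single_def ell2_norm)
    define g where "g = au + av"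
    have g: "g \<in> ell n" using a by (simp add: g_def)
    have ng: "hnorm (H_single n) g \<le> 2" using Hs.norm_triangle[OF a] na by (simp add: g_def)
    have cg: "cmod (g m) = cmod (u m) + cmod (v m)" for m
    proof -
      have "g m = complex_of_real (cmod (u m) + cmod (v m))" by (simp add: g_def au_def av_def)
      then show ?thesis by (simp only: norm_of_real abs_of_nonneg[OF add_nonneg_nonneg[OF norm_ge_zero norm_ge_zero]])
    qed
    obtain y z where yz: "Dirac_resolvent n \<mu> x = (y, z)" by (cases "Dirac_resolvent n \<mu> x")
    then have yzC: "y \<in> ell n" "z \<in> ell n"
      using bounded_op_closed[OF Dirac_resolvent_bounded x(1), of \<mu>] by (simp_all add: H_total_simps)
    have le: "cmod (c * s + c' * t) \<le> max (cmod c) (cmod c') * (cmod s + cmod t)" for c c' s t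
    proof -
      have "cmod (c * s + c' * t) \<le> cmod c * cmod s + cmod c' * cmod t"
        using norm_triangle_ineq[of "c * s" "c' * t"] by (simp add: norm_mult)
      also have "\<dots> \<le> max (cmod c) (cmod c') * cmod s + max (cmod c) (cmod c') * cmod t"
        by (intro add_mono mult_right_mono) auto
      finally show ?thesis by (simp add: distrib_left)
    qed
    have "cmod (y m) \<le> d m * cmod (g m)" "cmod (z m) \<le> d m * cmod (g m)" if "m \<in> multi_indices n" for m
      using that yz le[of "?d1 m" "u m" "?d2 m" "v m"] le[of "?d2 m" "u m" "?d1 m" "v m"]
      by (auto simp: Dirac_resolvent_def Let_def pull_def d_def cg max.commute)
    then obtain k l where k: "k \<in> K" "hnorm (H_single n) (y - k) < \<epsilon> / 2"
      and l: "l \<in> K" "hnorm (H_single n) (z - l) < \<epsilon> / 2"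
      using K(3)[OF yzC(1) g ng] K(3)[OF yzC(2) g ng] by blast
    have "hnorm (H_total n) (y - k, z - l) \<le> hnorm (H_single n) (y - k) + hnorm (H_single n) (z - l)"
      unfolding H_total_def using K k l yzC by (intro Hp.sum_norm_le) auto
    moreover have "Dirac_resolvent n \<mu> x - (k, l) = (y - k, z - l)" by (simp only: yz minus_prod_def fst_conv snd_conv)
    ultimately have "hnorm (H_total n) (Dirac_resolvent n \<mu> x - (k, l)) < \<epsilon>" using k l by simp
    then show ?thesis using k l by blast
  qed
  then show "\<exists>K. finite K \<and> K \<subseteq> hcarrier (H_total n) \<and>
      (\<forall>x\<in>hcarrier (H_total n). hnorm (H_total n) x \<le> 1 \<longrightarrow> (\<exists>k\<in>K. hnorm (H_total n) (Dirac_resolvent n \<mu> x - k) < \<epsilon>))"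
    using K by (intro exI[of _ "K \<times> K"]) (auto simp: H_total_def hilbert_sum_simps)
qed

lemma block_inverse_left:
  fixes a \<mu> x y :: complex
  assumes "a\<^sup>2 \<noteq> \<mu>\<^sup>2"
  shows "\<mu> / (a\<^sup>2 - \<mu>\<^sup>2) * (a * y - \<mu> * x) + a / (a\<^sup>2 - \<mu>\<^sup>2) * (a * x - \<mu> * y) = x"
    "a / (a\<^sup>2 - \<mu>\<^sup>2) * (a * y - \<mu> * x) + \<mu> / (a\<^sup>2 - \<mu>\<^sup>2) * (a * x - \<mu> * y) = y"
proof -
  have "\<mu> * (a * y - \<mu> * x) + a * (a * x - \<mu> * y) = x * (a\<^sup>2 - \<mu>\<^sup>2)"
    "a * (a * y - \<mu> * x) + \<mu> * (a * x - \<mu> * y) = y * (a\<^sup>2 - \<mu>\<^sup>2)"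
    by (simp_all add: algebra_simps power2_eq_square)
  then show "\<mu> / (a\<^sup>2 - \<mu>\<^sup>2) * (a * y - \<mu> * x) + a / (a\<^sup>2 - \<mu>\<^sup>2) * (a * x - \<mu> * y) = x"
    "a / (a\<^sup>2 - \<mu>\<^sup>2) * (a * y - \<mu> * x) + \<mu> / (a\<^sup>2 - \<mu>\<^sup>2) * (a * x - \<mu> * y) = y"
    using assms by (simp_all add: times_divide_eq_left add_divide_distrib[symmetric])
qed

lemma block_inverse_right:
  fixes a \<mu> u v :: complex
  assumes "a\<^sup>2 \<noteq> \<mu>\<^sup>2"
  shows "a * (a / (a\<^sup>2 - \<mu>\<^sup>2) * u + \<mu> / (a\<^sup>2 - \<mu>\<^sup>2) * v) - \<mu> * (\<mu> / (a\<^sup>2 - \<mu>\<^sup>2) * u + a / (a\<^sup>2 - \<mu>\<^sup>2) * v) = u"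
    "a * (\<mu> / (a\<^sup>2 - \<mu>\<^sup>2) * u + a / (a\<^sup>2 - \<mu>\<^sup>2) * v) - \<mu> * (a / (a\<^sup>2 - \<mu>\<^sup>2) * u + \<mu> / (a\<^sup>2 - \<mu>\<^sup>2) * v) = v"
proof -
  define r where "r = inverse (a\<^sup>2 - \<mu>\<^sup>2)"
  have r: "(a * a - \<mu> * \<mu>) * r = 1" using assms by (simp add: r_def power2_eq_square)
  have "a * (a * r * u + \<mu> * r * v) - \<mu> * (\<mu> * r * u + a * r * v) = (a * a - \<mu> * \<mu>) * r * u"
    "a * (\<mu> * r * u + a * r * v) - \<mu> * (a * r * u + \<mu> * r * v) = (a * a - \<mu> * \<mu>) * r * v"
    by (simp_all add: algebra_simps)
  then show "a * (a / (a\<^sup>2 - \<mu>\<^sup>2) * u + \<mu> / (a\<^sup>2 - \<mu>\<^sup>2) * v) - \<mu> * (\<mu> / (a\<^sup>2 - \<mu>\<^sup>2) * u + a / (a\<^sup>2 - \<mu>\<^sup>2) * v) = u"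
    "a * (\<mu> / (a\<^sup>2 - \<mu>\<^sup>2) * u + a / (a\<^sup>2 - \<mu>\<^sup>2) * v) - \<mu> * (a / (a\<^sup>2 - \<mu>\<^sup>2) * u + \<mu> / (a\<^sup>2 - \<mu>\<^sup>2) * v) = v"
    unfolding divide_inverse r_def[symmetric] r by simp_all
qed

lemma Dirac_resolvent_inverse:
  assumes reg: "\<And>m. m \<in> multi_indices n \<Longrightarrow> (of_nat (level n m))\<^sup>2 \<noteq> \<mu>\<^sup>2"
  shows "bij_betw (\<lambda>x. opapp (Dirac n) x - hscale (H_total n) \<mu> x) (opdom (Dirac n)) (hcarrier (H_total n))"
    and "\<And>y. y \<in> hcarrier (H_total n) \<Longrightarrow> resolvent (H_total n) (Dirac n) \<mu> y = Dirac_resolvent n \<mu> y"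
proof -
  let ?f = "\<lambda>x. opapp (Dirac n) x - hscale (H_total n) \<mu> x"
  have left: "Dirac_resolvent n \<mu> (?f x) = x" if x: "x \<in> opdom (Dirac n)" for x
  proof -
    obtain \<phi> \<psi> where [simp]: "x = (\<phi>, \<psi>)" by (cases x)
    have out: "\<phi> m = 0 \<and> \<psi> m = 0" if "m \<notin> multi_indices n" for m
      using x that by (auto simp: Dirac_dom H_single_def ell2_carrier)
    show ?thesis
      using block_inverse_left[OF reg] out
      by (auto simp: Dirac_app H_total_simps Dirac_resolvent_def Let_def pull_def resolvent_coeff_def
          level_mult_def H_single_def ell2_scale fun_eq_iff)
  qed
  have right: "?f (Dirac_resolvent n \<mu> y) = y" if y: "y \<in> hcarrier (H_total n)" for y
  proof -
    obtain u v where [simp]: "y = (u, v)" by (cases y)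
    have out: "u m = 0 \<and> v m = 0" if "m \<notin> multi_indices n" for m
      using y that by (auto simp: H_total_simps H_single_def ell2_carrier)
    show ?thesis
      using block_inverse_right[OF reg] out
      by (auto simp: Dirac_app H_total_simps Dirac_resolvent_def Let_def pull_def resolvent_coeff_def
          level_mult_def H_single_def ell2_scale fun_eq_iff)
  qed
  have rdom: "Dirac_resolvent n \<mu> y \<in> opdom (Dirac n)" if y: "y \<in> hcarrier (H_total n)" for y
  proof -
    obtain \<phi> \<psi> where r: "Dirac_resolvent n \<mu> y = (\<phi>, \<psi>)" by (cases "Dirac_resolvent n \<mu> y")
    obtain u v where [simp]: "y = (u, v)" by (cases y)
    have uv: "u \<in> ell n" "v \<in> ell n" using y by (simp_all add: H_total_simps)
    have C: "\<phi> \<in> ell n" "\<psi> \<in> ell n"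
      using bounded_op_closed[OF Dirac_resolvent_bounded y, of \<mu>] r by (simp_all add: H_total_simps)
    have "level_mult n \<psi> = u + hscale (H_single n) \<mu> \<phi>" "level_mult n \<phi> = v + hscale (H_single n) \<mu> \<psi>"
      using right[OF y] unfolding r by (auto simp: Dirac_app H_total_simps algebra_simps)
    then show ?thesis unfolding r using C uv by (simp add: Dirac_dom)
  qed
  have fC: "?f x \<in> hcarrier (H_total n)" if "x \<in> opdom (Dirac n)" for x
    using that by (cases x) (auto simp: Dirac_dom Dirac_app H_total_simps)
  show bij: "bij_betw ?f (opdom (Dirac n)) (hcarrier (H_total n))"
    by (rule bij_betw_byWitness[where f'="Dirac_resolvent n \<mu>"]) (use left right rdom fC in auto)
  show "resolvent (H_total n) (Dirac n) \<mu> y = Dirac_resolvent n \<mu> y" if y: "y \<in> hcarrier (H_total n)" for y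
  proof -
    have "inj_on ?f (opdom (Dirac n))" using bij by (simp add: bij_betw_def)
    from inv_into_f_f[OF this rdom[OF y]] show ?thesis by (simp only: resolvent_def right[OF y])
  qed
qed

lemma compact_op_cong:
  assumes "compact_op H T" "\<And>x. x \<in> hcarrier H \<Longrightarrow> T' x = T x" "bounded_op H T'"
  shows "compact_op H T'"
proof -
  have "T' ` {x \<in> hcarrier H. hnorm H x \<le> 1} = T ` {x \<in> hcarrier H. hnorm H x \<le> 1}"
    using assms(2) by (intro image_cong) auto
  then show ?thesis using assms by (simp add: compact_op_def)
qed

text \<open>
  The blockwise inverse exists exactly if \<open>\<mu>\<close> is not an eigenvalue. This holds for \<open>\<i>\<close>, which makes
  the resolvent set nonempty, and for each point of the resolvent set, since the shifted operator is injective
  there.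
\<close>

lemma Dirac_compact_resolvent: "compact_resolvent (H_total n) (Dirac n)"
  unfolding compact_resolvent_def
proof
  have "(of_nat k)\<^sup>2 \<noteq> \<i>\<^sup>2" for k
  proof
    assume "(of_nat k)\<^sup>2 = \<i>\<^sup>2"
    then have "Re ((of_nat k)\<^sup>2) = -1" by simp
    moreover have "Re ((of_nat k)\<^sup>2) = (real k)\<^sup>2" by (simp add: power2_eq_square)
    ultimately have "(real k)\<^sup>2 = - 1" by simp
    then show False using zero_le_power2[of "real k"] by linarith
  qed
  note reg = this
  have "\<i> \<in> resolvent_set (H_total n) (Dirac n)"
    unfolding resolvent_set_def
    using Dirac_resolvent_inverse[of n \<i>] reg Ht.bounded_op_cong'[OF Dirac_resolvent_bounded[of n \<i>]] by auto
  then show "resolvent_set (H_total n) (Dirac n) \<noteq> {}" by blast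
  show "\<forall>\<mu>\<in>resolvent_set (H_total n) (Dirac n). compact_op (H_total n) (resolvent (H_total n) (Dirac n) \<mu>)"
  proof
    fix \<mu> assume "\<mu> \<in> resolvent_set (H_total n) (Dirac n)"
    then have inj: "inj_on (\<lambda>x. opapp (Dirac n) x - hscale (H_total n) \<mu> x) (opdom (Dirac n))"
      and bd: "bounded_op (H_total n) (resolvent (H_total n) (Dirac n) \<mu>)"
      by (auto simp: resolvent_set_def bij_betw_def)
    have reg: "(of_nat (level n m))\<^sup>2 \<noteq> \<mu>\<^sup>2" if m: "m \<in> multi_indices n" for m
    proof
      assume eq: "(of_nat (level n m))\<^sup>2 = \<mu>\<^sup>2"
      \<comment> \<open>otherwise an eigenvector for the eigenvalue \<open>\<mu>\<close> contradicts injectivity\<close>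
      define s :: complex where "s = (if \<mu> = of_nat (level n m) then 1 else -1)"
      have s: "s * s = 1" "\<mu> = s * of_nat (level n m)"
        using eq by (auto simp: s_def power2_eq_iff)
      define x where "x = (ket m, hscale (H_single n) s (ket m))"
      have ketC: "ket m \<in> ell n" using m by (simp add: H_single_def ket_carrier)
      have dom: "x \<in> opdom (Dirac n)" "0 \<in> opdom (Dirac n)"
        using ketC by (auto simp: x_def Dirac_dom level_mult_linear level_mult_ket zero_prod_def)
      have "opapp (Dirac n) x - hscale (H_total n) \<mu> x = opapp (Dirac n) 0 - hscale (H_total n) \<mu> 0"
        using s by (simp add: x_def zero_prod_def Dirac_app H_total_simps level_mult_linear level_mult_ket
            mult.assoc[symmetric])
      then have "x = 0" using inj dom by (meson inj_onD)
      then have "ket m = (0 :: vec)" by (simp add: x_def zero_prod_def)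
      then have "ket m m = (0 :: complex)" by (simp add: fun_eq_iff)
      then show False by (simp add: ket_apply)
    qed
    show "compact_op (H_total n) (resolvent (H_total n) (Dirac n) \<mu>)"
      by (rule compact_op_cong[OF Dirac_resolvent_compact]) (use Dirac_resolvent_inverse(2)[OF reg] bd in auto)
  qed
qed

section \<open>Metric dimension\<close>

definition weight :: "nat \<Rightarrow> real \<Rightarrow> (nat \<Rightarrow> nat) \<Rightarrow> real" where
  "weight n s m = (1 + (real (level n m))\<^sup>2) powr (- s / 2)"

lemma weight_pos: "weight n s m > 0"
proof -
  have "1 + (real (level n m))\<^sup>2 > 0" by (rule add_pos_nonneg) auto
  then show ?thesis by (simp add: weight_def)
qed

lemma weight_le_1: "s \<ge> 0 \<Longrightarrow> weight n s m \<le> 1"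
  unfolding weight_def using powr_mono[of "- s / 2" 0 "1 + (real (level n m))\<^sup>2"] by (simp split: if_splits)

lemma sum_box:
  fixes f :: "nat \<Rightarrow> real"
  shows "(\<Sum>m\<in>{m \<in> multi_indices n. \<forall>i\<in>{1..n}. m i < M}. \<Prod>i\<in>{1..n}. f (m i)) = (\<Sum>k<M. f k) ^ n"
proof -
  have "(\<Sum>k<M. f k) ^ n = (\<Sum>g\<in>{1..n} \<rightarrow>\<^sub>E {..<M}. \<Prod>i\<in>{1..n}. f (g i))"
    using prod_sum_PiE[of "{1..n}" "\<lambda>_. {..<M}" "\<lambda>_. f"] by simp
  also have "\<dots> = (\<Sum>m\<in>{m \<in> multi_indices n. \<forall>i\<in>{1..n}. m i < M}. \<Prod>i\<in>{1..n}. f (m i))"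
    by (rule sum.reindex_bij_witness[where i="\<lambda>m. restrict m {1..n}" and
          j="\<lambda>g i. if i \<in> {1..n} then g i else 0"])
       (auto simp: multi_indices_def fun_eq_iff PiE_iff extensional_def Suc_le_eq intro!: prod.cong)
  finally show ?thesis by simp
qed

lemma finite_box: "finite {m \<in> multi_indices n. \<forall>i\<in>{1..n}. m i < M}"
proof (rule finite_subset)
  show "{m \<in> multi_indices n. \<forall>i\<in>{1..n}. m i < M} \<subseteq> {m \<in> multi_indices n. real (level n m) \<le> real (n * M)}"
  proof clarify
    fix m assume "\<forall>i\<in>{1..n}. m i < M"
    then have "level n m \<le> (\<Sum>i\<in>{1..n}. M)" unfolding level_def by (intro sum_mono) (auto simp: less_imp_le)
    then show "real (level n m) \<le> real (n * M)" unfolding of_nat_le_iff by simp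
  qed
qed (rule finite_level_le)

text \<open>
  Each factor \<open>1 + m i\<close> is at most \<open>1 + level n m\<close>, so the weight is at most a constant times
  \<open>\<Prod>i. (1 + m i) powr (- s / n)\<close>. Summed over a box this is the \<open>n\<close>-th power of a partial sum of a convergent
  series, because \<open>s / n > 1\<close>.
\<close>

lemma weight_summable:
  assumes n: "n \<ge> 1" and s: "s > real n"
  shows "weight n s summable_on multi_indices n"
proof -
  define t where "t = s / real n"
  have t: "t > 1" using n s by (simp add: t_def)
  have "summable (\<lambda>k. real (Suc k) powr (- t))"
    using t summable_real_powr_iff[of "- t"] by (subst summable_Suc_iff) simp
  then have part: "(\<Sum>k<M. real (Suc k) powr (- t)) \<le> suminf (\<lambda>k. real (Suc k) powr (- t))" for M
    by (intro sum_le_suminf) auto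
  define S where "S = suminf (\<lambda>k. real (Suc k) powr (- t))"
  have bound: "weight n s m \<le> 2 powr (s / 2) * (\<Prod>i\<in>{1..n}. real (Suc (m i)) powr (- t))" for m
  proof -
    let ?L = "real (level n m)"
    have "(\<Prod>i\<in>{1..n}. real (Suc (m i))) \<le> (\<Prod>i\<in>{1..n}. 1 + ?L)"
    proof (rule prod_mono)
      fix i assume "i \<in> {1..n}"
      then have "m i \<le> level n m" unfolding level_def by (intro member_le_sum) auto
      then show "0 \<le> real (Suc (m i)) \<and> real (Suc (m i)) \<le> 1 + ?L" by simp
    qed
    then have P: "(\<Prod>i\<in>{1..n}. real (Suc (m i))) \<le> (1 + ?L) ^ n" by simp
    have Ppos: "(\<Prod>i\<in>{1..n}. real (Suc (m i))) > 0" by (intro prod_pos) auto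
    have L2: "(1 + ?L)\<^sup>2 / 2 \<le> 1 + ?L\<^sup>2"
      using sum_power2_ge_zero[of "1 - ?L" 0] by (simp add: power2_eq_square algebra_simps)
    have L0: "1 + ?L > 0" by simp
    then have L1: "(1 + ?L)\<^sup>2 / 2 > 0" by (intro divide_pos_pos zero_less_power) auto
    have "- s / 2 \<le> 0" using s by simp
    then have "weight n s m \<le> ((1 + ?L)\<^sup>2 / 2) powr (- s / 2)"
      unfolding weight_def using L1 L2 by (rule powr_mono2')
    also have "\<dots> = 2 powr (s / 2) * ((1 + ?L)\<^sup>2) powr (- s / 2)"
    proof -
      have "((1 + ?L)\<^sup>2 / 2) powr (- s / 2) = ((1 + ?L)\<^sup>2) powr (- s / 2) / 2 powr (- s / 2)"
        by (rule powr_divide)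
      moreover have "(2::real) powr (- s / 2) = inverse (2 powr (s / 2))"
        using powr_minus[of 2 "s / 2"] by simp
      ultimately show ?thesis by (simp only: divide_inverse inverse_inverse_eq mult.commute)
    qed
    also have "((1 + ?L)\<^sup>2) powr (- s / 2) = (1 + ?L) powr (- s)"
      using L0 by (subst powr_numeral[symmetric]) (simp_all only: powr_powr, simp)
    also have "(1 + ?L) powr (- s) = ((1 + ?L) ^ n) powr (- t)"
      using n L0 by (subst powr_realpow[symmetric]) (simp_all only: powr_powr t_def, simp)
    also have "\<dots> \<le> (\<Prod>i\<in>{1..n}. real (Suc (m i))) powr (- t)"
      using P Ppos t by (intro powr_mono2') auto
    also have "\<dots> = (\<Prod>i\<in>{1..n}. real (Suc (m i)) powr (- t))" by (rule prod_powr_distrib)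
    finally show ?thesis by simp
  qed
  have "sum (weight n s) F \<le> 2 powr (s / 2) * S ^ n" if F: "finite F" "F \<subseteq> multi_indices n" for F
  proof -
    obtain M where M: "\<And>m i. m \<in> F \<Longrightarrow> i \<in> {1..n} \<Longrightarrow> m i < M"
    proof
      fix m i assume m: "m \<in> F" "i \<in> {1..n}"
      have "m i \<le> level n m" unfolding level_def using m by (intro member_le_sum) auto
      also have "\<dots> \<le> (\<Sum>m\<in>F. level n m)" using m F by (intro member_le_sum) auto
      finally show "m i < Suc (\<Sum>m\<in>F. level n m)" by simp
    qed
    let ?B = "{m \<in> multi_indices n. \<forall>i\<in>{1..n}. m i < M}"
    note finB = finite_box[of n M]
    have "sum (weight n s) F \<le> (\<Sum>m\<in>F. 2 powr (s / 2) * (\<Prod>i\<in>{1..n}. real (Suc (m i)) powr (- t)))"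
      by (intro sum_mono bound)
    also have "\<dots> \<le> (\<Sum>m\<in>?B. 2 powr (s / 2) * (\<Prod>i\<in>{1..n}. real (Suc (m i)) powr (- t)))"
      using F M finB by (intro sum_mono2) (auto intro!: mult_nonneg_nonneg prod_nonneg)
    also have "\<dots> = 2 powr (s / 2) * (\<Sum>k<M. real (Suc k) powr (- t)) ^ n"
      by (simp only: sum_distrib_left[symmetric] sum_box[where f="\<lambda>k. real (Suc k) powr (- t)"])
    also have "\<dots> \<le> 2 powr (s / 2) * S ^ n"
      using part unfolding S_def by (intro mult_left_mono power_mono sum_nonneg) auto
    finally show ?thesis .
  qed
  then show ?thesis
    by (intro nonneg_bdd_above_summable_on bdd_aboveI[where M="2 powr (s / 2) * S ^ n"])
       (auto intro: less_imp_le[OF weight_pos])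
qed

text \<open>
  The \<open>M ^ n\<close> points of a box of side \<open>M\<close> have level at most \<open>n * M\<close>, so their weights add up to at least
  a constant times \<open>M powr (n - s)\<close>, which is unbounded for \<open>s < n\<close>.
\<close>

lemma weight_divergent:
  assumes s: "s > 0" and bound: "\<And>F. finite F \<Longrightarrow> F \<subseteq> multi_indices n \<Longrightarrow> sum (weight n s) F \<le> B"
  shows "real n \<le> s"
proof (rule ccontr)
  assume "\<not> real n \<le> s"
  then have c: "real n - s > 0" by simp
  \<comment> \<open>\<open>M\<close> is chosen such that \<open>M powr (n - s)\<close> exceeds the bound that the box would give\<close>
  define A where "A = \<bar>B\<bar> * (1 + real n) powr s + 1"
  have A: "A \<ge> 1" by (simp add: A_def)
  define M where "M = nat \<lceil>A powr (1 / (real n - s))\<rceil>"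
  have Apos: "A powr (1 / (real n - s)) \<ge> 1" using A c by (simp add: ge_one_powr_ge_zero)
  then have MA: "A powr (1 / (real n - s)) \<le> real M" unfolding M_def by linarith
  then have M1: "real M \<ge> 1" using Apos by linarith
  let ?B = "{m \<in> multi_indices n. \<forall>i\<in>{1..n}. m i < M}"
  note finB = finite_box[of n M]
  have cardB: "real (card ?B) = real M ^ n"
    using sum_box[of "\<lambda>_. 1" n M] by simp
  have low: "((1 + real n) * real M) powr (- s) \<le> weight n s m" if "m \<in> ?B" for m
  proof -
    have "level n m \<le> (\<Sum>i\<in>{1..n}. M)" unfolding level_def using that by (intro sum_mono) (auto simp: less_imp_le)
    then have "level n m \<le> n * M" by simp
    then have "real (level n m) \<le> real n * real M" by (metis of_nat_le_iff of_nat_mult)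
    then have "(real (level n m))\<^sup>2 \<le> (real n * real M)\<^sup>2" by (intro power_mono) auto
    moreover have "1 \<le> (real M)\<^sup>2" using M1 by simp
    moreover have "0 \<le> real n * (real M)\<^sup>2" by simp
    moreover have "((1 + real n) * real M)\<^sup>2 = (real M)\<^sup>2 + 2 * (real n * (real M)\<^sup>2) + (real n * real M)\<^sup>2"
      by (simp add: power2_eq_square algebra_simps)
    ultimately have "1 + (real (level n m))\<^sup>2 \<le> ((1 + real n) * real M)\<^sup>2" by linarith
    moreover have "0 < 1 + (real (level n m))\<^sup>2" by (rule add_pos_nonneg) auto
    moreover have "- s / 2 \<le> 0" using s by simp
    ultimately have "(((1 + real n) * real M)\<^sup>2) powr (- s / 2) \<le> weight n s m"
      unfolding weight_def by (metis powr_mono2')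
    moreover have "(((1 + real n) * real M)\<^sup>2) powr (- s / 2) = ((1 + real n) * real M) powr (- s)"
    proof -
      have "(1 + real n) * real M > 0" using M1 by (intro mult_pos_pos) auto
      then show ?thesis by (subst powr_numeral[symmetric]) (simp_all only: powr_powr, simp)
    qed
    ultimately show ?thesis by simp
  qed
  have "real M ^ n * ((1 + real n) * real M) powr (- s) = (\<Sum>m\<in>?B. ((1 + real n) * real M) powr (- s))"
    using cardB by simp
  also have "\<dots> \<le> sum (weight n s) ?B" by (intro sum_mono low)
  also have "\<dots> \<le> B" using finB by (intro bound) auto
  finally have "real M ^ n * ((1 + real n) * real M) powr (- s) \<le> B" .
  moreover have "real M ^ n * ((1 + real n) * real M) powr (- s) = real M powr (real n - s) * (1 + real n) powr (- s)"
  proof -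
    have "((1 + real n) * real M) powr (- s) = (1 + real n) powr (- s) * real M powr (- s)"
      by (rule powr_mult)
    moreover have "real M ^ n = real M powr (real n)" using M1 by (simp add: powr_realpow)
    moreover have "real M powr (real n - s) = real M powr (real n) * real M powr (- s)"
      using powr_add[of "real M" "real n" "- s"] by simp
    ultimately show ?thesis by simp
  qed
  moreover have "(1 + real n) powr s > 0" by simp
  ultimately have "real M powr (real n - s) \<le> B * (1 + real n) powr s"
    by (simp only: powr_minus divide_inverse[symmetric] pos_divide_le_eq)
  also have "\<dots> \<le> \<bar>B\<bar> * (1 + real n) powr s" by (intro mult_right_mono) auto
  also have "\<dots> < A" by (simp add: A_def)
  also have "A = (A powr (1 / (real n - s))) powr (real n - s)" using A c by (simp add: powr_powr)
  also have "\<dots> \<le> real M powr (real n - s)" using MA c by (intro powr_mono2) auto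
  finally show False by simp
qed

text \<open>
  For \<open>c = 1\<close> and \<open>c = -1\<close> these are the normalized eigenvectors for the eigenvalues \<open>level n m\<close> and
  \<open>- level n m\<close>.
\<close>

definition Dirac_eigvec :: "nat \<Rightarrow> complex \<Rightarrow> (nat \<Rightarrow> nat) \<Rightarrow> vec \<times> vec" where
  "Dirac_eigvec n c m = hscale (H_total n) (of_real (1 / sqrt 2)) (ket m, hscale (H_single n) c (ket m))"

lemma ket_ell: "m \<in> multi_indices n \<Longrightarrow> ket m \<in> ell n"
  by (simp add: H_single_def ket_carrier)

lemma Dirac_eigvec_carrier: "m \<in> multi_indices n \<Longrightarrow> Dirac_eigvec n c m \<in> hcarrier (H_total n)"
  by (simp add: Dirac_eigvec_def H_total_simps ket_ell)

lemma Dirac_eigvec_inner: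
  assumes "m \<in> multi_indices n" "m' \<in> multi_indices n" "c \<in> {1, -1}" "c' \<in> {1, -1}"
  shows "hinner (H_total n) (Dirac_eigvec n c m) (Dirac_eigvec n c' m') = (if m = m' \<and> c = c' then 1 else 0)"
proof -
  define r where "r = complex_of_real (1 / sqrt 2)"
  define d :: complex where "d = (if m = m' then 1 else 0)"
  have r: "cnj r * r = 1 / 2" by (simp add: r_def flip: of_real_mult)
  have kC: "ket m \<in> ell n" "ket m' \<in> ell n" using assms ket_ell by auto
  have d: "hinner (H_single n) (ket m) (ket m') = d"
    using assms by (simp add: H_single_def ket_inner ket_apply d_def)
  have "hinner (H_total n) (Dirac_eigvec n c m) (Dirac_eigvec n c' m') = (cnj r * r) * (d + cnj c * c' * d)"
    unfolding Dirac_eigvec_def r_def[symmetric]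
    using kC by (simp add: H_total_simps Hs.inner_scale Hs.inner_scale_left d distrib_left mult_ac)
  then show ?thesis using assms unfolding r d_def by auto
qed

lemma Dirac_eigvec_eigen:
  assumes "m \<in> multi_indices n" "c \<in> {1, -1}"
  shows "Dirac_eigvec n c m \<in> opdom (Dirac n)"
    "opapp (Dirac n) (Dirac_eigvec n c m) = hscale (H_total n) (c * of_nat (level n m)) (Dirac_eigvec n c m)"
  using assms
  by (auto simp: Dirac_eigvec_def H_total_simps Dirac_dom Dirac_app level_mult_linear level_mult_ket ket_ell mult_ac)

lemma Dirac_eigvec_basis:
  "orthonormal_basis (H_total n) ((\<lambda>(c, m). Dirac_eigvec n c m) ` ({1, -1} \<times> multi_indices n))"
    (is "orthonormal_basis _ ?E")
  unfolding orthonormal_basis_def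
proof (intro conjI ballI)
  show sub: "?E \<subseteq> hcarrier (H_total n)" using Dirac_eigvec_carrier by auto
  show "hinner (H_total n) e e' = (if e = e' then 1 else 0)" if "e \<in> ?E" "e' \<in> ?E" for e e'
  proof -
    obtain c m c' m' where e: "e = Dirac_eigvec n c m" "e' = Dirac_eigvec n c' m'"
      "m \<in> multi_indices n" "m' \<in> multi_indices n" "c \<in> {1, -1}" "c' \<in> {1, -1}" using \<open>e \<in> ?E\<close> \<open>e' \<in> ?E\<close> by auto
    have "e \<noteq> e'" if "\<not> (m = m' \<and> c = c')"
      using Dirac_eigvec_inner[of m n m' c c'] Dirac_eigvec_inner[of m n m c c] e that by auto
    then show ?thesis using Dirac_eigvec_inner[of m n m' c c'] e by auto
  qed
  have spC: "Ht.vs.span n ?E \<subseteq> hcarrier (H_total n)"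
    using sub Ht.carrier_subspace Ht.vs.span_minimal by blast
  show "hdense (H_total n) (Ht.vs.span n ?E)"
    unfolding H_total_def H_single_def
  proof (rule ell2_pair_dense)
    fix m assume m: "m \<in> multi_indices n"
    define r where "r = complex_of_real (1 / sqrt 2)"
    have r2: "r * (r * x) + r * (r * x) = x" for x
      using arg_cong[OF real_sqrt_mult_self[of 2], of complex_of_real]
      by (simp add: r_def field_simps flip: of_real_mult)
    have in_span: "hscale (H_total n) c' (Dirac_eigvec n c m) \<in> Ht.vs.span n ?E" if "c \<in> {1, -1}" for c c'
      using that m by (intro Ht.vs.span_scale Ht.vs.span_base) auto
    have "(ket m, 0) = hscale (H_total n) r (Dirac_eigvec n 1 m) + hscale (H_total n) r (Dirac_eigvec n (-1) m)"
      "(0, ket m) = hscale (H_total n) r (Dirac_eigvec n 1 m) + hscale (H_total n) (-r) (Dirac_eigvec n (-1) m)"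
      unfolding Dirac_eigvec_def r_def[symmetric] using r2
      by (auto simp: H_total_simps H_single_def ell2_scale fun_eq_iff)
    then have "(ket m, 0) \<in> Ht.vs.span n ?E \<and> (0, ket m) \<in> Ht.vs.span n ?E"
      using in_span by (metis (no_types, lifting) Ht.vs.span_add insertCI)
    then show "(ket m, 0) \<in> module.span (hscale (hilbert_sum (ell2 (multi_indices n)) (ell2 (multi_indices n)))) ?E \<and>
        (0, ket m) \<in> module.span (hscale (hilbert_sum (ell2 (multi_indices n)) (ell2 (multi_indices n)))) ?E"
      by (simp add: H_total_def H_single_def)
  qed (use spC Ht.vs.subspace_span[of n ?E] in \<open>simp_all add: H_total_def H_single_def\<close>)
qed

definition Dirac_power :: "nat \<Rightarrow> real \<Rightarrow> vec \<times> vec \<Rightarrow> vec \<times> vec" where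
  "Dirac_power n s = (\<lambda>(\<phi>, \<psi>). (pull (multi_indices n) (\<lambda>m. of_real (weight n s m)) (\<lambda>m. m) \<phi>,
     pull (multi_indices n) (\<lambda>m. of_real (weight n s m)) (\<lambda>m. m) \<psi>))"

lemma Dirac_power_trace_class:
  assumes n: "n \<ge> 1" and s: "s > real n"
  shows "functional_calculus (H_total n) (Dirac n) (\<lambda>t. (1 + t\<^sup>2) powr (- s / 2)) (Dirac_power n s)"
    and "trace_class (H_total n) (Dirac_power n s)"
proof -
  let ?I = "multi_indices n" and ?T = "Dirac_power n s"
  let ?E = "(\<lambda>(c, m). Dirac_eigvec n c m) ` ({1, -1} \<times> multi_indices n)"
  let ?P = "pull ?I (\<lambda>m. of_real (weight n s m)) (\<lambda>m. m)"
  have s0: "s > 0" using n s by simp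
  have P: "bounded_op (H_single n) ?P"
    unfolding H_single_def using weight_le_1[of s n] s0 weight_pos[of n s]
    by (intro bounded_op_pull[where B=1]) (auto simp: less_imp_le)
  have T: "bounded_op (H_total n) ?T"
    using Hs.bounded_op_block[OF P Hs.bounded_op_zero Hs.bounded_op_zero P]
    unfolding H_total_def Dirac_power_def by simp
  have Teig: "?T (Dirac_eigvec n c m) = hscale (H_total n) (of_real (weight n s m)) (Dirac_eigvec n c m)"
    if "m \<in> ?I" for c m
  proof -
    have "?P (\<lambda>x. d * ket m x) = (\<lambda>x. of_real (weight n s m) * (d * ket m x))" for d
      using that by (intro ext) (auto simp: pull_def ket_apply)
    from this[of "of_real (1 / sqrt 2)"] this[of "of_real (1 / sqrt 2) * c"] show ?thesis
      by (simp add: Dirac_power_def Dirac_eigvec_def H_total_simps) (simp add: H_single_def ell2_scale mult.assoc)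
  qed
  show "functional_calculus (H_total n) (Dirac n) (\<lambda>t. (1 + t\<^sup>2) powr (- s / 2)) ?T"
    unfolding functional_calculus_def
  proof (intro conjI exI[of _ ?E] T Dirac_eigvec_basis ballI)
    fix e assume "e \<in> ?E"
    then obtain c m where e: "e = Dirac_eigvec n c m" "m \<in> ?I" "c \<in> {1, -1}" by auto
    show "\<exists>t::real. e \<in> opdom (Dirac n) \<and> opapp (Dirac n) e = hscale (H_total n) (of_real t) e \<and>
        ?T e = hscale (H_total n) (of_real ((1 + t\<^sup>2) powr (- s / 2))) e"
    proof (intro exI[of _ "Re c * real (level n m)"] conjI)
      show "e \<in> opdom (Dirac n)" using Dirac_eigvec_eigen(1)[of m n c] e by simp
      show "opapp (Dirac n) e = hscale (H_total n) (of_real (Re c * real (level n m))) e"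
        using Dirac_eigvec_eigen(2)[of m n c] e by auto
      have "(Re c * real (level n m))\<^sup>2 = (real (level n m))\<^sup>2" using e by auto
      then show "?T e = hscale (H_total n) (of_real ((1 + (Re c * real (level n m))\<^sup>2) powr (- s / 2))) e"
        using Teig[OF e(2), of c] e by (simp add: weight_def)
    qed
  qed
  have Psym: "hinner (H_single n) (?P \<phi>) \<psi> = hinner (H_single n) \<phi> (?P \<psi>)" for \<phi> \<psi>
    unfolding H_single_def by (rule pull_adjoint) (auto simp: bij_betw_def)
  have Tsym: "hinner (H_total n) (?T x) y = hinner (H_total n) x (?T y)" for x y
    by (cases x; cases y) (simp add: Dirac_power_def H_total_simps Psym)
  have Ppos: "hinner (H_single n) \<phi> (?P \<phi>) \<in> \<real> \<and> 0 \<le> Re (hinner (H_single n) \<phi> (?P \<phi>))" if "\<phi> \<in> ell n" for \<phi>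
  proof -
    \<comment> \<open>positivity is read off from the square root, a diagonal operator of the same form\<close>
    let ?Q = "pull ?I (\<lambda>m. of_real (sqrt (weight n s m))) (\<lambda>m. m)"
    have sq: "complex_of_real (sqrt (weight n s m)) * complex_of_real (sqrt (weight n s m)) = of_real (weight n s m)" for m
      using weight_pos[of n s m] by (simp flip: of_real_mult)
    have "?P \<phi> = ?Q (?Q \<phi>)" by (auto simp: pull_def fun_eq_iff mult.assoc[symmetric] sq)
    moreover have "hinner (H_single n) (?Q \<phi>) \<psi> = hinner (H_single n) \<phi> (?Q \<psi>)" for \<psi>
      unfolding H_single_def by (rule pull_adjoint) (auto simp: bij_betw_def)
    ultimately have "hinner (H_single n) \<phi> (?P \<phi>) = hinner (H_single n) (?Q \<phi>) (?Q \<phi>)" by simp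
    then show ?thesis by (simp add: H_single_def ell2_inner_self infsum_nonneg)
  qed
  have abs: "abs_op (H_total n) ?T ?T"
    unfolding abs_op_def
  proof (intro conjI ballI T)
    fix x assume x: "x \<in> hcarrier (H_total n)"
    obtain \<phi> \<psi> where [simp]: "x = (\<phi>, \<psi>)" by (cases x)
    have C: "\<phi> \<in> ell n" "\<psi> \<in> ell n" using x by (simp_all add: H_total_simps)
    show "hinner (H_total n) x (?T x) \<in> \<real>" "0 \<le> Re (hinner (H_total n) x (?T x))"
      using Ppos[OF C(1)] Ppos[OF C(2)] by (simp_all add: Dirac_power_def H_total_simps)
    show "?T (?T x) = hadjoint (H_total n) ?T (?T x)"
      using x T Tsym by (intro Ht.hadjoint_eqI[symmetric]) (auto simp: bounded_op_closed)
  qed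
  have half: "(\<lambda>e. hinner (H_total n) e (?T e)) summable_on (Dirac_eigvec n c ` ?I)" if c: "c \<in> {1, -1}" for c
  proof -
    have inj: "inj_on (Dirac_eigvec n c) ?I"
    proof (rule inj_onI)
      fix m m' assume m: "m \<in> ?I" "m' \<in> ?I" "Dirac_eigvec n c m = Dirac_eigvec n c m'"
      then have "hinner (H_total n) (Dirac_eigvec n c m) (Dirac_eigvec n c m') = 1"
        using Dirac_eigvec_inner[of m n m c c] c by simp
      then show "m = m'" using Dirac_eigvec_inner[of m n m' c c] m c by (auto split: if_splits)
    qed
    have "(\<lambda>m. complex_of_real (weight n s m)) summable_on ?I"
      using weight_summable[OF n s] by (rule summable_on_of_real)
    also have "?this \<longleftrightarrow> ((\<lambda>e. hinner (H_total n) e (?T e)) \<circ> Dirac_eigvec n c) summable_on ?I"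
      using c Dirac_eigvec_inner
      by (intro summable_on_cong) (simp add: Teig Ht.inner_scale Dirac_eigvec_carrier)
    finally show ?thesis using summable_on_reindex[OF inj] by blast
  qed
  have "?E = Dirac_eigvec n 1 ` ?I \<union> Dirac_eigvec n (-1) ` ?I" by auto
  then have "(\<lambda>e. hinner (H_total n) e (?T e)) summable_on ?E"
    using summable_on_union[OF half[of 1] half[of "-1"]] by simp
  then show "trace_class (H_total n) ?T"
    unfolding trace_class_def using T abs Dirac_eigvec_basis by blast
qed

text \<open>
  For the lower bound it suffices to use the eigenvectors with eigenvalue \<open>+ level n m\<close>: any operator
  in the definition of the dimension acts on them by the weights, and a trace class
  operator has bounded finite sums of eigenvalues.
\<close>

lemma Dirac_metric_dimension:
  assumes n: "n \<ge> 1"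
  shows "metric_dimension (H_total n) (Dirac n) = ereal (real n)"
proof -
  let ?S = "{s. 0 < s \<and> (\<exists>T. functional_calculus (H_total n) (Dirac n) (\<lambda>t. (1 + t\<^sup>2) powr (- s / 2)) T \<and>
      trace_class (H_total n) T)}"
  have upper: "s \<in> ?S" if "s > real n" for s
    using Dirac_power_trace_class[OF n that] that n by auto
  have lower: "real n \<le> s" if sS: "s \<in> ?S" for s
  proof -
    obtain T where s: "s > 0" and fc: "functional_calculus (H_total n) (Dirac n) (\<lambda>t. (1 + t\<^sup>2) powr (- s / 2)) T"
      and tr: "trace_class (H_total n) T" using sS by blast
    have T: "bounded_op (H_total n) T" using tr by (simp add: trace_class_def)
    have eig: "T (Dirac_eigvec n 1 m) = hscale (H_total n) (of_real (weight n s m)) (Dirac_eigvec n 1 m)"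
      if m: "m \<in> multi_indices n" for m
    proof -
      have e: "Dirac_eigvec n 1 m \<in> opdom (Dirac n)"
        "opapp (Dirac n) (Dirac_eigvec n 1 m) = hscale (H_total n) (of_real (real (level n m))) (Dirac_eigvec n 1 m)"
        using Dirac_eigvec_eigen[OF m, of 1] by simp_all
      show ?thesis
        using Ht.functional_calculus_eigen[OF Dirac_symmetric Dirac_dom_carrier fc e] by (simp add: weight_def)
    qed
    have "hadjoint (H_total n) T (T (Dirac_eigvec n 1 m)) =
        hscale (H_total n) (of_real ((weight n s m)\<^sup>2)) (Dirac_eigvec n 1 m)" if m: "m \<in> multi_indices n" for m
    proof (rule Ht.hadjoint_eqI)
      let ?b = "Dirac_eigvec n 1 m"
      note bC = Dirac_eigvec_carrier[OF m, of 1]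
      show "hscale (H_total n) (of_real ((weight n s m)\<^sup>2)) ?b \<in> hcarrier (H_total n)" using bC by simp
      fix z assume z: "z \<in> hcarrier (H_total n)"
      have e: "Dirac_eigvec n 1 m \<in> opdom (Dirac n)"
        "opapp (Dirac n) (Dirac_eigvec n 1 m) = hscale (H_total n) (of_real (real (level n m))) (Dirac_eigvec n 1 m)"
        using Dirac_eigvec_eigen[OF m, of 1] by simp_all
      have "hinner (H_total n) ?b (T z) = of_real (weight n s m) * hinner (H_total n) ?b z"
        using Ht.functional_calculus_pairing[OF Dirac_symmetric Dirac_dom_carrier fc e z] by (simp add: weight_def)
      then show "hinner (H_total n) (hscale (H_total n) (of_real ((weight n s m)\<^sup>2)) ?b) z =
          hinner (H_total n) (T ?b) (T z)"
        using bC z bounded_op_closed[OF T] by (simp add: eig m Ht.inner_scale_left power2_eq_square)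
    qed
    then obtain B where "\<And>F. finite F \<Longrightarrow> F \<subseteq> multi_indices n \<Longrightarrow> sum (weight n s) F \<le> B"
      using Ht.trace_class_eigenvalue_bound[OF tr, of "multi_indices n" "Dirac_eigvec n 1" "weight n s"]
        Dirac_eigvec_inner[of _ n _ 1 1] Dirac_eigvec_carrier weight_pos by auto
    then show ?thesis by (rule weight_divergent[OF s])
  qed
  show ?thesis
    unfolding metric_dimension_def
  proof (rule antisym)
    show "ereal (real n) \<le> Inf (ereal ` ?S)"
    proof (rule Inf_greatest)
      fix x assume "x \<in> ereal ` ?S"
      then obtain s where "s \<in> ?S" "x = ereal s" by blast
      then show "ereal (real n) \<le> x" using lower by (simp only: ereal_less_eq)
    qed
    show "Inf (ereal ` ?S) \<le> ereal (real n)"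
    proof (rule ereal_le_epsilon2)
      fix \<epsilon> :: real assume "\<epsilon> > 0"
      then have "ereal (real n + \<epsilon>) \<in> ereal ` ?S" using upper by (intro imageI) simp
      then show "Inf (ereal ` ?S) \<le> ereal (real n) + ereal \<epsilon>" by (simp add: Inf_lower)
    qed
  qed
qed

section \<open>The coordinate algebras\<close>

subsection \<open>The free star-algebra\<close>

lemma free_elem_induct [case_names zero single add]:
  fixes x :: free_elem
  assumes "P 0" "\<And>k c. P (Poly_Mapping.single k c)" "\<And>x y. P x \<Longrightarrow> P y \<Longrightarrow> P (x + y)"
  shows "P x"
proof (induction x rule: update_induct)
  case (update f a b)
  have "Poly_Mapping.update a b f = f + Poly_Mapping.single a b"
    using update by (intro poly_mapping_eqI) (auto simp: lookup_update lookup_add lookup_single in_keys_iff when_def)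
  then show ?case using update assms by simp
qed (rule assms)

definition word_star :: "sphere_gen word \<Rightarrow> sphere_gen word" where
  "word_star w = Word (rev (map gen_star (letters w)))"

lemma gen_star_star[simp]: "gen_star (gen_star g) = g"
  by (cases g) auto

lemma gen_index_star[simp]: "gen_index (gen_star g) = gen_index g"
  by (cases g) auto

lemma word_star_star[simp]: "word_star (word_star w) = w"
  by (cases w) (simp add: word_star_def rev_map o_def)

lemma word_star_add: "word_star (u + v) = word_star v + word_star u"
  by (simp add: word_star_def plus_word_def)

lemma word_star_eq_iff: "word_star u = w \<longleftrightarrow> u = word_star w"
  by auto

text \<open>
  With this description on coefficients, additivity and involutivity of the star are immediate.
\<close>

lemma lookup_free_star: "Poly_Mapping.lookup (free_star x) w = cnj (Poly_Mapping.lookup x (word_star w))"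
proof -
  have "Poly_Mapping.lookup (free_star x) w =
      (\<Sum>v\<in>Poly_Mapping.keys x. if v = word_star w then cnj (Poly_Mapping.lookup x v) else 0)"
    unfolding free_star_def word_star_def[symmetric] lookup_sum lookup_single when_def
    by (simp add: word_star_eq_iff)
  also have "\<dots> = cnj (Poly_Mapping.lookup x (word_star w))"
    by (simp add: in_keys_iff)
  finally show ?thesis .
qed

lemma free_star_add: "free_star (x + y) = free_star x + free_star y"
  by (rule poly_mapping_eqI) (simp add: lookup_free_star lookup_add)

lemma free_star_zero[simp]: "free_star 0 = 0"
  by (rule poly_mapping_eqI) (simp add: lookup_free_star)

lemma free_star_uminus: "free_star (- x) = - free_star x"
  by (rule poly_mapping_eqI) (simp add: lookup_free_star)

lemma free_star_diff: "free_star (x - y) = free_star x - free_star y"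
  by (rule poly_mapping_eqI) (simp add: lookup_free_star lookup_minus)

lemma free_star_star[simp]: "free_star (free_star x) = x"
  by (rule poly_mapping_eqI) (simp add: lookup_free_star)

lemma free_star_single: "free_star (Poly_Mapping.single w c) = Poly_Mapping.single (word_star w) (cnj c)"
  by (rule poly_mapping_eqI) (auto simp: lookup_free_star lookup_single when_def word_star_eq_iff)

lemma free_star_mult: "free_star (x * y) = free_star y * free_star x"
proof (induction x rule: free_elem_induct)
  case (single k c)
  show ?case
    by (induction y rule: free_elem_induct)
       (simp_all add: free_star_single mult_single word_star_add free_star_add distrib_left distrib_right mult.commute)
qed (simp_all add: free_star_add distrib_left distrib_right)

lemma free_star_const: "free_star (free_const c) = free_const (cnj c)"
  by (simp add: free_const_def free_star_single) (simp add: word_star_def zero_word_def)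

lemma free_star_gens[simp]: "free_star (fz i) = fzs i" "free_star (fzs i) = fz i"
  by (simp_all add: fz_def fzs_def free_star_single word_star_def)

lemma free_const_central: "free_const c * x = x * free_const c"
  by (induction x rule: free_elem_induct) (simp_all add: free_const_def mult_single distrib_left distrib_right mult.commute)

lemma free_const_add: "free_const (c + d) = free_const c + free_const d"
  by (simp add: free_const_def single_add)

lemma free_const_mult: "free_const (c * d) = free_const c * free_const d"
  by (simp add: free_const_def mult_single)

lemma free_const_one: "free_const 1 = 1"
  by (simp add: free_const_def)

lemma free_const_minus_one: "free_const (-1) = - 1"
  by (simp add: free_const_def single_uminus)

abbreviation free_carrier :: "nat \<Rightarrow> free_elem set" where
  "free_carrier n \<equiv> carrier (free_alg n)"

lemma free_carrier_iff:
  "x \<in> free_carrier n \<longleftrightarrow> (\<forall>w\<in>Poly_Mapping.keys x. \<forall>g\<in>set (letters w). gen_index g \<le> n)"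
  by (simp add: free_alg_def)

lemma free_alg_simps[simp]:
  "x \<otimes>\<^bsub>free_alg n\<^esub> y = x * y" "x \<oplus>\<^bsub>free_alg n\<^esub> y = x + y" "\<one>\<^bsub>free_alg n\<^esub> = 1" "\<zero>\<^bsub>free_alg n\<^esub> = 0"
  by (simp_all add: free_alg_def)

lemma free_carrier_zero[simp]: "0 \<in> free_carrier n"
  and free_carrier_one[simp]: "1 \<in> free_carrier n"
  and free_carrier_const[simp]: "free_const c \<in> free_carrier n"
  and free_carrier_fz[simp]: "i \<le> n \<Longrightarrow> fz i \<in> free_carrier n"
  and free_carrier_fzs[simp]: "i \<le> n \<Longrightarrow> fzs i \<in> free_carrier n"
  by (simp_all add: free_carrier_iff zero_word_def free_const_def fz_def fzs_def)

lemma free_carrier_add[simp]: "x \<in> free_carrier n \<Longrightarrow> y \<in> free_carrier n \<Longrightarrow> x + y \<in> free_carrier n"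
  unfolding free_carrier_iff using keys_add[of x y] by blast

lemma free_carrier_uminus[simp]: "x \<in> free_carrier n \<Longrightarrow> - x \<in> free_carrier n"
  by (simp add: free_carrier_iff in_keys_iff)

lemma free_carrier_diff[simp]: "x \<in> free_carrier n \<Longrightarrow> y \<in> free_carrier n \<Longrightarrow> x - y \<in> free_carrier n"
  using free_carrier_add[of x n "- y"] by simp

lemma free_carrier_mult[simp]: "x \<in> free_carrier n \<Longrightarrow> y \<in> free_carrier n \<Longrightarrow> x * y \<in> free_carrier n"
  unfolding free_carrier_iff using keys_mult[of x y] by (fastforce simp: plus_word_def)

lemma free_carrier_sum[simp]: "(\<And>i. i \<in> A \<Longrightarrow> f i \<in> free_carrier n) \<Longrightarrow> sum f A \<in> free_carrier n"
  by (induction A rule: infinite_finite_induct) auto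

lemma free_carrier_star[simp]: "x \<in> free_carrier n \<Longrightarrow> free_star x \<in> free_carrier n"
  unfolding free_carrier_iff
proof (intro ballI)
  fix w g assume *: "\<forall>w\<in>Poly_Mapping.keys x. \<forall>g\<in>set (letters w). gen_index g \<le> n"
    and "w \<in> Poly_Mapping.keys (free_star x)" "g \<in> set (letters w)"
  then have "word_star w \<in> Poly_Mapping.keys x" "gen_star g \<in> set (letters (word_star w))"
    by (auto simp: in_keys_iff lookup_free_star word_star_def)
  then show "gen_index g \<le> n" using * gen_index_star by metis
qed

lemma free_alg_ring: "ring (free_alg n)"
proof (rule ringI)
  show "abelian_group (free_alg n)"
    by (rule abelian_groupI) (auto simp: add.assoc add.commute intro!: bexI[of _ "- _"])
  show "Group.monoid (free_alg n)"
    by (rule monoidI) (auto simp: mult.assoc)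
qed (auto simp: distrib_left distrib_right)

lemma free_alg_minus: "x \<in> free_carrier n \<Longrightarrow> \<ominus>\<^bsub>free_alg n\<^esub> x = - x"
  by (rule abelian_group.minus_equality) (use free_alg_ring ring.is_abelian_group in auto)

lemma free_ideal_intro:
  assumes "J \<subseteq> free_carrier n" "0 \<in> J" "\<And>x y. x \<in> J \<Longrightarrow> y \<in> J \<Longrightarrow> x + y \<in> J" "\<And>x. x \<in> J \<Longrightarrow> - x \<in> J"
    "\<And>a x. a \<in> J \<Longrightarrow> x \<in> free_carrier n \<Longrightarrow> x * a \<in> J \<and> a * x \<in> J"
  shows "ideal J (free_alg n)"
proof (rule idealI)
  show "subgroup J (add_monoid (free_alg n))"
  proof
    fix x assume "x \<in> J"
    then show "inv\<^bsub>add_monoid (free_alg n)\<^esub> x \<in> J"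
      using free_alg_minus[of x n] assms by (auto simp: a_inv_def)
  qed (use assms in auto)
qed (use assms free_alg_ring in auto)

lemma free_ideal_elim:
  assumes "ideal J (free_alg n)"
  shows "J \<subseteq> free_carrier n" "0 \<in> J" "\<And>x y. x \<in> J \<Longrightarrow> y \<in> J \<Longrightarrow> x + y \<in> J" "\<And>x. x \<in> J \<Longrightarrow> - x \<in> J"
    "\<And>a x. a \<in> J \<Longrightarrow> x \<in> free_carrier n \<Longrightarrow> x * a \<in> J" "\<And>a x. a \<in> J \<Longrightarrow> x \<in> free_carrier n \<Longrightarrow> a * x \<in> J"
proof -
  interpret ideal J "free_alg n" by fact
  show sub: "J \<subseteq> free_carrier n" using a_subset .
  show "0 \<in> J" using additive_subgroup.zero_closed[OF is_additive_subgroup] by simp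
  show "\<And>x y. x \<in> J \<Longrightarrow> y \<in> J \<Longrightarrow> x + y \<in> J" using additive_subgroup.a_closed[OF is_additive_subgroup] by simp
  show "- x \<in> J" if "x \<in> J" for x using additive_subgroup.a_inv_closed[OF is_additive_subgroup that] free_alg_minus[of x n] sub that by auto
  show "\<And>a x. a \<in> J \<Longrightarrow> x \<in> free_carrier n \<Longrightarrow> x * a \<in> J" using I_l_closed by simp
  show "\<And>a x. a \<in> J \<Longrightarrow> x \<in> free_carrier n \<Longrightarrow> a * x \<in> J" using I_r_closed by simp
qed

subsection \<open>The coordinate algebra of the quantum sphere\<close>

lemma sphere_relations_carrier: "sphere_relations q n \<subseteq> free_carrier n"
  unfolding sphere_relations_def
  by (auto intro!: free_carrier_diff free_carrier_mult free_carrier_sum)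

lemma sphere_ideal_is_ideal: "ideal (sphere_ideal q n) (free_alg n)"
  unfolding sphere_ideal_def
  by (rule ring.genideal_ideal[OF free_alg_ring]) (use sphere_relations_carrier[of q n] free_carrier_star in blast)

lemma sphere_ideal_minimal:
  assumes "ideal J (free_alg n)" "\<And>x. x \<in> sphere_relations q n \<Longrightarrow> x \<in> J" "\<And>x. x \<in> J \<Longrightarrow> free_star x \<in> J"
  shows "sphere_ideal q n \<subseteq> J"
  unfolding sphere_ideal_def by (rule ring.genideal_minimal[OF free_alg_ring assms(1)]) (use assms in auto)

lemmas sphere_ideal_closed = free_ideal_elim[OF sphere_ideal_is_ideal]

text \<open>
  The elements whose star lies in the ideal form an ideal that contains the generators, as the
  generating set is closed under the star.
\<close>

lemma sphere_ideal_star: "x \<in> sphere_ideal q n \<Longrightarrow> free_star x \<in> sphere_ideal q n"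
proof -
  let ?J = "{x \<in> free_carrier n. free_star x \<in> sphere_ideal q n}"
  have gen: "sphere_relations q n \<union> free_star ` sphere_relations q n \<subseteq> sphere_ideal q n"
    unfolding sphere_ideal_def
    by (rule ring.genideal_self[OF free_alg_ring]) (use sphere_relations_carrier[of q n] free_carrier_star in blast)
  have "ideal ?J (free_alg n)"
    by (rule free_ideal_intro)
       (auto simp: sphere_ideal_closed free_star_add free_star_uminus free_star_mult)
  moreover have "sphere_relations q n \<union> free_star ` sphere_relations q n \<subseteq> ?J"
    using gen sphere_relations_carrier[of q n] by auto
  ultimately have "sphere_ideal q n \<subseteq> ?J"
    unfolding sphere_ideal_def[of q n] by (rule ring.genideal_minimal[OF free_alg_ring])
  then show "x \<in> sphere_ideal q n \<Longrightarrow> free_star x \<in> sphere_ideal q n" by auto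
qed

lemma sphere_class_iff: "y \<in> sphere_class q n x \<longleftrightarrow> y - x \<in> sphere_ideal q n"
proof -
  have "sphere_class q n x = {h + x | h. h \<in> sphere_ideal q n}"
    unfolding sphere_class_def a_r_coset_def' by auto
  then show ?thesis by (force intro: exI[of _ "y - x"])
qed

lemma sphere_alg_carrier: "carrier (sphere_alg q n) = sphere_class q n ` free_carrier n"
  unfolding sphere_alg_def Let_def FactRing_def A_RCOSETS_def' sphere_class_def by auto

lemma sphere_class_mult:
  assumes "x \<in> free_carrier n" "y \<in> free_carrier n"
  shows "sphere_class q n x \<otimes>\<^bsub>sphere_alg q n\<^esub> sphere_class q n y = sphere_class q n (x * y)"
  using ideal.rcoset_mult_add[OF sphere_ideal_is_ideal assms, of q]
  by (simp add: sphere_alg_def Let_def FactRing_def sphere_class_def)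

lemma sphere_class_add:
  assumes "x \<in> free_carrier n" "y \<in> free_carrier n"
  shows "sphere_class q n x \<oplus>\<^bsub>sphere_alg q n\<^esub> sphere_class q n y = sphere_class q n (x + y)"
proof -
  interpret ideal "sphere_ideal q n" "free_alg n" by (rule sphere_ideal_is_ideal)
  show ?thesis
    using a_rcos_sum[OF assms] by (simp add: sphere_alg_def Let_def FactRing_def sphere_class_def)
qed

lemma sphere_class_zero: "\<zero>\<^bsub>sphere_alg q n\<^esub> = sphere_class q n 0"
  by (auto simp: sphere_alg_def Let_def FactRing_def sphere_class_iff)

lemma sphere_class_scale:
  assumes "x \<in> free_carrier n"
  shows "c \<odot>\<^bsub>sphere_alg q n\<^esub> sphere_class q n x = sphere_class q n (free_const c * x)"
proof -
  have "c \<odot>\<^bsub>sphere_alg q n\<^esub> sphere_class q n x =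
      sphere_class q n (free_const c) \<otimes>\<^bsub>sphere_alg q n\<^esub> sphere_class q n x"
    by (simp add: sphere_alg_def Let_def)
  then show ?thesis using sphere_class_mult[of "free_const c" n x q] assms by simp
qed

lemma sphere_class_star: "star (sphere_alg q n) (sphere_class q n x) = sphere_class q n (free_star x)"
proof -
  have "free_star ` sphere_class q n x = sphere_class q n (free_star x)"
  proof (intro equalityI subsetI)
    fix z assume "z \<in> free_star ` sphere_class q n x"
    then show "z \<in> sphere_class q n (free_star x)"
      using sphere_ideal_star by (auto simp: sphere_class_iff free_star_diff[symmetric])
  next
    fix z assume "z \<in> sphere_class q n (free_star x)"
    then have "free_star (z - free_star x) \<in> sphere_ideal q n"
      using sphere_ideal_star by (simp add: sphere_class_iff)
    then have "free_star z \<in> sphere_class q n x" by (simp add: sphere_class_iff free_star_diff)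
    then show "z \<in> free_star ` sphere_class q n x" by (metis free_star_star image_eqI)
  qed
  then show ?thesis by (simp add: sphere_alg_def Let_def)
qed

lemmas sphere_class_ops = sphere_class_mult sphere_class_add sphere_class_zero sphere_class_scale sphere_class_star

text \<open>
  All operations on classes are given by representatives, so each axiom reduces to the same identity in the
  free algebra. The carrier may be any subset closed under the operations; it
  contains negatives because it is closed under multiplication by \<open>-1\<close>.
\<close>

lemma sphere_subalgebra_star_algebra:
  assumes sub: "S \<subseteq> carrier (sphere_alg q n)" and zero: "\<zero>\<^bsub>sphere_alg q n\<^esub> \<in> S"
    and add: "\<And>x y. x \<in> S \<Longrightarrow> y \<in> S \<Longrightarrow> x \<oplus>\<^bsub>sphere_alg q n\<^esub> y \<in> S"
    and mult: "\<And>x y. x \<in> S \<Longrightarrow> y \<in> S \<Longrightarrow> x \<otimes>\<^bsub>sphere_alg q n\<^esub> y \<in> S"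
    and scale: "\<And>c x. x \<in> S \<Longrightarrow> c \<odot>\<^bsub>sphere_alg q n\<^esub> x \<in> S"
    and star: "\<And>x. x \<in> S \<Longrightarrow> star (sphere_alg q n) x \<in> S"
  shows "star_algebra ((sphere_alg q n)\<lparr>carrier := S\<rparr>)"
proof -
  let ?A = "(sphere_alg q n)\<lparr>carrier := S\<rparr>"
  have rep: "\<exists>y\<in>free_carrier n. x = sphere_class q n y" if "x \<in> S" for x
    using that sub by (auto simp: sphere_alg_carrier)
  have "abelian_group ?A"
  proof (rule abelian_groupI)
    fix x assume x: "x \<in> carrier ?A"
    then have xS: "x \<in> S" by simp
    then obtain a where a: "a \<in> free_carrier n" "x = sphere_class q n a" using rep by blast
    show "\<zero>\<^bsub>?A\<^esub> \<oplus>\<^bsub>?A\<^esub> x = x" using a by (simp add: sphere_class_ops)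
    have "(-1) \<odot>\<^bsub>sphere_alg q n\<^esub> x \<in> S" using scale xS by blast
    then show "\<exists>y\<in>carrier ?A. y \<oplus>\<^bsub>?A\<^esub> x = \<zero>\<^bsub>?A\<^esub>"
      using a by (intro bexI[of _ "(-1) \<odot>\<^bsub>sphere_alg q n\<^esub> x"]) (simp_all add: sphere_class_ops free_const_minus_one)
    fix y assume "y \<in> carrier ?A"
    then have yS: "y \<in> S" by simp
    then obtain b where b: "b \<in> free_carrier n" "y = sphere_class q n b" using rep by blast
    show "x \<oplus>\<^bsub>?A\<^esub> y = y \<oplus>\<^bsub>?A\<^esub> x" using a b by (simp add: sphere_class_ops add.commute)
    show "x \<oplus>\<^bsub>?A\<^esub> y \<in> carrier ?A" using add xS yS by simp
    fix z assume "z \<in> carrier ?A"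
    then obtain c where c: "c \<in> free_carrier n" "z = sphere_class q n c" using rep by auto
    show "(x \<oplus>\<^bsub>?A\<^esub> y) \<oplus>\<^bsub>?A\<^esub> z = x \<oplus>\<^bsub>?A\<^esub> (y \<oplus>\<^bsub>?A\<^esub> z)" using a b c by (simp add: sphere_class_ops add.assoc)
  qed (use zero in simp)
  moreover have "star_algebra_axioms ?A"
  proof
    fix x c d assume x: "x \<in> carrier ?A"
    then have xS: "x \<in> S" by simp
    then obtain a where a: "a \<in> free_carrier n" "x = sphere_class q n a" using rep by blast
    show "c \<odot>\<^bsub>?A\<^esub> x \<in> carrier ?A" "star ?A x \<in> carrier ?A" using xS scale star by simp_all
    show "(c + d) \<odot>\<^bsub>?A\<^esub> x = c \<odot>\<^bsub>?A\<^esub> x \<oplus>\<^bsub>?A\<^esub> d \<odot>\<^bsub>?A\<^esub> x"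
      using a by (simp add: sphere_class_ops free_const_add distrib_right)
    show "(c * d) \<odot>\<^bsub>?A\<^esub> x = c \<odot>\<^bsub>?A\<^esub> (d \<odot>\<^bsub>?A\<^esub> x)"
      using a by (simp add: sphere_class_ops free_const_mult mult.assoc)
    show "1 \<odot>\<^bsub>?A\<^esub> x = x" using a by (simp add: sphere_class_ops free_const_one)
    show "star ?A (star ?A x) = x" using a by (simp add: sphere_class_ops)
    show "star ?A (c \<odot>\<^bsub>?A\<^esub> x) = cnj c \<odot>\<^bsub>?A\<^esub> star ?A x"
      using a by (simp add: sphere_class_ops free_star_mult free_star_const free_const_central)
    fix y assume "y \<in> carrier ?A"
    then have yS: "y \<in> S" by simp
    then obtain b where b: "b \<in> free_carrier n" "y = sphere_class q n b" using rep by blast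
    show "x \<otimes>\<^bsub>?A\<^esub> y \<in> carrier ?A" using mult xS yS by simp
    show "c \<odot>\<^bsub>?A\<^esub> (x \<oplus>\<^bsub>?A\<^esub> y) = c \<odot>\<^bsub>?A\<^esub> x \<oplus>\<^bsub>?A\<^esub> c \<odot>\<^bsub>?A\<^esub> y"
      using a b by (simp add: sphere_class_ops distrib_left)
    show "(c \<odot>\<^bsub>?A\<^esub> x) \<otimes>\<^bsub>?A\<^esub> y = c \<odot>\<^bsub>?A\<^esub> (x \<otimes>\<^bsub>?A\<^esub> y)"
      using a b by (simp add: sphere_class_ops mult.assoc)
    show "x \<otimes>\<^bsub>?A\<^esub> (c \<odot>\<^bsub>?A\<^esub> y) = c \<odot>\<^bsub>?A\<^esub> (x \<otimes>\<^bsub>?A\<^esub> y)"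
      using a b free_const_central[of c a] by (simp add: sphere_class_ops mult.assoc[symmetric])
    show "star ?A (x \<oplus>\<^bsub>?A\<^esub> y) = star ?A x \<oplus>\<^bsub>?A\<^esub> star ?A y"
      using a b by (simp add: sphere_class_ops free_star_add)
    show "star ?A (x \<otimes>\<^bsub>?A\<^esub> y) = star ?A y \<otimes>\<^bsub>?A\<^esub> star ?A x"
      using a b by (simp add: sphere_class_ops free_star_mult)
    fix z assume "z \<in> carrier ?A"
    then obtain c where c: "c \<in> free_carrier n" "z = sphere_class q n c" using rep by auto
    show "x \<otimes>\<^bsub>?A\<^esub> y \<otimes>\<^bsub>?A\<^esub> z = x \<otimes>\<^bsub>?A\<^esub> (y \<otimes>\<^bsub>?A\<^esub> z)" using a b c by (simp add: sphere_class_ops mult.assoc)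
    show "x \<otimes>\<^bsub>?A\<^esub> (y \<oplus>\<^bsub>?A\<^esub> z) = x \<otimes>\<^bsub>?A\<^esub> y \<oplus>\<^bsub>?A\<^esub> x \<otimes>\<^bsub>?A\<^esub> z"
      using a b c by (simp add: sphere_class_ops distrib_left)
    show "(x \<oplus>\<^bsub>?A\<^esub> y) \<otimes>\<^bsub>?A\<^esub> z = x \<otimes>\<^bsub>?A\<^esub> z \<oplus>\<^bsub>?A\<^esub> y \<otimes>\<^bsub>?A\<^esub> z"
      using a b c by (simp add: sphere_class_ops distrib_right)
  qed
  ultimately show ?thesis by (rule star_algebra.intro)
qed

lemma proj_gen_class:
  assumes "i \<le> n" "j \<le> n" shows "proj_gen q n i j = sphere_class q n (fzs i * fz j)"
  using assms by (simp add: proj_gen_def sphere_class_ops)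

lemma projective_alg_carrier_sub: "carrier (projective_alg q n) \<subseteq> carrier (sphere_alg q n)"
proof
  fix x assume "x \<in> carrier (projective_alg q n)"
  then have "x \<in> star_subalgebra_generated (sphere_alg q n) {proj_gen q n i j |i j. i \<le> n \<and> j \<le> n}"
    by (simp add: projective_alg_def)
  then show "x \<in> carrier (sphere_alg q n)"
    by (induction) (auto simp: proj_gen_class sphere_alg_carrier sphere_class_ops)
qed

lemma projective_alg_star_algebra: "star_algebra (projective_alg q n)"
  unfolding projective_alg_def
  by (rule sphere_subalgebra_star_algebra)
     (use projective_alg_carrier_sub[of q n] in \<open>auto simp: projective_alg_def intro: star_subalgebra_generated.intros\<close>)

section \<open>The irreducible representations of the quantum sphere\<close>

text \<open>
  The amplitude of the shift by \<open>eps i k\<close>, read off at the target for the generator (\<open>r = 0\<close>) and for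
  its adjoint (\<open>r = 1\<close>); in both cases \<open>p\<close> is the index of the coordinate of the image. For
  \<open>r = 0\<close> and \<open>i \<le> k\<close> it vanishes exactly if \<open>p\<close> is not a shifted element of the index set, so no
  case distinction is needed there.
\<close>

definition amp :: "real \<Rightarrow> nat \<Rightarrow> nat \<Rightarrow> nat \<Rightarrow> (nat \<Rightarrow> nat) \<Rightarrow> real" where
  "amp q k i r p = (if i < k then q ^ p i * sqrt (1 - q ^ (2 * (p (i + 1) - p i + r)))
     else if i = k then q ^ p k else 0)"

definition V_act :: "nat \<Rightarrow> nat \<Rightarrow> vec \<Rightarrow> vec" where
  "V_act n k = pull (multi_indices n) (\<lambda>p. if p \<in> V_indices n k then 1 else 0) (\<lambda>p. p)"

definition z_act :: "real \<Rightarrow> nat \<Rightarrow> nat \<Rightarrow> nat \<Rightarrow> vec \<Rightarrow> vec" where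
  "z_act q n k i = pull (multi_indices n)
     (\<lambda>p. if p \<in> V_indices n k then of_real (amp q k i 0 p) else 0) (\<lambda>p. p - eps i k)"

definition zs_act :: "real \<Rightarrow> nat \<Rightarrow> nat \<Rightarrow> nat \<Rightarrow> vec \<Rightarrow> vec" where
  "zs_act q n k i = pull (multi_indices n)
     (\<lambda>p. if p \<in> V_indices n k then of_real (amp q k i (Suc 0) p) else 0) (\<lambda>p. p + eps i k)"

primrec gen_act :: "real \<Rightarrow> nat \<Rightarrow> nat \<Rightarrow> sphere_gen \<Rightarrow> vec \<Rightarrow> vec" where
  "gen_act q n k (Z i) = z_act q n k i"
| "gen_act q n k (Zs i) = zs_act q n k i"

primrec word_act :: "real \<Rightarrow> nat \<Rightarrow> nat \<Rightarrow> sphere_gen list \<Rightarrow> vec \<Rightarrow> vec" where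
  "word_act q n k [] = V_act n k"
| "word_act q n k (g # w) = gen_act q n k g \<circ> word_act q n k w"

definition free_act :: "real \<Rightarrow> nat \<Rightarrow> nat \<Rightarrow> free_elem \<Rightarrow> vec \<Rightarrow> vec" where
  "free_act q n k x \<psi> = (\<Sum>w\<in>Poly_Mapping.keys x.
     hscale (H_single n) (Poly_Mapping.lookup x w) (word_act q n k (letters w) \<psi>))"

lemma V_indices_multi: "p \<in> V_indices n k \<Longrightarrow> p \<in> multi_indices n"
  by (simp add: V_indices_def)

lemma H_single_scale: "hscale (H_single n) c \<psi> = (\<lambda>p. c * \<psi> p)"
  by (simp add: H_single_def ell2_scale)

lemma V_act_apply: "V_act n k \<psi> p = (if p \<in> V_indices n k then \<psi> p else 0)"
  by (auto simp: V_act_def pull_def dest: V_indices_multi)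

lemma z_act_apply: "z_act q n k i \<psi> p = (if p \<in> V_indices n k then of_real (amp q k i 0 p) * \<psi> (p - eps i k) else 0)"
  by (auto simp: z_act_def pull_def dest: V_indices_multi)

lemma zs_act_apply: "zs_act q n k i \<psi> p = (if p \<in> V_indices n k then of_real (amp q k i (Suc 0) p) * \<psi> (p + eps i k) else 0)"
  by (auto simp: zs_act_def pull_def dest: V_indices_multi)

lemma pull_linear:
  "pull I a \<tau> (\<phi> + \<psi>) = pull I a \<tau> \<phi> + pull I a \<tau> \<psi>"
  "pull I a \<tau> (\<lambda>p. c * \<psi> p) = (\<lambda>p. c * pull I a \<tau> \<psi> p)"
  "pull I a \<tau> 0 = 0"
  by (auto simp: pull_def algebra_simps)

lemma gen_act_linear:
  "gen_act q n k g (\<phi> + \<psi>) = gen_act q n k g \<phi> + gen_act q n k g \<psi>"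
  "gen_act q n k g (hscale (H_single n) c \<psi>) = hscale (H_single n) c (gen_act q n k g \<psi>)"
  "gen_act q n k g 0 = 0"
  by (cases g; simp add: z_act_def zs_act_def pull_linear H_single_scale)+

lemma V_act_linear:
  "V_act n k (\<phi> + \<psi>) = V_act n k \<phi> + V_act n k \<psi>"
  "V_act n k (hscale (H_single n) c \<psi>) = hscale (H_single n) c (V_act n k \<psi>)"
  "V_act n k 0 = 0"
  by (simp_all add: V_act_def pull_linear H_single_scale)

lemma word_act_linear:
  "word_act q n k w (\<phi> + \<psi>) = word_act q n k w \<phi> + word_act q n k w \<psi>"
  "word_act q n k w (hscale (H_single n) c \<psi>) = hscale (H_single n) c (word_act q n k w \<psi>)"
  "word_act q n k w 0 = 0"
  by (induction w) (simp_all add: gen_act_linear V_act_linear)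

lemma free_act_add: "free_act q n k (x + y) \<psi> = free_act q n k x \<psi> + free_act q n k y \<psi>"
  unfolding free_act_def
  by (rule setsum_keys_plus_distrib[where f="\<lambda>w c. hscale (H_single n) c (word_act q n k (letters w) \<psi>)"])
     (simp_all add: Hs.vs.scale_left_distrib)

lemma free_act_zero[simp]: "free_act q n k 0 \<psi> = 0"
  by (simp add: free_act_def)

lemma free_act_single: "free_act q n k (Poly_Mapping.single w c) \<psi> =
    hscale (H_single n) c (word_act q n k (letters w) \<psi>)"
  by (simp add: free_act_def)

lemma free_act_uminus: "free_act q n k (- x) \<psi> = - free_act q n k x \<psi>"
  using free_act_add[of q n k x "- x" \<psi>] by (simp add: eq_neg_iff_add_eq_0 add.commute)

lemma free_act_diff: "free_act q n k (x - y) \<psi> = free_act q n k x \<psi> - free_act q n k y \<psi>"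
  using free_act_add[of q n k x "- y" \<psi>] by (simp add: free_act_uminus)

lemma free_act_sum: "free_act q n k (sum f A) \<psi> = (\<Sum>i\<in>A. free_act q n k (f i) \<psi>)"
  by (induction A rule: infinite_finite_induct) (simp_all add: free_act_add)

lemma free_act_linear:
  "free_act q n k x (\<phi> + \<psi>) = free_act q n k x \<phi> + free_act q n k x \<psi>"
  "free_act q n k x (hscale (H_single n) c \<psi>) = hscale (H_single n) c (free_act q n k x \<psi>)"
  "free_act q n k x 0 = 0"
  by (simp_all add: free_act_def word_act_linear Hs.vs.scale_right_distrib sum.distrib Hs.vs.scale_sum_right
      mult.commute)

lemma sum_fun_apply: "(\<Sum>j\<in>A. f j) p = (\<Sum>j\<in>A. f j p)"
  by (induction A rule: infinite_finite_induct) auto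

lemma eps_same[simp]: "eps k k = (0 :: nat \<Rightarrow> nat)"
  by (auto simp: eps_def)

locale sphere_component =
  fixes q :: real and n k :: nat
  assumes q: "0 < q" "q < 1" and k: "k \<le> n"
begin

abbreviation "V \<equiv> V_indices n k"

lemma V_mono:
  assumes "p \<in> V" "i \<le> j" "j \<le> k" shows "p i \<le> p j"
  using assms(2,3)
proof (induction j rule: dec_induct)
  case (step j)
  have "p j \<le> p (Suc j)"
    using assms(1) step by (cases "j = 0") (auto simp: V_indices_def multi_indices_def)
  then show ?case using step by simp
qed simp

lemma V_plus: "p \<in> V \<Longrightarrow> i \<le> k \<Longrightarrow> p + eps i k \<in> V"
  using k by (auto simp: V_indices_def multi_indices_def eps_def)

text \<open>
  A strict step at \<open>i\<close> makes all entries in positions \<open>i + 1, \<dots>, k\<close> positive, so the truncated subtraction is a true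
  one.
\<close>

lemma V_minus:
  assumes p: "p \<in> V" "i < k" "p i < p (i + 1)"
  shows "p - eps i k \<in> V" "(p - eps i k) + eps i k = p"
proof -
  have pos: "0 < p j" if "i < j" "j \<le> k" for j
    using V_mono[OF p(1), of "i + 1" j] p that by auto
  have step: "p j - eps i k j \<le> p (j + 1) - eps i k (j + 1)" if j: "1 \<le> j" "j < k" for j
  proof (cases "j = i")
    case True then show ?thesis using p by (auto simp: eps_def)
  next
    case False
    have "p j \<le> p (j + 1)" using p(1) j by (auto simp: V_indices_def)
    then show ?thesis using False j by (auto simp: eps_def)
  qed
  show "p - eps i k \<in> V"
    unfolding V_indices_def
  proof (intro CollectI conjI)
    show "p - eps i k \<in> multi_indices n" using p(1) by (auto simp: V_indices_def multi_indices_def)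
    show "\<forall>j. 1 \<le> j \<and> j < k \<longrightarrow> (p - eps i k) j \<le> (p - eps i k) (j + 1)" using step by simp
    show "\<forall>j. k < j \<and> j < n \<longrightarrow> (p - eps i k) (j + 1) < (p - eps i k) j"
      using p(1) by (auto simp: V_indices_def eps_def)
  qed
  show "(p - eps i k) + eps i k = p"
    using pos by (auto simp: fun_eq_iff eps_def Suc_le_eq)
qed

lemma amp_above: "i > k \<Longrightarrow> amp q k i r p = 0"
  by (simp add: amp_def)

lemma power_q_le_1: "q ^ a \<le> 1"
  using q by (simp add: power_le_one)

lemma amp_bounds: "0 \<le> amp q k i r p" "amp q k i r p \<le> q ^ p i" "amp q k i r p \<le> 1"
proof -
  have s: "0 \<le> sqrt (1 - q ^ a)" "sqrt (1 - q ^ a) \<le> 1" for a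
    using power_q_le_1[of a] q by auto
  show "0 \<le> amp q k i r p" using s q by (auto simp: amp_def)
  have "q ^ p i * sqrt (1 - q ^ a) \<le> q ^ p i * 1" for a using s q by (intro mult_left_mono) auto
  then show *: "amp q k i r p \<le> q ^ p i" using q by (auto simp: amp_def)
  then show "amp q k i r p \<le> 1" using power_q_le_1[of "p i"] by linarith
qed

lemma amp0_nonzero:
  assumes "p \<in> V" "amp q k i 0 p \<noteq> 0"
  shows "i \<le> k" "p - eps i k \<in> V" "(p - eps i k) + eps i k = p"
proof -
  have "i < k \<and> p i < p (i + 1) \<or> i = k"
  proof (rule ccontr)
    assume "\<not> ?thesis"
    then have "i > k \<or> (i < k \<and> p (i + 1) - p i = 0)" by auto
    then show False using assms(2) by (auto simp: amp_def)
  qed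
  then show "i \<le> k" "p - eps i k \<in> V" "(p - eps i k) + eps i k = p"
    using V_minus[OF assms(1)] assms(1) by (auto simp: fun_eq_iff)
qed

lemma amp0_plus:
  assumes "p \<in> V" shows "amp q k i 0 (p + eps i k) = amp q k i (Suc 0) p"
  using V_mono[OF assms, of i "i + 1"] by (auto simp: amp_def eps_def Suc_diff_le)

lemma amp0_minus:
  assumes "p \<in> V" "amp q k i 0 p \<noteq> 0" shows "amp q k i (Suc 0) (p - eps i k) = amp q k i 0 p"
  using amp0_plus[of "p - eps i k" i] amp0_nonzero[OF assms] by simp

lemma amp_plus_upper: "i < j \<Longrightarrow> amp q k i r (p + eps j k) = amp q k i r p"
  by (auto simp: amp_def eps_def)

lemma amp_plus_lower: "i < j \<Longrightarrow> amp q k j r (p + eps i k) = q * amp q k j r p"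
  by (auto simp: amp_def eps_def)

lemma z_adjoint: "hinner (H_single n) (zs_act q n k i \<phi>) \<psi> = hinner (H_single n) \<phi> (z_act q n k i \<psi>)"
  unfolding H_single_def z_act_def zs_act_def
proof (rule pull_adjoint)
  let ?a = "\<lambda>p. if p \<in> V then of_real (amp q k i 0 p) else 0 :: complex"
  let ?b = "\<lambda>p. if p \<in> V then of_real (amp q k i (Suc 0) p) else 0 :: complex"
  have i: "i \<le> k" if "amp q k i r p \<noteq> 0" for r p using that amp_above[of i r p] by (cases "i \<le> k") auto
  show "bij_betw (\<lambda>p. p - eps i k) {p \<in> multi_indices n. ?a p \<noteq> 0} {p \<in> multi_indices n. ?b p \<noteq> 0}"
  proof (rule bij_betw_byWitness[where f'="\<lambda>p. p + eps i k"])
    show "(\<lambda>p. p - eps i k) ` {p \<in> multi_indices n. ?a p \<noteq> 0} \<subseteq> {p \<in> multi_indices n. ?b p \<noteq> 0}"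
      by (auto simp: amp0_nonzero amp0_minus V_indices_multi split: if_splits)
    show "(\<lambda>p. p + eps i k) ` {p \<in> multi_indices n. ?b p \<noteq> 0} \<subseteq> {p \<in> multi_indices n. ?a p \<noteq> 0}"
      using i by (auto simp: amp0_plus V_plus V_indices_multi split: if_splits)
  qed (auto simp: amp0_nonzero fun_eq_iff[of "_ + _ - _"] split: if_splits)
  show "p - eps i k + eps i k = p \<and> ?b (p - eps i k) = cnj (?a p)" if "p \<in> multi_indices n" "?a p \<noteq> 0" for p
    using that by (auto simp: amp0_nonzero amp0_minus split: if_splits)
qed

lemma z_bounded: "bounded_op (H_single n) (z_act q n k i)"
  unfolding z_act_def H_single_def
proof (rule bounded_op_pull[where B=1])
  let ?a = "\<lambda>p. if p \<in> V then of_real (amp q k i 0 p) else 0 :: complex"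
  show "inj_on (\<lambda>p. p - eps i k) {p \<in> multi_indices n. ?a p \<noteq> 0}"
  proof (rule inj_onI)
    fix p p' assume "p \<in> {p \<in> multi_indices n. ?a p \<noteq> 0}" "p' \<in> {p \<in> multi_indices n. ?a p \<noteq> 0}" "p - eps i k = p' - eps i k"
    then show "p = p'" using amp0_nonzero(3)[of p i] amp0_nonzero(3)[of p' i] by (auto split: if_splits)
  qed
qed (auto simp: amp_bounds intro: V_indices_multi[OF amp0_nonzero(2)] split: if_splits)

lemma zs_bounded: "bounded_op (H_single n) (zs_act q n k i)"
  unfolding zs_act_def H_single_def
proof (rule bounded_op_pull[where B=1])
  show "inj_on (\<lambda>p. p + eps i k) X" for X by (rule inj_onI) simp
  show "p + eps i k \<in> multi_indices n" if "(if p \<in> V then of_real (amp q k i (Suc 0) p) else 0 :: complex) \<noteq> 0" for p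
    using that amp_above[of i "Suc 0" p] V_plus[of p i] by (cases "i \<le> k") (auto simp: V_indices_multi split: if_splits)
qed (use amp_bounds in auto)

lemma V_act_bounded: "bounded_op (H_single n) (V_act n k)"
  unfolding V_act_def H_single_def by (rule bounded_op_pull[where B=1]) auto

text \<open>
  At most one basis vector contributes to a given coordinate of the image, so this
  identity needs no summability.
\<close>

lemma z_op_eq: "z_op q n k i \<psi> = z_act q n k i \<psi>"
proof
  fix p
  let ?v = "\<lambda>m. if m \<notin> V then 0 else if i < k then hscale (H_single n)
      (of_real (q ^ m i * sqrt (1 - q ^ (2 * (m (i + 1) - m i + 1))))) (ket (m + eps i k))
      else if i = k then hscale (H_single n) (of_real (q ^ m k)) (ket m) else 0"
  have v: "?v m p = (if m \<in> V \<and> p = m + eps i k then of_real (amp q k i (Suc 0) m) else 0)" for m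
    by (auto simp: H_single_scale ket_apply amp_def)
  have "z_op q n k i \<psi> p = (\<Sum>\<^sub>\<infinity>m\<in>multi_indices n. \<psi> m * ?v m p)"
    by (simp add: z_op_def basis_op_def)
  also have "\<dots> = (\<Sum>\<^sub>\<infinity>m\<in>{p - eps i k}. \<psi> m * ?v m p)"
    unfolding v by (intro infsum_cong_neutral) (auto simp: fun_eq_iff V_indices_multi)
  also have "\<dots> = z_act q n k i \<psi> p"
  proof (cases "p - eps i k \<in> V \<and> p = p - eps i k + eps i k \<and> i \<le> k")
    case True
    then have "p \<in> V" "amp q k i 0 p = amp q k i (Suc 0) (p - eps i k)"
      using V_plus[of "p - eps i k" i] amp0_plus[of "p - eps i k" i] by auto
    then show ?thesis using True by (simp add: v z_act_apply)
  next
    case False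
    then have "p \<in> V \<Longrightarrow> amp q k i 0 p = 0" using amp0_nonzero[of p i] by (cases "i \<le> k") (auto simp: amp_above)
    moreover have "p - eps i k \<in> V \<and> p = p - eps i k + eps i k \<Longrightarrow> amp q k i (Suc 0) (p - eps i k) = 0"
      using False amp_above by auto
    ultimately show ?thesis by (auto simp: v z_act_apply)
  qed
  finally show "z_op q n k i \<psi> p = z_act q n k i \<psi> p" .
qed

lemma V_proj_eq: "V_proj n k \<psi> = V_act n k \<psi>"
proof
  fix p
  have "V_proj n k \<psi> p = (\<Sum>\<^sub>\<infinity>m\<in>{p}. \<psi> m * (if m \<in> V then ket m else 0) p)"
    unfolding V_proj_def basis_op_def by (intro infsum_cong_neutral) (auto simp: ket_apply V_indices_multi)
  then show "V_proj n k \<psi> p = V_act n k \<psi> p" by (simp add: V_act_apply ket_apply)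
qed

lemma z_hadjoint: "\<phi> \<in> ell n \<Longrightarrow> hadjoint (H_single n) (z_op q n k i) \<phi> = zs_act q n k i \<phi>"
  using bounded_op_closed[OF zs_bounded]
  by (intro Hs.hadjoint_eqI) (simp_all add: z_op_eq z_adjoint)

lemma gen_bounded: "bounded_op (H_single n) (gen_act q n k g)"
  by (cases g) (simp_all add: z_bounded zs_bounded)

lemma word_bounded: "bounded_op (H_single n) (word_act q n k w)"
proof (induction w)
  case (Cons g w)
  show ?case using Hs.bounded_op_comp[OF gen_bounded Cons.IH, of g] by (simp add: comp_def)
qed (simp add: V_act_bounded)

lemma free_bounded: "bounded_op (H_single n) (free_act q n k x)"
  unfolding free_act_def by (intro Hs.bounded_op_sum Hs.bounded_op_scaled word_bounded)

lemma word_op_eq: "\<psi> \<in> ell n \<Longrightarrow> word_op q n k w \<psi> = word_act q n k w \<psi>"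
proof (induction w)
  case (Cons g w)
  have "word_act q n k w \<psi> \<in> ell n" using Cons.prems by (rule bounded_op_closed[OF word_bounded])
  then show ?case using Cons by (cases g) (simp_all add: z_op_eq z_hadjoint)
qed (simp add: V_proj_eq)

lemma free_rep_eq: "\<psi> \<in> ell n \<Longrightarrow> free_rep q n k x \<psi> = free_act q n k x \<psi>"
  by (simp add: free_rep_def free_act_def word_op_eq)

lemma V_act_gen: "V_act n k (gen_act q n k g \<psi>) = gen_act q n k g \<psi>"
  by (cases g) (auto simp: V_act_apply z_act_apply zs_act_apply)

text \<open>
  The generators depend only on the part of a vector that is supported on the index set; together
  with \<open>V_act_gen\<close> this makes the components mutually orthogonal.
\<close>

lemma gen_V_act: "gen_act q n k g (V_act n k \<psi>) = gen_act q n k g \<psi>"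
proof (cases g)
  case (Z i)
  then show ?thesis using amp0_nonzero(2)[of _ i] by (auto simp: V_act_apply z_act_apply fun_eq_iff[of "z_act _ _ _ _ _"])
next
  case (Zs i)
  then show ?thesis using V_plus[of _ i] amp_above[of i] by (cases "i \<le> k") (auto simp: V_act_apply zs_act_apply fun_eq_iff[of "zs_act _ _ _ _ _"])
qed

lemma V_act_V_act: "V_act n k (V_act n k \<psi>) = V_act n k \<psi>"
  by (auto simp: V_act_apply)

lemma V_act_word: "V_act n k (word_act q n k w \<psi>) = word_act q n k w \<psi>"
  by (cases w) (simp_all add: V_act_V_act V_act_gen)

lemma word_V_act: "word_act q n k w (V_act n k \<psi>) = word_act q n k w \<psi>"
  by (induction w) (simp_all add: V_act_V_act)

lemma word_act_append: "word_act q n k (u @ v) \<psi> = word_act q n k u (word_act q n k v \<psi>)"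
  by (induction u) (simp_all add: V_act_word)

lemma free_act_mult: "free_act q n k (x * y) \<psi> = free_act q n k x (free_act q n k y \<psi>)"
proof (induction x rule: free_elem_induct)
  case (single u c)
  show ?case
  proof (induction y rule: free_elem_induct)
    case zero
    show ?case by (simp only: mult_zero_right free_act_zero free_act_linear)
  next
    case (single v d)
    have "letters (u + v) = letters u @ letters v" by (simp add: plus_word_def)
    then show ?case
      by (simp only: mult_single free_act_single word_act_linear word_act_append Hs.vs.scale_scale)
  next
    case (add x y)
    then show ?case by (simp only: distrib_left free_act_add free_act_linear)
  qed
qed (simp_all only: distrib_right free_act_add mult_zero_left free_act_zero)

lemma V_act_adjoint: "hinner (H_single n) (V_act n k \<phi>) \<psi> = hinner (H_single n) \<phi> (V_act n k \<psi>)"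
  unfolding V_act_def H_single_def by (rule pull_adjoint) (auto simp: bij_betw_def)

lemma gen_adjoint: "hinner (H_single n) (gen_act q n k g \<phi>) \<psi> = hinner (H_single n) \<phi> (gen_act q n k (gen_star g) \<psi>)"
proof (cases g)
  case (Z i)
  \<comment> \<open>both sides are the complex conjugate of the adjunction for the starred generator\<close>
  have cnj_inner: "hinner (H_single n) \<alpha> \<beta> = cnj (hinner (H_single n) \<beta> \<alpha>)" for \<alpha> \<beta>
    unfolding H_single_def ell2_inner infsum_cnj[symmetric] by (simp add: mult.commute)
  have "hinner (H_single n) (z_act q n k i \<phi>) \<psi> = cnj (hinner (H_single n) \<psi> (z_act q n k i \<phi>))"
    by (rule cnj_inner)
  also have "\<dots> = cnj (hinner (H_single n) (zs_act q n k i \<psi>) \<phi>)" by (simp only: z_adjoint)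
  also have "\<dots> = hinner (H_single n) \<phi> (zs_act q n k i \<psi>)" by (rule cnj_inner[symmetric])
  finally show ?thesis using Z by simp
qed (simp add: z_adjoint)

lemma word_adjoint: "hinner (H_single n) (word_act q n k w \<phi>) \<psi> =
    hinner (H_single n) \<phi> (word_act q n k (rev (map gen_star w)) \<psi>)"
proof (induction w arbitrary: \<psi>)
  case (Cons g w)
  show ?case by (simp add: gen_adjoint Cons.IH word_act_append gen_V_act)
qed (simp add: V_act_adjoint)

lemma free_act_adjoint:
  assumes "\<phi> \<in> ell n" "\<psi> \<in> ell n"
  shows "hinner (H_single n) (free_act q n k x \<phi>) \<psi> = hinner (H_single n) \<phi> (free_act q n k (free_star x) \<psi>)"
proof (induction x rule: free_elem_induct)
  case (single w c)
  show ?case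
    using assms bounded_op_closed[OF word_bounded]
    by (simp add: free_act_single free_star_single word_adjoint Hs.inner_scale Hs.inner_scale_left)
       (simp add: word_star_def)
next
  case (add x y)
  then show ?case
    using assms bounded_op_closed[OF free_bounded]
    by (simp only: free_act_add free_star_add Hs.inner_add Hs.inner_add_left)
qed (use assms in \<open>simp only: free_act_zero free_star_zero Hs.inner_zero_left Hs.inner_zero_right\<close>)

text \<open>
  Each relation can be verified either for itself or for its star, whichever is easier.
\<close>

lemma free_act_star_zero:
  assumes "\<And>\<psi>. \<psi> \<in> ell n \<Longrightarrow> free_act q n k (free_star x) \<psi> = 0" and "\<psi> \<in> ell n"
  shows "free_act q n k x \<psi> = 0"
proof (rule Hs.inner_eqI)
  show "free_act q n k x \<psi> \<in> ell n" using assms(2) by (rule bounded_op_closed[OF free_bounded])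
  fix \<phi> assume "\<phi> \<in> ell n"
  then show "hinner (H_single n) (free_act q n k x \<psi>) \<phi> = hinner (H_single n) 0 \<phi>"
    using assms by (simp add: free_act_adjoint)
qed simp

lemma free_act_gens:
  "free_act q n k (fz i) \<psi> = z_act q n k i \<psi>"
  "free_act q n k (fzs i) \<psi> = zs_act q n k i \<psi>"
  "free_act q n k (free_const c) \<psi> = hscale (H_single n) c (V_act n k \<psi>)"
  "free_act q n k 1 \<psi> = V_act n k \<psi>"
proof -
  show "free_act q n k (fz i) \<psi> = z_act q n k i \<psi>" "free_act q n k (fzs i) \<psi> = zs_act q n k i \<psi>"
    using gen_V_act[of "Z i" \<psi>] gen_V_act[of "Zs i" \<psi>] by (simp_all add: fz_def fzs_def free_act_single)
  show const: "free_act q n k (free_const c) \<psi> = hscale (H_single n) c (V_act n k \<psi>)" for c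
    by (simp add: free_const_def free_act_single zero_word_def)
  show "free_act q n k 1 \<psi> = V_act n k \<psi>" using const[of 1] by (simp add: free_const_one)
qed

lemma V_act_z: "V_act n k (z_act q n k i \<psi>) = z_act q n k i \<psi>" "V_act n k (zs_act q n k i \<psi>) = zs_act q n k i \<psi>"
  using V_act_gen[of "Z i" \<psi>] V_act_gen[of "Zs i" \<psi>] by simp_all

lemma z_zs: "z_act q n k i (zs_act q n k i \<psi>) p = (if p \<in> V then of_real ((amp q k i 0 p)\<^sup>2) * \<psi> p else 0)"
  by (cases "p \<in> V"; cases "amp q k i 0 p = 0")
     (simp_all add: z_act_apply zs_act_apply amp0_nonzero amp0_minus power2_eq_square)

lemma zs_z: "zs_act q n k i (z_act q n k i \<psi>) p = (if p \<in> V then of_real ((amp q k i (Suc 0) p)\<^sup>2) * \<psi> p else 0)"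
proof -
  have "p + eps i k - eps i k = p" by (simp add: fun_eq_iff)
  then show ?thesis
    using V_plus[of p i] amp0_plus[of p i] amp_above[of i "Suc 0" p]
    by (cases "i \<le> k") (auto simp: z_act_apply zs_act_apply power2_eq_square)
qed

lemma amp_sq:
  assumes "p \<in> V" "i < k"
  shows "(amp q k i r p)\<^sup>2 = q ^ (2 * p i) - q ^ (2 * (p (i + 1) + r))"
proof -
  have "p i \<le> p (i + 1)" using V_mono[OF assms(1), of i "i + 1"] assms by simp
  then have e: "2 * p i + 2 * (p (i + 1) - p i + r) = 2 * (p (i + 1) + r)" by simp
  have "(amp q k i r p)\<^sup>2 = q ^ (2 * p i) * (1 - q ^ (2 * (p (i + 1) - p i + r)))"
    using assms power_q_le_1 by (simp add: amp_def power_mult_distrib power_mult[symmetric] mult.commute)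
  also have "\<dots> = q ^ (2 * p i) - q ^ (2 * p i + 2 * (p (i + 1) - p i + r))"
    by (simp add: right_diff_distrib power_add)
  finally show ?thesis unfolding e .
qed

text \<open>
  By \<open>amp_sq\<close> the sum telescopes; its last term, for \<open>j = k\<close>, is not a difference.
\<close>

lemma amp_sq_sum:
  assumes p: "p \<in> V"
  shows "(\<Sum>j\<in>{l..n}. (amp q k j 0 p)\<^sup>2) = (if l \<le> k then q ^ (2 * p l) else 0)"
proof (cases "l \<le> k")
  case True
  have "(\<Sum>j\<in>{l..n}. (amp q k j 0 p)\<^sup>2) = (\<Sum>j\<in>{l..k}. (amp q k j 0 p)\<^sup>2)"
    using k by (intro sum.mono_neutral_right) (auto simp: amp_above)
  also have "{l..k} = insert k {l..<k}" using True by auto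
  also have "(\<Sum>j\<in>insert k {l..<k}. (amp q k j 0 p)\<^sup>2) = q ^ (2 * p k) + (\<Sum>j\<in>{l..<k}. (q ^ (2 * p j) - q ^ (2 * p (Suc j))))"
    using amp_sq[OF p, of _ 0] by (simp add: amp_def[of q k k] power_mult[symmetric] mult.commute)
  also have "(\<Sum>j\<in>{l..<k}. q ^ (2 * p j) - q ^ (2 * p (Suc j))) = q ^ (2 * p l) - q ^ (2 * p k)"
    using sum_Suc_diff'[OF True, of "\<lambda>j. - (q ^ (2 * p j))"] by simp
  finally show ?thesis using True by simp
qed (simp add: amp_above)

lemma z_zs_sum:
  "(\<Sum>j\<in>{l..n}. z_act q n k j (zs_act q n k j \<psi>)) p = (if p \<in> V \<and> l \<le> k then of_real (q ^ (2 * p l)) * \<psi> p else 0)"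
proof -
  have "(\<Sum>j\<in>{l..n}. z_act q n k j (zs_act q n k j \<psi>)) p = (\<Sum>j\<in>{l..n}. z_act q n k j (zs_act q n k j \<psi>) p)"
    by (rule sum_fun_apply)
  also have "\<dots> = (if p \<in> V then of_real (\<Sum>j\<in>{l..n}. (amp q k j 0 p)\<^sup>2) * \<psi> p else 0)"
    by (simp add: z_zs sum_distrib_right)
  also have "\<dots> = (if p \<in> V \<and> l \<le> k then of_real (q ^ (2 * p l)) * \<psi> p else 0)"
    by (simp add: amp_sq_sum)
  finally show ?thesis .
qed

text \<open>
  The starred form of the relation between \<open>z\<^sub>i\<close> and \<open>z\<^sub>j\<close>. Adjoints shift indices upwards and never leave the index set, so
  the unstarred relation, where amplitudes may vanish, needs no separate treatment.
\<close>

lemma zs_zs_commute: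
  assumes "i < j"
  shows "zs_act q n k i (zs_act q n k j \<psi>) p = of_real q * zs_act q n k j (zs_act q n k i \<psi>) p"
proof (cases "j \<le> k \<and> p \<in> V")
  case True
  have "p + eps i k + eps j k = p + eps j k + eps i k" by (simp add: add_ac)
  then show ?thesis
    using True assms V_plus[of p i] V_plus[of p j]
    by (simp add: zs_act_apply amp_plus_upper[OF assms] amp_plus_lower[OF assms])
qed (auto simp: zs_act_apply amp_above)

lemma zs_z_commute:
  assumes "i < j"
  shows "zs_act q n k i (z_act q n k j \<psi>) p = of_real q * z_act q n k j (zs_act q n k i \<psi>) p"
proof (cases "j \<le> k \<and> p \<in> V \<and> amp q k j 0 p \<noteq> 0")
  case True
  then have p: "p \<in> V" "amp q k j 0 p \<noteq> 0" by auto
  define p' where "p' = p - eps j k"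
  have p': "p' \<in> V" "p = p' + eps j k" using amp0_nonzero[OF p] by (auto simp: p'_def)
  have e: "p' + eps j k + eps i k - eps j k = p' + eps i k" by (auto simp: fun_eq_iff)
  show ?thesis
    using True assms V_plus[of p i] p' e amp_plus_upper[OF assms, of "Suc 0" p'] amp_plus_lower[OF assms, of 0 p]
    by (simp add: zs_act_apply z_act_apply p'_def[symmetric])
next
  case False
  then show ?thesis
    using amp_plus_lower[OF assms, of 0 p] V_plus[of p i] assms
    by (cases "p \<in> V") (auto simp: zs_act_apply z_act_apply amp_above)
qed

lemmas free_act_rules = free_act_diff free_act_mult free_act_gens free_act_sum V_act_z

lemma sphere_relation_zero:
  assumes x: "x \<in> sphere_relations q n" and \<psi>: "\<psi> \<in> ell n"
  shows "free_act q n k x \<psi> = 0"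
proof -
  let ?c = "complex_of_real q"
  have mixed_zero: "free_act q n k (fzs i * fz j - free_const ?c * fz j * fzs i) \<psi> = 0" if "i < j" for i j \<psi>
    by (rule ext) (simp add: free_act_rules zs_z_commute[OF that] H_single_scale)
  consider (comm) i j where "i < j" "x = fz i * fz j - free_const (inverse ?c) * fz j * fz i"
    | (mixed) i j where "i \<noteq> j" "x = fzs i * fz j - free_const ?c * fz j * fzs i"
    | (bracket) i where "i < n" "x = fzs i * fz i - fz i * fzs i - free_const (1 - ?c\<^sup>2) * (\<Sum>j\<in>{i+1..n}. fz j * fzs j)"
    | (last) "x = fzs n * fz n - fz n * fzs n"
    | (unit) "x = (\<Sum>i\<in>{0..n}. fz i * fzs i) - 1"
    using x unfolding sphere_relations_def by blast
  then show ?thesis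
  proof cases
    case comm
    show ?thesis
    proof (rule free_act_star_zero[OF _ \<psi>])
      fix \<psi> assume "\<psi> \<in> ell n"
      have "free_star x = fzs j * fzs i - fzs i * fzs j * free_const (inverse ?c)"
        by (simp add: comm free_star_diff free_star_mult free_star_const mult.assoc)
      also have "\<dots> = fzs j * fzs i - free_const (inverse ?c) * (fzs i * fzs j)"
        by (simp only: free_const_central[symmetric])
      finally have star: "free_star x = fzs j * fzs i - free_const (inverse ?c) * (fzs i * fzs j)" .
      show "free_act q n k (free_star x) \<psi> = 0"
        unfolding star using q by (intro ext) (simp add: free_act_rules zs_zs_commute[OF comm(1)] H_single_scale)
    qed
  next
    case mixed
    show ?thesis
    proof (cases "i < j")
      case True
      then show ?thesis using mixed mixed_zero by simp
    next
      case False
      show ?thesis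
      proof (rule free_act_star_zero[OF _ \<psi>])
        fix \<psi> assume "\<psi> \<in> ell n"
        have "free_star x = fzs j * fz i - fz i * fzs j * free_const ?c"
          by (simp add: mixed free_star_diff free_star_mult free_star_const mult.assoc)
        also have "\<dots> = fzs j * fz i - free_const ?c * fz i * fzs j"
          by (simp only: free_const_central[symmetric] mult.assoc)
        finally show "free_act q n k (free_star x) \<psi> = 0"
          using False mixed(1) mixed_zero by simp
      qed
    qed
  next
    case bracket
    have "(amp q k i (Suc 0) p)\<^sup>2 - (amp q k i 0 p)\<^sup>2 = (1 - q\<^sup>2) * (if i + 1 \<le> k then q ^ (2 * p (i + 1)) else 0)"
      if "p \<in> V" for p
    proof (cases "i < k")
      case True
      then show ?thesis unfolding amp_sq[OF that True] by (simp add: power_add algebra_simps power2_eq_square)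
    qed (auto simp: amp_def)
    then have amp: "of_real ((amp q k i (Suc 0) p)\<^sup>2) - of_real ((amp q k i 0 p)\<^sup>2) =
        (1 - ?c\<^sup>2) * of_real (if i + 1 \<le> k then q ^ (2 * p (i + 1)) else 0)" if "p \<in> V" for p
      using that by (metis (no_types, lifting) of_real_1 of_real_diff of_real_mult of_real_power)
    show ?thesis
    proof
      fix p
      show "free_act q n k x \<psi> p = 0 p"
      proof (cases "p \<in> V")
        case True
        have "free_act q n k x \<psi> p = of_real ((amp q k i (Suc 0) p)\<^sup>2) * \<psi> p - of_real ((amp q k i 0 p)\<^sup>2) * \<psi> p
            - (1 - ?c\<^sup>2) * (of_real (if i + 1 \<le> k then q ^ (2 * p (i + 1)) else 0) * \<psi> p)"
          using True by (simp add: bracket free_act_rules z_zs zs_z H_single_scale V_act_apply z_zs_sum del: of_real_power)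
        also have "\<dots> = (of_real ((amp q k i (Suc 0) p)\<^sup>2) - of_real ((amp q k i 0 p)\<^sup>2)
            - (1 - ?c\<^sup>2) * of_real (if i + 1 \<le> k then q ^ (2 * p (i + 1)) else 0)) * \<psi> p"
          by (simp only: left_diff_distrib mult.assoc)
        finally show ?thesis using amp[OF True] by simp
      qed (simp add: bracket free_act_rules z_zs zs_z H_single_scale V_act_apply z_zs_sum)
    qed
  next
    case last
    have "amp q k n (Suc 0) p = amp q k n 0 p" for p using k by (auto simp: amp_def)
    then show ?thesis by (intro ext) (simp add: last free_act_rules z_zs zs_z)
  next
    case unit
    show ?thesis
    proof
      fix p
      have "p 0 = 0" if "p \<in> V" using that by (simp add: V_indices_def multi_indices_def)
      then show "free_act q n k x \<psi> p = 0 p"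
        by (simp add: unit free_act_rules z_zs_sum V_act_apply)
    qed
  qed
qed

text \<open>
  The elements that act as zero form an ideal closed under the star, and this ideal contains the relations.
\<close>

lemma sphere_ideal_zero:
  assumes "x \<in> sphere_ideal q n" "\<psi> \<in> ell n" shows "free_act q n k x \<psi> = 0"
proof -
  let ?K = "{x \<in> free_carrier n. \<forall>\<psi>\<in>ell n. free_act q n k x \<psi> = 0}"
  have "sphere_ideal q n \<subseteq> ?K"
  proof (rule sphere_ideal_minimal)
    show "ideal ?K (free_alg n)"
      by (rule free_ideal_intro)
         (auto simp: free_act_add free_act_uminus free_act_mult free_act_linear bounded_op_closed[OF free_bounded])
    show "x \<in> ?K" if "x \<in> sphere_relations q n" for x
      using that sphere_relations_carrier[of q n] sphere_relation_zero by auto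
    show "free_star x \<in> ?K" if "x \<in> ?K" for x
      using that free_act_star_zero[of "free_star x"] by auto
  qed
  then show ?thesis using assms by auto
qed

lemma sphere_rep_class:
  assumes "\<psi> \<in> ell n"
  shows "sphere_rep q n k (sphere_class q n x) \<psi> = free_act q n k x \<psi>"
proof -
  define y where "y = (SOME y. y \<in> sphere_class q n x)"
  have "x \<in> sphere_class q n x" by (simp add: sphere_class_iff sphere_ideal_closed)
  then have "y \<in> sphere_class q n x" unfolding y_def by (rule someI)
  then have "free_act q n k (y - x) \<psi> = 0"
    using assms by (intro sphere_ideal_zero) (auto simp: sphere_class_iff)
  then show ?thesis using assms by (simp add: sphere_rep_def y_def[symmetric] free_rep_eq free_act_diff)
qed

end

section \<open>The even and odd representations\<close>

subsection \<open>Orthogonality of the components\<close>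

text \<open>
  The entries at \<open>k + 1\<close> and \<open>k + 2\<close> would have to be in both orders.
\<close>

lemma V_indices_disjoint:
  assumes "p \<in> V_indices n k" "p \<in> V_indices n k'" "k + 2 \<le> k'" "k' \<le> n" shows False
proof -
  have "p (k + 1) \<le> p (k + 2)" using assms by (auto simp: V_indices_def dest!: spec[of _ "k + 1"])
  moreover have "p (k + 1) > p (k + 2)" using assms by (auto simp: V_indices_def dest!: spec[of _ "k + 1"])
  ultimately show False by simp
qed

text \<open>
  Increasing up to \<open>k\<close> and strictly decreasing after \<open>k\<close> leaves the step from \<open>k\<close> to \<open>k + 1\<close> free; its direction decides
  whether the maximal entry is at \<open>r = k\<close> or at \<open>r = k + 1\<close>. As \<open>n \<ge> 1\<close>, this also works at the ends \<open>k = 0\<close> and \<open>k = n\<close>.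
  The index set with the next index then contains \<open>p\<close> as well, and all others are excluded by disjointness.
\<close>

lemma V_indices_peak:
  assumes p: "p \<in> V_indices n k" "k \<le> n" and n: "n \<ge> 1"
  obtains r where "1 \<le> r" "r \<le> n" "\<And>k. k \<le> n \<Longrightarrow> p \<in> V_indices n k \<longleftrightarrow> k = r - 1 \<or> k = r"
proof -
  have "\<exists>r. 1 \<le> r \<and> r \<le> n \<and> p \<in> V_indices n (r - 1) \<and> p \<in> V_indices n r"
  proof (cases "k \<ge> 1 \<and> (k = n \<or> p k > p (k + 1))")
    case True
    have "p \<in> V_indices n (k - 1)"
      unfolding V_indices_def
    proof (intro CollectI conjI allI impI)
      show "p \<in> multi_indices n" using p by (simp add: V_indices_def)
      show "p i \<le> p (i + 1)" if "1 \<le> i \<and> i < k - 1" for i using p that by (auto simp: V_indices_def)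
      show "p (i + 1) < p i" if "k - 1 < i \<and> i < n" for i
        using p that True by (cases "i = k") (auto simp: V_indices_def)
    qed
    then show ?thesis using True p by (intro exI[of _ k]) auto
  next
    case False
    then have *: "k < n" "k = 0 \<or> p k \<le> p (k + 1)" using p n by auto
    have "p \<in> V_indices n (k + 1)"
      unfolding V_indices_def
    proof (intro CollectI conjI allI impI)
      show "p \<in> multi_indices n" using p by (simp add: V_indices_def)
      show "p i \<le> p (i + 1)" if "1 \<le> i \<and> i < k + 1" for i
        using p that * by (cases "i = k") (auto simp: V_indices_def)
      show "p (i + 1) < p i" if "k + 1 < i \<and> i < n" for i using p that by (auto simp: V_indices_def)
    qed
    then show ?thesis using * p by (intro exI[of _ "k + 1"]) auto
  qed
  then obtain r where r: "1 \<le> r" "r \<le> n" "p \<in> V_indices n (r - 1)" "p \<in> V_indices n r" by blast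
  have "k = r - 1 \<or> k = r" if "k \<le> n" "p \<in> V_indices n k" for k
  proof (rule ccontr)
    assume "\<not> ?thesis"
    then have "k + 2 \<le> r \<or> r - 1 + 2 \<le> k" using r(1) by arith
    then show False using V_indices_disjoint[of p n k r] V_indices_disjoint[of p n "r - 1" k] r that by auto
  qed
  then show ?thesis using that[of r] r by blast
qed

definition evens :: "nat \<Rightarrow> nat set" where "evens n = {k. k \<le> n \<and> even k}"
definition odds :: "nat \<Rightarrow> nat set" where "odds n = {k. k \<le> n \<and> odd k}"

definition sum_act :: "real \<Rightarrow> nat \<Rightarrow> nat set \<Rightarrow> free_elem \<Rightarrow> vec \<Rightarrow> vec" where
  "sum_act q n K x \<psi> = (\<Sum>k\<in>K. free_act q n k x \<psi>)"

lemma sum_act_linear: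
  "sum_act q n K x (\<phi> + \<psi>) = sum_act q n K x \<phi> + sum_act q n K x \<psi>"
  "sum_act q n K x (hscale (H_single n) c \<psi>) = hscale (H_single n) c (sum_act q n K x \<psi>)"
  "sum_act q n K x 0 = 0"
  by (simp_all only: sum_act_def free_act_linear sum.distrib Hs.vs.scale_sum_right sum.neutral_const)

lemma sum_act_diff: "sum_act q n K x (\<phi> - \<psi>) = sum_act q n K x \<phi> - sum_act q n K x \<psi>"
  using sum_act_linear(1)[of q n K x "\<phi> - \<psi>" \<psi>] by (simp only: diff_add_cancel add_diff_cancel_right')

lemma sum_act_add: "sum_act q n K (x + y) \<psi> = sum_act q n K x \<psi> + sum_act q n K y \<psi>"
  by (simp only: sum_act_def free_act_add sum.distrib)

lemma sum_act_zero: "sum_act q n K 0 \<psi> = 0"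
  by (simp only: sum_act_def free_act_zero sum.neutral_const)

context sphere_component
begin

lemma free_V_act: "free_act q n k x (V_act n k \<psi>) = free_act q n k x \<psi>"
  by (simp only: free_act_def word_V_act)

lemma V_act_free: "V_act n k (free_act q n k x \<psi>) = free_act q n k x \<psi>"
proof -
  have "V_act n k (free_act q n k x \<psi>) = free_act q n k 1 (free_act q n k x \<psi>)" by (simp only: free_act_gens)
  then show ?thesis by (simp only: free_act_mult[symmetric] mult_1_left)
qed

lemma free_act_scale: "free_act q n k (free_const c * x) \<psi> = hscale (H_single n) c (free_act q n k x \<psi>)"
  by (simp only: free_act_mult free_act_gens V_act_free)

lemma free_act_support: "p \<notin> V_indices n k \<Longrightarrow> free_act q n k x \<psi> p = 0"
  using arg_cong[OF V_act_free[of x \<psi>], of "\<lambda>f. f p"] by (simp add: V_act_apply)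

end

locale orthogonal_components =
  fixes q :: real and n :: nat and K :: "nat set"
  assumes q01: "0 < q" "q < 1" and K: "K = evens n \<or> K = odds n"
begin

lemma finite_K: "finite K"
  using K by (auto simp: evens_def odds_def)

lemma component: "k \<in> K \<Longrightarrow> sphere_component q n k"
  using K q01 by (auto simp: evens_def odds_def sphere_component_def)

text \<open>
  Indices of equal parity differ by at least two, so the image of one component is invisible to the other.
\<close>

lemma free_act_orthogonal:
  assumes "k \<in> K" "k' \<in> K" "k \<noteq> k'"
  shows "free_act q n k x (free_act q n k' y \<psi>) = 0"
proof -
  interpret A: sphere_component q n k by (rule component) fact
  interpret B: sphere_component q n k' by (rule component) fact
  have "k + 2 \<le> k' \<or> k' + 2 \<le> k"
  proof -
    have "even k = even k'" using assms K by (auto simp: evens_def odds_def)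
    then have "k \<noteq> k' + 1" "k' \<noteq> k + 1" by auto
    then show ?thesis using assms(3) by arith
  qed
  then have disj: "p \<notin> V_indices n k" if "p \<in> V_indices n k'" for p
    using V_indices_disjoint[of p n k k'] V_indices_disjoint[of p n k' k] that A.k B.k by blast
  have "V_act n k (free_act q n k' y \<psi>) = 0"
    using disj B.free_act_support by (auto simp: V_act_apply fun_eq_iff)
  then show ?thesis using A.free_V_act[of x "free_act q n k' y \<psi>"] by (simp only: free_act_linear)
qed

lemma sum_act_mult: "sum_act q n K (x * y) \<psi> = sum_act q n K x (sum_act q n K y \<psi>)"
proof -
  have lin: "free_act q n k x (sum f A) = (\<Sum>i\<in>A. free_act q n k x (f i))" for k f and A :: "nat set"
  proof (induction A rule: infinite_finite_induct)
    case (insert a A)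
    show ?case by (simp only: sum.insert[OF insert.hyps(1,2)] free_act_linear insert.IH)
  next
    case empty
    show ?case by (simp only: sum.empty free_act_linear)
  next
    case (infinite A)
    show ?case by (simp only: sum.infinite[OF infinite.hyps] free_act_linear)
  qed
  have "sum_act q n K x (sum_act q n K y \<psi>) = (\<Sum>k\<in>K. \<Sum>k'\<in>K. free_act q n k x (free_act q n k' y \<psi>))"
    by (simp only: sum_act_def lin)
  also have "\<dots> = (\<Sum>k\<in>K. free_act q n k (x * y) \<psi>)"
  proof (rule sum.cong[OF refl])
    fix k assume kK: "k \<in> K"
    then interpret sphere_component q n k by (rule component)
    have "(\<Sum>k'\<in>K. free_act q n k x (free_act q n k' y \<psi>)) = (\<Sum>k'\<in>{k}. free_act q n k x (free_act q n k' y \<psi>))"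
      using kK finite_K free_act_orthogonal by (intro sum.mono_neutral_right) auto
    then show "(\<Sum>k'\<in>K. free_act q n k x (free_act q n k' y \<psi>)) = free_act q n k (x * y) \<psi>"
      by (simp add: free_act_mult)
  qed
  finally show ?thesis by (simp only: sum_act_def)
qed

lemma sum_act_scale: "sum_act q n K (free_const c * x) \<psi> = hscale (H_single n) c (sum_act q n K x \<psi>)"
  unfolding sum_act_def Hs.vs.scale_sum_right
  by (intro sum.cong refl sphere_component.free_act_scale component)

lemma sum_act_bounded: "bounded_op (H_single n) (sum_act q n K x)"
  unfolding sum_act_def by (intro Hs.bounded_op_sum sphere_component.free_bounded component)

lemma sum_act_closed: "\<psi> \<in> ell n \<Longrightarrow> sum_act q n K x \<psi> \<in> ell n"
  by (rule bounded_op_closed[OF sum_act_bounded])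

lemma sum_act_adjoint:
  assumes "\<phi> \<in> ell n" "\<psi> \<in> ell n"
  shows "hinner (H_single n) (sum_act q n K (free_star x) \<phi>) \<psi> = hinner (H_single n) \<phi> (sum_act q n K x \<psi>)"
proof -
  have C: "free_act q n k y \<xi> \<in> ell n" if "k \<in> K" "\<xi> \<in> ell n" for k y \<xi>
    by (rule bounded_op_closed[OF sphere_component.free_bounded[OF component]]) (use that in auto)
  have "hinner (H_single n) (sum_act q n K (free_star x) \<phi>) \<psi> =
      (\<Sum>k\<in>K. hinner (H_single n) (free_act q n k (free_star x) \<phi>) \<psi>)"
    unfolding sum_act_def using assms C by (intro Hs.inner_sum_left) auto
  also have "\<dots> = (\<Sum>k\<in>K. hinner (H_single n) \<phi> (free_act q n k x \<psi>))"
    using assms sphere_component.free_act_adjoint[OF component, of _ \<phi> \<psi> "free_star x"] by (intro sum.cong) auto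
  also have "\<dots> = hinner (H_single n) \<phi> (sum_act q n K x \<psi>)"
    unfolding sum_act_def using assms C by (intro Hs.inner_sum[symmetric]) auto
  finally show ?thesis .
qed

end

lemma pi_class:
  assumes q: "0 < q" "q < 1" and "\<psi> \<in> ell n"
  shows "pi_plus q n (sphere_class q n x) \<psi> = sum_act q n (evens n) x \<psi>"
    "pi_minus q n (sphere_class q n x) \<psi> = sum_act q n (odds n) x \<psi>"
  unfolding pi_plus_def pi_minus_def sum_act_def evens_def odds_def
  using assms by (auto intro!: sum.cong sphere_component.sphere_rep_class simp: sphere_component_def)

lemma orthogonal_evens: "0 < q \<Longrightarrow> q < 1 \<Longrightarrow> orthogonal_components q n (evens n)"
  and orthogonal_odds: "0 < q \<Longrightarrow> q < 1 \<Longrightarrow> orthogonal_components q n (odds n)"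
  by (simp_all add: orthogonal_components_def)

lemma pi_star_representation:
  assumes q: "0 < q" "q < 1"
  shows "star_representation (projective_alg q n) (H_total n) (pi_total q n)"
proof -
  interpret E: orthogonal_components q n "evens n" by (rule orthogonal_evens[OF q])
  interpret O: orthogonal_components q n "odds n" by (rule orthogonal_odds[OF q])
  have ops: "a \<oplus>\<^bsub>projective_alg q n\<^esub> b = a \<oplus>\<^bsub>sphere_alg q n\<^esub> b" "a \<otimes>\<^bsub>projective_alg q n\<^esub> b = a \<otimes>\<^bsub>sphere_alg q n\<^esub> b"
    "c \<odot>\<^bsub>projective_alg q n\<^esub> a = c \<odot>\<^bsub>sphere_alg q n\<^esub> a" "star (projective_alg q n) a = star (sphere_alg q n) a" for a b c
    by (simp_all add: projective_alg_def)
  have rep: "\<exists>x\<in>free_carrier n. a = sphere_class q n x" if "a \<in> carrier (projective_alg q n)" for a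
    using that projective_alg_carrier_sub[of q n] by (auto simp: sphere_alg_carrier)
  have pi: "pi_total q n (sphere_class q n x) (\<phi>, \<psi>) = (sum_act q n (evens n) x \<phi>, sum_act q n (odds n) x \<psi>)"
    if "\<phi> \<in> ell n" "\<psi> \<in> ell n" for x \<phi> \<psi>
    using that by (simp add: pi_total_def pi_class q)
  have bd: "bounded_op (H_total n) (pi_total q n (sphere_class q n x))" for x
  proof (rule Ht.bounded_op_cong')
    show "bounded_op (H_total n) (\<lambda>(\<phi>, \<psi>). (sum_act q n (evens n) x \<phi> + 0, 0 + sum_act q n (odds n) x \<psi>))"
      unfolding H_total_def
      by (rule Hs.bounded_op_block[OF E.sum_act_bounded Hs.bounded_op_zero Hs.bounded_op_zero O.sum_act_bounded])
  qed (auto simp: pi H_total_simps)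
  show ?thesis
    unfolding star_representation_def
  proof (intro conjI ballI allI)
    fix a z assume "a \<in> carrier (projective_alg q n)" and z: "z \<in> hcarrier (H_total n)"
    then obtain x where x: "x \<in> free_carrier n" "a = sphere_class q n x" using rep by blast
    obtain \<phi> \<psi> where [simp]: "z = (\<phi>, \<psi>)" by (cases z)
    have C: "\<phi> \<in> ell n" "\<psi> \<in> ell n" using z by (simp_all add: H_total_simps)
    show "pi_total q n (c \<odot>\<^bsub>projective_alg q n\<^esub> a) z = hscale (H_total n) c (pi_total q n a z)" for c
      using x C by (simp add: ops sphere_class_ops pi E.sum_act_scale O.sum_act_scale H_total_simps)
    show "pi_total q n (star (projective_alg q n) a) z = hadjoint (H_total n) (pi_total q n a) z"
    proof (rule Ht.hadjoint_eqI[symmetric])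
      show "pi_total q n (star (projective_alg q n) a) z \<in> hcarrier (H_total n)"
        using x z bounded_op_closed[OF bd] by (simp add: ops sphere_class_ops)
      fix w assume w: "w \<in> hcarrier (H_total n)"
      obtain \<phi>' \<psi>' where [simp]: "w = (\<phi>', \<psi>')" by (cases w)
      have C': "\<phi>' \<in> ell n" "\<psi>' \<in> ell n" using w by (simp_all add: H_total_simps)
      show "hinner (H_total n) (pi_total q n (star (projective_alg q n) a) z) w = hinner (H_total n) z (pi_total q n a w)"
        using x C C' by (simp add: ops sphere_class_ops pi H_total_simps E.sum_act_adjoint O.sum_act_adjoint)
    qed
    fix b assume "b \<in> carrier (projective_alg q n)"
    then obtain y where y: "y \<in> free_carrier n" "b = sphere_class q n y" using rep by blast
    show "pi_total q n (a \<oplus>\<^bsub>projective_alg q n\<^esub> b) z = pi_total q n a z + pi_total q n b z"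
      using x y C by (simp add: ops sphere_class_ops pi sum_act_add)
    show "pi_total q n (a \<otimes>\<^bsub>projective_alg q n\<^esub> b) z = pi_total q n a (pi_total q n b z)"
      using x y C by (simp add: ops sphere_class_ops pi E.sum_act_mult O.sum_act_mult E.sum_act_closed O.sum_act_closed)
  next
    fix a assume "a \<in> carrier (projective_alg q n)"
    then show "bounded_op (H_total n) (pi_total q n a)" using rep bd by blast
  qed
qed

subsection \<open>Commutators with the generators\<close>

text \<open>
  The matrix coefficients of \<open>z\<^sub>i\<^sup>* z\<^sub>j\<close> in the \<open>k\<close>-th component. The index that goes with a nonzero
  coefficient, \<open>proj_shift i j p\<close>, does not depend on \<open>k\<close>; this is what makes different components comparable.
\<close>

definition proj_coeff :: "real \<Rightarrow> nat \<Rightarrow> nat \<Rightarrow> nat \<Rightarrow> (nat \<Rightarrow> nat) \<Rightarrow> real" where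
  "proj_coeff q k i j p = amp q k i (Suc 0) p * amp q k j 0 (p + eps i k)"

definition proj_shift :: "nat \<Rightarrow> nat \<Rightarrow> (nat \<Rightarrow> nat) \<Rightarrow> (nat \<Rightarrow> nat)" where
  "proj_shift i j p = p + eps i j - eps j i"

lemma level_eps: "i \<le> k \<Longrightarrow> k \<le> n \<Longrightarrow> level n (p + eps i k) + i = level n p + k"
proof -
  assume "i \<le> k" "k \<le> n"
  have "(\<Sum>l\<in>{1..n}. eps i k l) = card {l \<in> {1..n}. i < l \<and> l \<le> k}"
    by (simp add: eps_def sum.If_cases Int_def)
  also have "{l \<in> {1..n}. i < l \<and> l \<le> k} = {i<..k}" using \<open>k \<le> n\<close> by auto
  finally have "(\<Sum>l\<in>{1..n}. eps i k l) = k - i" by simp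
  then have "level n (p + eps i k) = level n p + (k - i)"
    by (simp add: level_def sum.distrib)
  then show ?thesis using \<open>i \<le> k\<close> by simp
qed

context sphere_component
begin

lemma proj_coeff_nonzero:
  assumes p: "p \<in> V" and nz: "proj_coeff q k i j p \<noteq> 0"
  shows "i \<le> k" "j \<le> k" "proj_shift i j p \<in> V" "proj_shift i j p + eps j k = p + eps i k"
    "p + eps i k - eps j k = proj_shift i j p"
proof -
  have i: "i \<le> k" using nz amp_above[of i] by (cases "i \<le> k") (auto simp: proj_coeff_def)
  have p1: "p + eps i k \<in> V" using V_plus[OF p i] .
  have nz': "amp q k j 0 (p + eps i k) \<noteq> 0" using nz by (auto simp: proj_coeff_def)
  note a = amp0_nonzero[OF p1 nz']
  have eq: "p + eps i k - eps j k = proj_shift i j p"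
    using i a(1) by (auto simp: proj_shift_def eps_def fun_eq_iff)
  show "i \<le> k" "j \<le> k" "p + eps i k - eps j k = proj_shift i j p" by fact+
  show "proj_shift i j p \<in> V" "proj_shift i j p + eps j k = p + eps i k" using a eq by simp_all
qed

lemma proj_act:
  "free_act q n k (fzs i * fz j) \<psi> p = (if p \<in> V then of_real (proj_coeff q k i j p) * \<psi> (proj_shift i j p) else 0)"
proof (cases "p \<in> V \<and> i \<le> k")
  case True
  then show ?thesis
    using V_plus[of p i] proj_coeff_nonzero(5)[of p i j]
    by (cases "proj_coeff q k i j p = 0")
       (auto simp: free_act_mult free_act_gens zs_act_apply z_act_apply proj_coeff_def)
qed (auto simp: free_act_mult free_act_gens zs_act_apply z_act_apply proj_coeff_def amp_above)

lemma proj_shift_level: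
  assumes "p \<in> V" "proj_coeff q k i j p \<noteq> 0"
  shows "level n (proj_shift i j p) + i = level n p + j"
  using level_eps[of i k n p] level_eps[of j k n "proj_shift i j p"] proj_coeff_nonzero[OF assms] k by simp

lemma proj_shift_inverse:
  assumes "p \<in> V" "proj_coeff q k i j p \<noteq> 0"
  shows "proj_shift i j p + eps j i = p + eps i j"
proof
  fix l
  have "proj_shift i j p l + eps j k l = p l + eps i k l"
    using proj_coeff_nonzero(4)[OF assms] by (metis plus_fun_apply)
  then show "(proj_shift i j p + eps j i) l = (p + eps i j) l"
    using proj_coeff_nonzero(1,2)[OF assms] by (auto simp: eps_def split: if_splits)
qed

text \<open>
  The operator shifts the level by the constant \<open>i - j\<close>, so its commutator with the level is a multiple
  of itself.
\<close>

lemma proj_act_level: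
  "level_mult n (free_act q n k (fzs i * fz j) \<psi>) =
     free_act q n k (fzs i * fz j) (level_mult n \<psi>)
     + hscale (H_single n) (of_int (int i - int j)) (free_act q n k (fzs i * fz j) \<psi>)"
proof
  fix p
  show "level_mult n (free_act q n k (fzs i * fz j) \<psi>) p =
     (free_act q n k (fzs i * fz j) (level_mult n \<psi>)
     + hscale (H_single n) (of_int (int i - int j)) (free_act q n k (fzs i * fz j) \<psi>)) p"
  proof (cases "p \<in> V \<and> proj_coeff q k i j p \<noteq> 0")
    case True
    then have "level n (proj_shift i j p) + i = level n p + j" using proj_shift_level by blast
    then have "of_nat (level n (proj_shift i j p)) + of_nat i = (of_nat (level n p) + of_nat j :: complex)"
      by (metis of_nat_add)
    then have e: "of_nat (level n p) = (of_nat (level n (proj_shift i j p)) + (of_nat i - of_nat j) :: complex)"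
      by (simp add: algebra_simps)
    show ?thesis
      using True by (simp add: level_mult_def proj_act H_single_scale e distrib_right distrib_left mult_ac)
  qed (auto simp: level_mult_def proj_act H_single_scale)
qed

end

text \<open>
  Passing from component \<open>M\<close> to \<open>M + 1\<close> changes the amplitude only for \<open>j = M\<close>, by a factor \<open>sqrt (1 - t)\<close> with
  \<open>t = q ^ (2 * (P (M + 1) - P M + r))\<close>. The elementary bound \<open>1 - sqrt (1 - t) \<le> t\<close> turns the prefactor \<open>q ^ P M\<close> into
  \<open>q ^ P (M + 1)\<close>.
\<close>

lemma amp_step:
  assumes q: "0 < q" "q < 1" and j: "j \<le> M" and mono: "P M \<le> P (Suc M)" and eq: "\<And>l. l \<le> M \<Longrightarrow> P' l = P l"
  shows "\<bar>amp q (Suc M) j r P - amp q M j r P'\<bar> \<le> q ^ P (Suc M)"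
proof (cases "j = M")
  case True
  define t where "t = q ^ (2 * (P (Suc M) - P M + r))"
  have t: "0 \<le> t" "t \<le> 1" using q by (simp_all add: t_def power_le_one)
  have "1 - t \<le> sqrt (1 - t)"
  proof (rule real_le_rsqrt)
    show "(1 - t)\<^sup>2 \<le> 1 - t" using t by (simp add: power2_eq_square mult_left_le)
  qed
  moreover have "sqrt (1 - t) \<le> 1" using t by simp
  ultimately have s: "\<bar>sqrt (1 - t) - 1\<bar> \<le> t" by simp
  have "amp q (Suc M) j r P - amp q M j r P' = q ^ P M * (sqrt (1 - t) - 1)"
    using True eq[of M] by (simp add: amp_def t_def algebra_simps)
  then have "\<bar>amp q (Suc M) j r P - amp q M j r P'\<bar> = q ^ P M * \<bar>sqrt (1 - t) - 1\<bar>"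
    using q by (simp add: abs_mult)
  also have "\<dots> \<le> q ^ P M * t" using s q by (intro mult_left_mono) auto
  also have "\<dots> = q ^ (P M + 2 * (P (Suc M) - P M + r))" by (simp add: t_def power_add)
  also have "\<dots> \<le> q ^ P (Suc M)" using q mono by (intro power_decreasing) auto
  finally show ?thesis .
next
  case False
  then have "amp q (Suc M) j r P = amp q M j r P'" using j eq[of j] eq[of "Suc j"] by (simp add: amp_def)
  then show ?thesis using q by simp
qed

text \<open>
  The coefficients of \<open>\<pi>\<^sub>+ - \<pi>\<^sub>-\<close> at \<open>z\<^sub>i\<^sup>* z\<^sub>j\<close>.
\<close>

definition proj_diff :: "real \<Rightarrow> nat \<Rightarrow> nat \<Rightarrow> nat \<Rightarrow> (nat \<Rightarrow> nat) \<Rightarrow> real" where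
  "proj_diff q n i j p = (\<Sum>k\<le>n. if p \<in> V_indices n k then (-1) ^ k * proj_coeff q k i j p else 0)"

lemma proj_diff_witness:
  assumes "proj_diff q n i j p \<noteq> 0"
  shows "\<exists>k\<le>n. p \<in> V_indices n k \<and> proj_coeff q k i j p \<noteq> 0"
proof (rule ccontr)
  assume "\<not> ?thesis"
  then have "proj_diff q n i j p = 0" unfolding proj_diff_def by (intro sum.neutral) auto
  then show False using assms by simp
qed

text \<open>
  If \<open>i\<close> or \<open>j\<close> exceeds \<open>r - 1\<close>, the lower component contributes nothing and the upper one has the small factor
  \<open>q ^ p r\<close> (or is zero as well). Otherwise \<open>amp_step\<close> bounds the change of each of the two
  amplitudes, which accounts for the factor \<open>2\<close>.
\<close>

lemma proj_coeff_step:
  assumes q: "0 < q" "q < 1" and r: "1 \<le> r" "r \<le> n" and p: "p \<in> V_indices n (r - 1)" "p \<in> V_indices n r"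
  shows "\<bar>proj_coeff q r i j p - proj_coeff q (r - 1) i j p\<bar> \<le> 2 * q ^ p r"
proof -
  interpret R: sphere_component q n r using q r by (simp add: sphere_component_def)
  interpret S: sphere_component q n "r - 1" using q r by (simp add: sphere_component_def)
  have qr: "0 \<le> q ^ p r" using q by simp
  show ?thesis
  proof (cases "i \<le> r - 1 \<and> j \<le> r - 1")
    case True
    obtain M where M: "r = Suc M" using r by (cases r) auto
    have pM: "p M \<le> p (Suc M)" using R.V_mono[OF p(2), of M "Suc M"] M by simp
    define P where "P = p + eps i r"
    define P' where "P' = p + eps i M"
    have P: "P M \<le> P (Suc M)" "\<And>l. l \<le> M \<Longrightarrow> P' l = P l" "p r \<le> P (Suc M)"
      using pM True M by (auto simp: P_def P'_def eps_def)
    have "\<bar>amp q (Suc M) i (Suc 0) p - amp q M i (Suc 0) p\<bar> \<le> q ^ p r"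
      using amp_step[OF q, of i M p p "Suc 0"] True M pM by simp
    moreover have "\<bar>amp q (Suc M) j 0 P - amp q M j 0 P'\<bar> \<le> q ^ p r"
    proof -
      have "\<bar>amp q (Suc M) j 0 P - amp q M j 0 P'\<bar> \<le> q ^ P (Suc M)"
        using amp_step[OF q _ P(1,2), of j 0] True M by simp
      also have "\<dots> \<le> q ^ p r" using P(3) q by (intro power_decreasing) auto
      finally show ?thesis .
    qed
    moreover have "0 \<le> amp q (Suc M) j 0 P" "amp q (Suc M) j 0 P \<le> 1"
      "0 \<le> amp q M i (Suc 0) p" "amp q M i (Suc 0) p \<le> 1"
      using R.amp_bounds S.amp_bounds M by simp_all
    ultimately have "\<bar>(amp q (Suc M) i (Suc 0) p - amp q M i (Suc 0) p) * amp q (Suc M) j 0 P\<bar> \<le> q ^ p r * 1"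
      "\<bar>amp q M i (Suc 0) p * (amp q (Suc M) j 0 P - amp q M j 0 P')\<bar> \<le> 1 * q ^ p r"
      unfolding abs_mult by (intro mult_mono; simp add: qr)+
    moreover have "proj_coeff q r i j p - proj_coeff q (r - 1) i j p =
        (amp q (Suc M) i (Suc 0) p - amp q M i (Suc 0) p) * amp q (Suc M) j 0 P
        + amp q M i (Suc 0) p * (amp q (Suc M) j 0 P - amp q M j 0 P')"
      by (simp add: proj_coeff_def P_def P'_def M algebra_simps)
    ultimately show ?thesis by linarith
  next
    case False
    then have 0: "proj_coeff q (r - 1) i j p = 0"
      using S.amp_above by (auto simp: proj_coeff_def not_le)
    have nn: "0 \<le> proj_coeff q r i j p" unfolding proj_coeff_def using R.amp_bounds by simp
    have "proj_coeff q r i j p \<le> q ^ p r"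
    proof (cases "i \<le> r \<and> j \<le> r")
      case True
      then consider "i = r" | "j = r" using False by linarith
      then show ?thesis
      proof cases
        case 1
        then have "proj_coeff q r i j p \<le> q ^ p r * 1"
          unfolding proj_coeff_def using R.amp_bounds(2)[of i "Suc 0" p] R.amp_bounds
          by (intro mult_mono) (auto simp: qr)
        then show ?thesis by simp
      next
        case 2
        have "amp q r j 0 (p + eps i r) \<le> q ^ (p + eps i r) j" by (rule R.amp_bounds)
        also have "\<dots> \<le> q ^ p r" using q 2 by (intro power_decreasing) auto
        finally have "proj_coeff q r i j p \<le> 1 * q ^ p r"
          unfolding proj_coeff_def using R.amp_bounds by (intro mult_mono) auto
        then show ?thesis by simp
      qed
    next
      case False
      then show ?thesis using R.amp_above qr by (auto simp: proj_coeff_def not_le)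
    qed
    then show ?thesis using 0 nn by simp
  qed
qed

text \<open>
  At a multi-index with largest entry \<open>a = p r\<close> the coefficient is at most \<open>2 * q ^ a\<close> and the level at
  most \<open>n * a\<close>. The summand \<open>n\<close> on the left allows for the shift of the level by the operator.
\<close>

lemma proj_diff_bound:
  assumes q: "0 < q" "q < 1" and n: "n \<ge> 1" and nz: "proj_diff q n i j p \<noteq> 0"
  shows "\<bar>proj_diff q n i j p\<bar> * (real (level n p) + real n) \<le> 2 * real n / (1 - q)"
proof -
  obtain k where k: "p \<in> V_indices n k" "k \<le> n" using proj_diff_witness[OF nz] by blast
  obtain r where r: "1 \<le> r" "r \<le> n" and V: "\<And>k. k \<le> n \<Longrightarrow> p \<in> V_indices n k \<longleftrightarrow> k = r - 1 \<or> k = r"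
    by (rule V_indices_peak[OF k n]) blast
  interpret R: sphere_component q n r using q r by (simp add: sphere_component_def)
  have p: "p \<in> V_indices n (r - 1)" "p \<in> V_indices n r" using V r by auto
  have "proj_diff q n i j p = (\<Sum>k\<in>{r - 1, r}. (-1) ^ k * proj_coeff q k i j p)"
    unfolding proj_diff_def using V r by (intro sum.mono_neutral_cong_right) auto
  also have "\<dots> = (-1) ^ r * (proj_coeff q r i j p - proj_coeff q (r - 1) i j p)"
    using r by (cases r) (auto simp: algebra_simps)
  finally have D: "\<bar>proj_diff q n i j p\<bar> \<le> 2 * q ^ p r"
    using proj_coeff_step[OF q r p, of i j] by (simp add: abs_mult power_abs)
  have le: "p l \<le> p r" if l: "l \<in> {1..n}" for l
  proof (cases "l \<le> r")
    case True
    then show ?thesis using R.V_mono[OF p(2)] by simp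
  next
    case False
    have "p l \<le> p r" if "r \<le> l" "l \<le> n" for l
      using that
    proof (induction l rule: dec_induct)
      case (step l)
      then have "p (l + 1) < p l" using p(1) r by (simp add: V_indices_def)
      then show ?case using step by simp
    qed simp
    then show ?thesis using False l by simp
  qed
  have "level n p \<le> (\<Sum>l\<in>{1..n}. p r)" unfolding level_def by (intro sum_mono le)
  then have "level n p + n \<le> n * (p r + 1)" by simp
  then have lev: "real (level n p) + real n \<le> real n * (real (p r) + 1)"
    by (metis of_nat_1 of_nat_add of_nat_le_iff of_nat_mult)
  \<comment> \<open>each of the \<open>a + 1\<close> leading terms of the geometric series is at least \<open>q ^ a\<close>\<close>
  have geo: "(real a + 1) * q ^ a \<le> 1 / (1 - q)" for a
  proof -
    have "(real a + 1) * q ^ a = (\<Sum>l<Suc a. q ^ a)" by simp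
    also have "\<dots> \<le> (\<Sum>l<Suc a. q ^ l)" using q by (intro sum_mono power_decreasing) auto
    also have "\<dots> = (1 - q ^ Suc a) / (1 - q)" using q by (subst sum_gp_strict) auto
    also have "\<dots> \<le> 1 / (1 - q)" using q by (intro divide_right_mono) auto
    finally show ?thesis .
  qed
  have "\<bar>proj_diff q n i j p\<bar> * (real (level n p) + real n) \<le> (2 * q ^ p r) * (real n * (real (p r) + 1))"
    using D lev q by (intro mult_mono) auto
  also have "\<dots> = 2 * real n * ((real (p r) + 1) * q ^ p r)" by simp
  also have "\<dots> \<le> 2 * real n * (1 / (1 - q))" by (intro mult_left_mono geo) auto
  finally show ?thesis by simp
qed

lemma proj_diff_act:
  assumes q: "0 < q" "q < 1"
  shows "sum_act q n (evens n) (fzs i * fz j) \<psi> p - sum_act q n (odds n) (fzs i * fz j) \<psi> p =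
    of_real (proj_diff q n i j p) * \<psi> (proj_shift i j p)"
proof -
  let ?f = "\<lambda>k. free_act q n k (fzs i * fz j) \<psi> p"
  have comp: "sphere_component q n k" if "k \<le> n" for k using q that by (simp add: sphere_component_def)
  have "sum_act q n (evens n) (fzs i * fz j) \<psi> p - sum_act q n (odds n) (fzs i * fz j) \<psi> p =
      (\<Sum>k\<in>evens n. (-1) ^ k * ?f k) + (\<Sum>k\<in>odds n. (-1) ^ k * ?f k)"
    unfolding sum_act_def sum_fun_apply by (simp add: evens_def odds_def sum_negf)
  also have "\<dots> = (\<Sum>k\<in>evens n \<union> odds n. (-1) ^ k * ?f k)"
    by (rule sum.union_disjoint[symmetric]) (auto simp: evens_def odds_def)
  also have "evens n \<union> odds n = {..n}" by (auto simp: evens_def odds_def)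
  also have "(\<Sum>k\<in>{..n}. (-1) ^ k * ?f k) =
      (\<Sum>k\<le>n. of_real (if p \<in> V_indices n k then (-1) ^ k * proj_coeff q k i j p else 0) * \<psi> (proj_shift i j p))"
    by (intro sum.cong refl) (auto simp: sphere_component.proj_act[OF comp])
  also have "\<dots> = of_real (proj_diff q n i j p) * \<psi> (proj_shift i j p)"
    by (simp only: proj_diff_def of_real_sum sum_distrib_right)
  finally show ?thesis .
qed

lemma proj_diff_bounded:
  assumes q: "0 < q" "q < 1" and n: "n \<ge> 1" and ij: "i \<le> n" "j \<le> n"
  obtains B where "bounded_op (H_single n) B"
    "\<And>\<psi>. sum_act q n (evens n) (fzs i * fz j) (level_mult n \<psi>) - sum_act q n (odds n) (fzs i * fz j) (level_mult n \<psi>) = B \<psi>"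
proof
  let ?a = "\<lambda>p. complex_of_real (proj_diff q n i j p * real (level n (proj_shift i j p)))"
  let ?B = "pull (multi_indices n) ?a (proj_shift i j)"
  have witness: "\<exists>k. sphere_component q n k \<and> p \<in> V_indices n k \<and> proj_coeff q k i j p \<noteq> 0" if "proj_diff q n i j p \<noteq> 0" for p
    using proj_diff_witness[OF that] q by (auto simp: sphere_component_def)
  show "bounded_op (H_single n) ?B"
    unfolding H_single_def
  proof (rule bounded_op_pull)
    show "cmod (?a p) \<le> 2 * real n / (1 - q)" for p
    proof (cases "proj_diff q n i j p = 0")
      case False
      obtain k where k: "sphere_component q n k" "p \<in> V_indices n k" "proj_coeff q k i j p \<noteq> 0"
        using witness[OF False] by blast
      have "level n (proj_shift i j p) \<le> level n p + n"
        using sphere_component.proj_shift_level[OF k] ij by linarith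
      then have "real (level n (proj_shift i j p)) \<le> real (level n p) + real n" by linarith
      then have "\<bar>proj_diff q n i j p\<bar> * real (level n (proj_shift i j p)) \<le> \<bar>proj_diff q n i j p\<bar> * (real (level n p) + real n)"
        by (intro mult_left_mono) auto
      also have "\<dots> \<le> 2 * real n / (1 - q)" by (rule proj_diff_bound[OF q n False])
      finally show ?thesis by (simp only: norm_of_real abs_mult abs_of_nat)
    qed (use q in simp)
    show "inj_on (proj_shift i j) {p \<in> multi_indices n. ?a p \<noteq> 0}"
    proof (rule inj_onI)
      fix p p' assume "p \<in> {p \<in> multi_indices n. ?a p \<noteq> 0}" "p' \<in> {p \<in> multi_indices n. ?a p \<noteq> 0}"
        and eq: "proj_shift i j p = proj_shift i j p'"
      then have "proj_diff q n i j p \<noteq> 0" "proj_diff q n i j p' \<noteq> 0" by auto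
      then have "p + eps i j = p' + eps i j"
        using witness[of p] witness[of p'] sphere_component.proj_shift_inverse eq by metis
      then show "p = p'" by simp
    qed
    show "proj_shift i j p \<in> multi_indices n" if nz: "?a p \<noteq> 0" for p
    proof -
      obtain k where k: "sphere_component q n k" "p \<in> V_indices n k" "proj_coeff q k i j p \<noteq> 0"
        using witness[of p] nz by auto
      show ?thesis by (rule V_indices_multi[OF sphere_component.proj_coeff_nonzero(3)[OF k]])
    qed
  qed
  fix \<psi>
  show "sum_act q n (evens n) (fzs i * fz j) (level_mult n \<psi>) - sum_act q n (odds n) (fzs i * fz j) (level_mult n \<psi>) = ?B \<psi>"
  proof
    fix p
    have "proj_diff q n i j p = 0" if "p \<notin> multi_indices n"
      using witness[of p] that by (auto dest: V_indices_multi)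
    then show "(sum_act q n (evens n) (fzs i * fz j) (level_mult n \<psi>) - sum_act q n (odds n) (fzs i * fz j) (level_mult n \<psi>)) p = ?B \<psi> p"
      by (simp add: proj_diff_act[OF q] pull_def level_mult_def)
  qed
qed

subsection \<open>Bounded commutators\<close>

definition level_dom :: "nat \<Rightarrow> vec set" where
  "level_dom n = {\<psi> \<in> ell n. level_mult n \<psi> \<in> ell n}"

definition level_commutator :: "real \<Rightarrow> nat \<Rightarrow> nat set \<Rightarrow> free_elem \<Rightarrow> (vec \<Rightarrow> vec) \<Rightarrow> bool" where
  "level_commutator q n K x B \<longleftrightarrow> bounded_op (H_single n) B \<and>
     (\<forall>\<psi>\<in>level_dom n. level_mult n (sum_act q n K x \<psi>) = sum_act q n K x (level_mult n \<psi>) + B \<psi>)"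

definition level_parity_diff :: "real \<Rightarrow> nat \<Rightarrow> free_elem \<Rightarrow> (vec \<Rightarrow> vec) \<Rightarrow> bool" where
  "level_parity_diff q n x B \<longleftrightarrow> bounded_op (H_single n) B \<and>
     (\<forall>\<psi>\<in>level_dom n. sum_act q n (evens n) x (level_mult n \<psi>) - sum_act q n (odds n) x (level_mult n \<psi>) = B \<psi>)"

text \<open>
  The three bounds behind a bounded commutator with the Dirac operator: \<open>level_commutator\<close> says that \<open>B\<close>
  extends the commutator of the level with \<open>\<pi>\<^sub>+ x\<close> or \<open>\<pi>\<^sub>- x\<close>, and \<open>level_parity_diff\<close> that \<open>B\<close>
  extends \<open>\<pi>\<^sub>+ x - \<pi>\<^sub>- x\<close> times the level.
\<close>

definition smooth :: "real \<Rightarrow> nat \<Rightarrow> free_elem \<Rightarrow> bool" where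
  "smooth q n x \<longleftrightarrow> (\<exists>B. level_commutator q n (evens n) x B) \<and> (\<exists>B. level_commutator q n (odds n) x B) \<and>
     (\<exists>B. level_parity_diff q n x B)"

lemma smoothI:
  assumes "level_commutator q n (evens n) x Be" "level_commutator q n (odds n) x Bo" "level_parity_diff q n x B"
  shows "smooth q n x"
  using assms unfolding smooth_def by blast

lemma smoothE:
  assumes "smooth q n x"
  obtains Be Bo B where "level_commutator q n (evens n) x Be" "level_commutator q n (odds n) x Bo"
    "level_parity_diff q n x B"
  using assms unfolding smooth_def by blast

context orthogonal_components
begin

lemma level_commutator_dom:
  assumes B: "level_commutator q n K x B" and \<psi>: "\<psi> \<in> level_dom n"
  shows "sum_act q n K x \<psi> \<in> level_dom n"
  using assms sum_act_closed bounded_op_closed[of "H_single n" B \<psi>]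
  by (simp add: level_commutator_def level_dom_def)

lemma level_commutator_proj:
  "level_commutator q n K (fzs i * fz j)
     (\<lambda>\<psi>. hscale (H_single n) (of_int (int i - int j)) (sum_act q n K (fzs i * fz j) \<psi>))"
  unfolding level_commutator_def
proof (intro conjI ballI Hs.bounded_op_scaled sum_act_bounded)
  fix \<psi>
  have lin: "level_mult n (sum f A) = (\<Sum>k\<in>A. level_mult n (f k))" for f and A :: "nat set"
    by (rule ext) (simp add: level_mult_def sum_fun_apply sum_distrib_left)
  have "level_mult n (sum_act q n K (fzs i * fz j) \<psi>) = (\<Sum>k\<in>K. free_act q n k (fzs i * fz j) (level_mult n \<psi>)
      + hscale (H_single n) (of_int (int i - int j)) (free_act q n k (fzs i * fz j) \<psi>))"
    unfolding sum_act_def lin using component sphere_component.proj_act_level by (intro sum.cong) blast+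
  then show "level_mult n (sum_act q n K (fzs i * fz j) \<psi>) = sum_act q n K (fzs i * fz j) (level_mult n \<psi>)
      + hscale (H_single n) (of_int (int i - int j)) (sum_act q n K (fzs i * fz j) \<psi>)"
    by (simp only: sum_act_def sum.distrib Hs.vs.scale_sum_right)
qed

lemma level_commutator_add:
  assumes x: "level_commutator q n K x B" and y: "level_commutator q n K y B'"
  shows "level_commutator q n K (x + y) (\<lambda>\<psi>. B \<psi> + B' \<psi>)"
  unfolding level_commutator_def
proof (intro conjI ballI Hs.bounded_op_plus)
  fix \<psi> assume "\<psi> \<in> level_dom n"
  then have "level_mult n (sum_act q n K x \<psi>) = sum_act q n K x (level_mult n \<psi>) + B \<psi>"
    "level_mult n (sum_act q n K y \<psi>) = sum_act q n K y (level_mult n \<psi>) + B' \<psi>"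
    using x y by (simp_all only: level_commutator_def)
  then show "level_mult n (sum_act q n K (x + y) \<psi>) = sum_act q n K (x + y) (level_mult n \<psi>) + (B \<psi> + B' \<psi>)"
    by (simp only: sum_act_add level_mult_linear add_ac)
qed (use x y in \<open>simp_all only: level_commutator_def\<close>)

lemma level_commutator_scale:
  assumes x: "level_commutator q n K x B"
  shows "level_commutator q n K (free_const c * x) (\<lambda>\<psi>. hscale (H_single n) c (B \<psi>))"
  unfolding level_commutator_def
proof (intro conjI ballI Hs.bounded_op_scaled)
  fix \<psi> assume "\<psi> \<in> level_dom n"
  then have "level_mult n (sum_act q n K x \<psi>) = sum_act q n K x (level_mult n \<psi>) + B \<psi>"
    using x by (simp only: level_commutator_def)
  then show "level_mult n (sum_act q n K (free_const c * x) \<psi>) =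
      sum_act q n K (free_const c * x) (level_mult n \<psi>) + hscale (H_single n) c (B \<psi>)"
    by (simp only: sum_act_scale level_mult_linear Hs.vs.scale_right_distrib)
qed (use x in \<open>simp only: level_commutator_def\<close>)

lemma level_commutator_mult:
  assumes x: "level_commutator q n K x B" and y: "level_commutator q n K y B'"
  shows "level_commutator q n K (x * y) (\<lambda>\<psi>. sum_act q n K x (B' \<psi>) + B (sum_act q n K y \<psi>))"
  unfolding level_commutator_def
proof (intro conjI ballI)
  have B: "bounded_op (H_single n) B" "bounded_op (H_single n) B'" using x y by (simp_all only: level_commutator_def)
  show "bounded_op (H_single n) (\<lambda>\<psi>. sum_act q n K x (B' \<psi>) + B (sum_act q n K y \<psi>))"
    by (intro Hs.bounded_op_plus Hs.bounded_op_comp[OF sum_act_bounded B(2)] Hs.bounded_op_comp[OF B(1) sum_act_bounded])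
  fix \<psi> assume \<psi>: "\<psi> \<in> level_dom n"
  have "level_mult n (sum_act q n K x (sum_act q n K y \<psi>)) =
      sum_act q n K x (level_mult n (sum_act q n K y \<psi>)) + B (sum_act q n K y \<psi>)"
    using x level_commutator_dom[OF y \<psi>] by (simp only: level_commutator_def)
  moreover have "level_mult n (sum_act q n K y \<psi>) = sum_act q n K y (level_mult n \<psi>) + B' \<psi>"
    using y \<psi> by (simp only: level_commutator_def)
  ultimately show "level_mult n (sum_act q n K (x * y) \<psi>) = sum_act q n K (x * y) (level_mult n \<psi>)
      + (sum_act q n K x (B' \<psi>) + B (sum_act q n K y \<psi>))"
    by (simp only: sum_act_mult sum_act_linear add.assoc)
qed

end

context
  fixes q :: real and n :: nat
  assumes q: "0 < q" "q < 1" and n: "n \<ge> 1"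
begin

interpretation E: orthogonal_components q n "evens n" by (rule orthogonal_evens[OF q])
interpretation O: orthogonal_components q n "odds n" by (rule orthogonal_odds[OF q])

text \<open>
  Writing \<open>e\<close> and \<open>o\<close> for the even and odd representations and \<open>N\<close> for the level,
  \<open>e (x y) N - o (x y) N = e x (e y - o y) N + (e x - o x) o y N\<close>. In the last term \<open>o y N\<close> is \<open>N (o y)\<close>
  up to a bounded operator.
\<close>

lemma level_parity_diff_mult:
  assumes x: "level_parity_diff q n x B" and y: "level_parity_diff q n y B'"
    and yo: "level_commutator q n (odds n) y Bo"
  shows "level_parity_diff q n (x * y) (\<lambda>\<psi>. sum_act q n (evens n) x (B' \<psi>) + (B (sum_act q n (odds n) y \<psi>)
      - (sum_act q n (evens n) x (Bo \<psi>) - sum_act q n (odds n) x (Bo \<psi>))))" (is "level_parity_diff q n _ ?C")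
  unfolding level_parity_diff_def
proof (intro conjI ballI)
  let ?e = "sum_act q n (evens n)" and ?o = "sum_act q n (odds n)"
  have B: "bounded_op (H_single n) B" "bounded_op (H_single n) B'" "bounded_op (H_single n) Bo"
    using x y yo by (simp_all only: level_parity_diff_def level_commutator_def)
  show "bounded_op (H_single n) ?C"
    by (intro Hs.bounded_op_plus Hs.bounded_op_diff Hs.bounded_op_comp[OF E.sum_act_bounded B(2)]
        Hs.bounded_op_comp[OF B(1) O.sum_act_bounded] Hs.bounded_op_comp[OF E.sum_act_bounded B(3)]
        Hs.bounded_op_comp[OF O.sum_act_bounded B(3)])
  fix \<psi> assume \<psi>: "\<psi> \<in> level_dom n"
  let ?N = "level_mult n \<psi>"
  have 1: "?e x (level_mult n (?o y \<psi>)) - ?o x (level_mult n (?o y \<psi>)) = B (?o y \<psi>)"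
    using x O.level_commutator_dom[OF yo \<psi>] by (simp only: level_parity_diff_def)
  have 2: "level_mult n (?o y \<psi>) = ?o y ?N + Bo \<psi>" using yo \<psi> by (simp only: level_commutator_def)
  have 3: "?e y ?N - ?o y ?N = B' \<psi>" using y \<psi> by (simp only: level_parity_diff_def)
  have "?e (x * y) ?N - ?o (x * y) ?N = ?e x (?e y ?N - ?o y ?N) + (?e x (?o y ?N) - ?o x (?o y ?N))"
    by (simp add: E.sum_act_mult O.sum_act_mult sum_act_diff)
  also have "?e x (?o y ?N) - ?o x (?o y ?N) = B (?o y \<psi>) - (?e x (Bo \<psi>) - ?o x (Bo \<psi>))"
    unfolding 1[symmetric] 2 by (simp add: sum_act_linear algebra_simps)
  finally show "?e (x * y) ?N - ?o (x * y) ?N = ?C \<psi>" unfolding 3 .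
qed

lemma smooth_zero: "smooth q n 0"
  unfolding smooth_def level_commutator_def level_parity_diff_def using Hs.bounded_op_zero[of n]
  by (auto simp: sum_act_zero level_mult_linear intro!: exI[of _ "\<lambda>_. 0"])

lemma smooth_proj:
  assumes "i \<le> n" "j \<le> n" shows "smooth q n (fzs i * fz j)"
proof -
  obtain B where "bounded_op (H_single n) B"
    "\<And>\<psi>. sum_act q n (evens n) (fzs i * fz j) (level_mult n \<psi>) - sum_act q n (odds n) (fzs i * fz j) (level_mult n \<psi>) = B \<psi>"
    by (rule proj_diff_bounded[OF q n assms]) blast
  then have "level_parity_diff q n (fzs i * fz j) B" by (simp only: level_parity_diff_def) simp
  then show ?thesis by (rule smoothI[OF E.level_commutator_proj O.level_commutator_proj])
qed

lemma level_parity_diff_add: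
  assumes B: "level_parity_diff q n x B" "level_parity_diff q n y B'"
  shows "level_parity_diff q n (x + y) (\<lambda>\<psi>. B \<psi> + B' \<psi>)"
proof -
  have "sum_act q n (evens n) (x + y) \<xi> - sum_act q n (odds n) (x + y) \<xi> =
      (sum_act q n (evens n) x \<xi> - sum_act q n (odds n) x \<xi>) + (sum_act q n (evens n) y \<xi> - sum_act q n (odds n) y \<xi>)" for \<xi>
    by (simp only: sum_act_add add_diff_add)
  then show ?thesis using B by (simp add: level_parity_diff_def Hs.bounded_op_plus)
qed

lemma level_parity_diff_scale:
  assumes "level_parity_diff q n x B"
  shows "level_parity_diff q n (free_const c * x) (\<lambda>\<psi>. hscale (H_single n) c (B \<psi>))"
  using assms by (simp add: level_parity_diff_def Hs.bounded_op_scaled E.sum_act_scale O.sum_act_scale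
      Hs.vs.scale_right_diff_distrib[symmetric])

lemma smooth_add:
  assumes x: "smooth q n x" and y: "smooth q n y" shows "smooth q n (x + y)"
  by (rule smoothE[OF x], rule smoothE[OF y])
     (rule smoothI[OF E.level_commutator_add O.level_commutator_add level_parity_diff_add])

lemma smooth_scale:
  assumes x: "smooth q n x" shows "smooth q n (free_const c * x)"
  by (rule smoothE[OF x])
     (rule smoothI[OF E.level_commutator_scale O.level_commutator_scale level_parity_diff_scale])

lemma smooth_mult:
  assumes x: "smooth q n x" and y: "smooth q n y" shows "smooth q n (x * y)"
  by (rule smoothE[OF x], rule smoothE[OF y])
     (rule smoothI[OF E.level_commutator_mult O.level_commutator_mult level_parity_diff_mult])

text \<open>
  The set of generators \<open>z\<^sub>i\<^sup>* z\<^sub>j\<close> is closed under the star. Carrying an element and its star through the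
  induction therefore settles the star case without taking adjoints of bounded extensions.
\<close>

lemma projective_smooth:
  assumes "a \<in> carrier (projective_alg q n)"
  shows "\<exists>x\<in>free_carrier n. a = sphere_class q n x \<and> smooth q n x"
proof -
  have "a \<in> star_subalgebra_generated (sphere_alg q n) {proj_gen q n i j |i j. i \<le> n \<and> j \<le> n}"
    using assms by (simp add: projective_alg_def)
  then have "\<exists>x\<in>free_carrier n. a = sphere_class q n x \<and> smooth q n x \<and> smooth q n (free_star x)"
  proof induction
    case (gen a)
    then obtain i j where "i \<le> n" "j \<le> n" "a = proj_gen q n i j" by blast
    then show ?case
      by (intro bexI[of _ "fzs i * fz j"]) (simp_all add: proj_gen_class smooth_proj free_star_mult)
  next
    case zero
    show ?case by (intro bexI[of _ 0]) (simp_all add: sphere_class_zero smooth_zero)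
  next
    case (add a b)
    then obtain x y where "x \<in> free_carrier n" "a = sphere_class q n x" "smooth q n x" "smooth q n (free_star x)"
      "y \<in> free_carrier n" "b = sphere_class q n y" "smooth q n y" "smooth q n (free_star y)" by blast
    then show ?case by (intro bexI[of _ "x + y"]) (simp_all add: sphere_class_add free_star_add smooth_add)
  next
    case (mult a b)
    then obtain x y where "x \<in> free_carrier n" "a = sphere_class q n x" "smooth q n x" "smooth q n (free_star x)"
      "y \<in> free_carrier n" "b = sphere_class q n y" "smooth q n y" "smooth q n (free_star y)" by blast
    then show ?case by (intro bexI[of _ "x * y"]) (simp_all add: sphere_class_mult free_star_mult smooth_mult)
  next
    case (scale a c)
    then obtain x where "x \<in> free_carrier n" "a = sphere_class q n x" "smooth q n x" "smooth q n (free_star x)" by blast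
    then show ?case
      by (intro bexI[of _ "free_const c * x"])
         (simp_all add: sphere_class_scale free_star_mult free_star_const smooth_scale free_const_central[of "cnj c", symmetric])
  next
    case (star a)
    then obtain x where "x \<in> free_carrier n" "a = sphere_class q n x" "smooth q n x" "smooth q n (free_star x)" by blast
    then show ?case by (intro bexI[of _ "free_star x"]) (simp_all add: sphere_class_star)
  qed
  then show ?thesis by blast
qed

text \<open>
  The commutator is the block with the entries \<open>[N, o x] - (e x - o x) N\<close> and
  \<open>[N, e x] + (e x - o x) N\<close> off the diagonal, where \<open>N\<close> is the level and \<open>e\<close>, \<open>o\<close> are the even and odd
  representations.
\<close>

lemma Dirac_commutator:
  assumes a: "a \<in> carrier (projective_alg q n)"
  shows "(\<forall>x\<in>opdom (Dirac n). pi_total q n a x \<in> opdom (Dirac n)) \<and>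
    (\<exists>T. bounded_op (H_total n) T \<and>
      (\<forall>x\<in>opdom (Dirac n). T x = opapp (Dirac n) (pi_total q n a x) - pi_total q n a (opapp (Dirac n) x)))"
proof -
  obtain x where x: "x \<in> free_carrier n" "a = sphere_class q n x" and sm: "smooth q n x"
    using projective_smooth[OF a] by blast
  let ?e = "sum_act q n (evens n) x" and ?o = "sum_act q n (odds n) x"
  obtain Be Bo B where ops: "level_commutator q n (evens n) x Be" "level_commutator q n (odds n) x Bo"
    "level_parity_diff q n x B"
    using sm unfolding smooth_def by blast
  then have B: "bounded_op (H_single n) Be" "bounded_op (H_single n) Bo" "bounded_op (H_single n) B"
    "\<And>\<psi>. \<psi> \<in> level_dom n \<Longrightarrow> level_mult n (?e \<psi>) = ?e (level_mult n \<psi>) + Be \<psi>"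
    "\<And>\<psi>. \<psi> \<in> level_dom n \<Longrightarrow> level_mult n (?o \<psi>) = ?o (level_mult n \<psi>) + Bo \<psi>"
    "\<And>\<psi>. \<psi> \<in> level_dom n \<Longrightarrow> ?e (level_mult n \<psi>) - ?o (level_mult n \<psi>) = B \<psi>"
    by (simp_all only: level_commutator_def level_parity_diff_def)
  have pi: "pi_total q n a (\<phi>, \<psi>) = (?e \<phi>, ?o \<psi>)" if "\<phi> \<in> ell n" "\<psi> \<in> ell n" for \<phi> \<psi>
    using that by (simp add: pi_total_def pi_class q x)
  have dom: "(\<phi>, \<psi>) \<in> opdom (Dirac n) \<longleftrightarrow> \<phi> \<in> level_dom n \<and> \<psi> \<in> level_dom n" for \<phi> \<psi>
    by (auto simp: Dirac_dom level_dom_def)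
  let ?T = "\<lambda>(\<phi>, \<psi>). (0 + (Bo \<psi> - B \<psi>), (Be \<phi> + B \<phi>) + 0)"
  have T: "bounded_op (H_total n) ?T"
    unfolding H_total_def
    by (rule Hs.bounded_op_block[OF Hs.bounded_op_zero Hs.bounded_op_diff[OF B(2,3)] Hs.bounded_op_plus[OF B(1,3)] Hs.bounded_op_zero])
  show ?thesis
  proof (intro conjI ballI exI[of _ ?T] T)
    fix z assume z: "z \<in> opdom (Dirac n)"
    obtain \<phi> \<psi> where [simp]: "z = (\<phi>, \<psi>)" by (cases z)
    have d: "\<phi> \<in> level_dom n" "\<psi> \<in> level_dom n" using z dom by auto
    then have C: "\<phi> \<in> ell n" "\<psi> \<in> ell n" "level_mult n \<phi> \<in> ell n" "level_mult n \<psi> \<in> ell n"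
      by (simp_all add: level_dom_def)
    show "pi_total q n a z \<in> opdom (Dirac n)"
      using d C by (simp add: pi dom E.level_commutator_dom[OF ops(1)] O.level_commutator_dom[OF ops(2)])
    show "?T z = opapp (Dirac n) (pi_total q n a z) - pi_total q n a (opapp (Dirac n) z)"
      using C by (simp add: pi Dirac_app B(4)[OF d(1)] B(5)[OF d(2)] B(6)[OF d(1), symmetric] B(6)[OF d(2), symmetric])
  qed
qed

end

lemma grading_bounded: "bounded_op (H_total n) grading"
proof (rule Ht.bounded_op_cong')
  show "bounded_op (H_total n) (\<lambda>(\<phi>, \<psi>). (\<phi> + 0, 0 + - \<psi>))"
    unfolding H_total_def
    by (intro Hs.bounded_op_block Hs.bounded_op_id Hs.bounded_op_zero Hs.bounded_op_uminus)
qed (auto simp: grading_def)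

theorem mainTheorem2:
  fixes q :: real and n :: nat
  assumes "0 < q" and "q < 1" and "n \<ge> 1"
  shows "even_spectral_triple (projective_alg q n) (H_total n) (pi_total q n) grading (Dirac n) \<and>
         metric_dimension (H_total n) (Dirac n) = ereal (real n)"
proof
  show "metric_dimension (H_total n) (Dirac n) = ereal (real n)" by (rule Dirac_metric_dimension[OF assms(3)])
  have rep: "star_representation (projective_alg q n) (H_total n) (pi_total q n)"
    by (rule pi_star_representation[OF assms(1,2)])
  show "even_spectral_triple (projective_alg q n) (H_total n) (pi_total q n) grading (Dirac n)"
    unfolding even_spectral_triple_def
  proof (intro conjI)
    show "\<forall>x\<in>hcarrier (H_total n). grading (grading x) = x \<and> hadjoint (H_total n) grading x = grading x"
    proof
      fix x assume x: "x \<in> hcarrier (H_total n)"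
      have "hadjoint (H_total n) grading x = grading x"
      proof (rule Ht.hadjoint_eqI)
        show "grading x \<in> hcarrier (H_total n)" using x by (rule bounded_op_closed[OF grading_bounded])
        show "hinner (H_total n) (grading x) z = hinner (H_total n) x (grading z)" if "z \<in> hcarrier (H_total n)" for z
          by (cases x; cases z) (simp add: grading_def H_total_simps H_single_def ell2_inner)
      qed
      then show "grading (grading x) = x \<and> hadjoint (H_total n) grading x = grading x"
        by (simp add: grading_def split: prod.splits)
    qed
    show "\<forall>a\<in>carrier (projective_alg q n). \<forall>x\<in>hcarrier (H_total n).
        grading (pi_total q n a x) = pi_total q n a (grading x)"
    proof (intro ballI)
      fix a x assume "a \<in> carrier (projective_alg q n)" and x: "x \<in> hcarrier (H_total n)"
      then have bd: "bounded_op (H_total n) (pi_total q n a)" using rep by (simp add: star_representation_def)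
      obtain \<phi> \<psi> where [simp]: "x = (\<phi>, \<psi>)" by (cases x)
      have "pi_total q n a (- (0, \<psi>)) = - pi_total q n a (0, \<psi>)"
        using x by (intro Ht.bounded_op_minus[OF bd]) (simp add: H_total_simps)
      then show "grading (pi_total q n a x) = pi_total q n a (grading x)"
        by (simp add: grading_def pi_total_def)
    qed
    show "\<forall>x\<in>opdom (Dirac n). grading x \<in> opdom (Dirac n) \<and> grading (opapp (Dirac n) x) = - opapp (Dirac n) (grading x)"
      by (auto simp: grading_def Dirac_dom Dirac_app level_mult_linear)
    show "\<forall>a\<in>carrier (projective_alg q n).
       (\<forall>x\<in>opdom (Dirac n). pi_total q n a x \<in> opdom (Dirac n)) \<and>
       (\<exists>T. bounded_op (H_total n) T \<and>
            (\<forall>x\<in>opdom (Dirac n). T x = opapp (Dirac n) (pi_total q n a x) - pi_total q n a (opapp (Dirac n) x)))"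
      using Dirac_commutator[OF assms] by blast
  qed (rule projective_alg_star_algebra Ht.hilbert_space rep Dirac_self_adjoint Dirac_compact_resolvent grading_bounded)+
qed

end
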